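(* Let $f:\mathbb{N}^s\to\mathbb{R}_{\ge 0}$ be a function satisfying Property I (see context) with constants $C_{f,M}\le C_{f,E}$, $\varDelta>0$ and $\varpi_1,\dots,\varpi_s>0$. Let $\mathcal{K}$ be a finite index set and let $\alpha_{i,j}\ge 0$ for $1\le i\le s$, $j\in\mathcal{K}$. Let $\mathcal{P}\subset\mathbb{R}^s$ be the polyhedron defined by $$\sum_{i=1}^s \alpha_{i,j}\varpi_i^{-1}t_i\le 1\quad (j\in\mathcal{K}),\qquad t_i\ge 0\quad(1\le i\le s).$$ Assume that $\mathcal{P}$ is bounded and non-degenerate (not contained in an $(s-1)$-dimensional subspace of $\mathbb{R}^s$). Let $a$ be the maximal value of the linear function $\sum_{i=1}^s t_i$ on $\mathcal{P}$, let $F$ be the face of $\mathcal{P}$ on which this maximum is attained, and let $k=\dim F$. Assume that $F$ is not contained in a coordinate hyperplane of $\mathbb{R}^s$. For real $B$ put $$S^{f}(B):=\sum_{\substack{\mathbf{y}=(y_1,\dots,y_s)\in\mathbb{N}^s\\ \prod_{i=1}^s y_i^{\alpha_{i,j}}\le B\ \forall j\in\mathcal{K}}} f(\mathbf{y}).$$ Then for all sufficiently large $B$ $$S^f(B)=(s-1-k)!\,C_{f,M}\,c_{\mathcal{P}}\,(\log B)^kB^{a}+O\left(C_{f,E}(\log\log B)^{s}(\log B)^{k-1}B^{a}\right),$$ where $c_{\mathcal{P}}$ is the constant defined in the context.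
   Context: $\mathbb{N}$ denotes the positive integers. Property I for $f:\mathbb{N}^s\to\mathbb{R}_{\ge0}$: there are non-negative real constants $C_{f,M}\le C_{f,E}$ and $\varDelta>0$, $\varpi_i>0$ ($1\le i\le s$) such that for all $B_1,\dots,B_s\in\mathbb{R}_{\ge1}$ $$\sum_{1\le y_i\le B_i,\ 1\le i\le s}f(\mathbf{y})=C_{f,M}\prod_{i=1}^sB_i^{\varpi_i}+O\left(C_{f,E}\prod_{i=1}^sB_i^{\varpi_i}\left(\min_{1\le i\le s}B_i\right)^{-\varDelta}\right),$$ where the implied constant is independent of $f$. The constant $c_{\mathcal{P}}$: for $\delta>0$ let $H_\delta$ be the hyperplane $\sum_{i=1}^st_i=a-\delta$, equipped with the $(s-1)$-dimensional measure $\mathrm{meas}_{s-1}$ obtained by pulling back Lebesgue measure under the projection of $H_\delta$ to any coordinate hyperplane. Then $c_{\mathcal{P}}$ is the constant for which there is a constant $C$ depending only on $\mathcal{P}$ with $|\mathrm{meas}_{s-1}(H_\delta\cap\mathcal{P})-c_{\mathcal{P}}\delta^{s-1-k}|\le C\delta^{s-k}$ for all sufficiently small $\delta>0$. The implied constant in the conclusion and the meaning of "sufficiently large" may depend on $s$, $\mathcal K$, the $\alpha_{i,j}$, the $\varpi_i$, $\varDelta$ and the implied constant in Property I, but not otherwise on $f$, $C_{f,M}$, $C_{f,E}$. *)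

theory Defs
  imports "HOL-Analysis.Analysis"
begin

text \<open>The dimension \<open>s\<close> is \<open>CARD('n)\<close>. Elements of \<open>\<nat>\<^sup>s\<close> (with \<open>\<nat>\<close> the positive
  integers) are the \<open>y :: nat ^ 'n\<close> with all entries at least 1, and a function on \<open>\<nat>\<^sup>s\<close> is
  given by its values on these; nothing is required of its other values.\<close>

text \<open>The parameter \<open>A\<close> is the implied constant of the \<open>O\<close>-term. It is explicit so that it can
  be fixed before \<open>f\<close>, \<open>CM\<close> and \<open>CE\<close>.\<close>

definition property_I ::
    "real \<Rightarrow> real \<Rightarrow> ('n::finite \<Rightarrow> real) \<Rightarrow> real \<Rightarrow> real \<Rightarrow> (nat ^ 'n \<Rightarrow> real) \<Rightarrow> bool" where
  "property_I A \<Delta> \<omega> CM CE f \<longleftrightarrow>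
     (\<forall>y. (\<forall>i. 1 \<le> y $ i) \<longrightarrow> 0 \<le> f y) \<and>
     0 \<le> CM \<and> CM \<le> CE \<and> 0 < \<Delta> \<and> (\<forall>i. 0 < \<omega> i) \<and>
     (\<forall>B :: real ^ 'n. (\<forall>i. 1 \<le> B $ i) \<longrightarrow>
        \<bar>(\<Sum>y | \<forall>i. 1 \<le> y $ i \<and> real (y $ i) \<le> B $ i. f y)
           - CM * (\<Prod>i\<in>UNIV. (B $ i) powr \<omega> i)\<bar>
        \<le> A * (CE * (\<Prod>i\<in>UNIV. (B $ i) powr \<omega> i) * (MIN i. B $ i) powr (- \<Delta>)))"

definition polyhedron_P ::
    "'k set \<Rightarrow> ('n::finite \<Rightarrow> 'k \<Rightarrow> real) \<Rightarrow> ('n \<Rightarrow> real) \<Rightarrow> (real ^ 'n) set" where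
  "polyhedron_P K \<alpha> \<omega> =
     {t. (\<forall>j\<in>K. (\<Sum>i\<in>UNIV. \<alpha> i j * inverse (\<omega> i) * t $ i) \<le> 1) \<and> (\<forall>i. 0 \<le> t $ i)}"

definition max_value :: "(real ^ 'n::finite) set \<Rightarrow> real" where
  "max_value P = (GREATEST v. v \<in> (\<lambda>t. \<Sum>i\<in>UNIV. t $ i) ` P)"

definition max_face :: "(real ^ 'n::finite) set \<Rightarrow> (real ^ 'n) set" where
  "max_face P = {t \<in> P. (\<Sum>i\<in>UNIV. t $ i) = max_value P}"

text \<open>\<open>aff_dim\<close> is integer-valued only because it is \<open>-1\<close> on the empty set.\<close>

definition max_face_dim :: "(real ^ 'n::finite) set \<Rightarrow> nat" where
  "max_face_dim P = nat (aff_dim (max_face P))"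

definition hyperplane_H :: "(real ^ 'n::finite) set \<Rightarrow> real \<Rightarrow> (real ^ 'n) set" where
  "hyperplane_H P \<delta> = {t. (\<Sum>i\<in>UNIV. t $ i) = max_value P - \<delta>}"

text \<open>The measure of a subset \<open>X\<close> of some \<open>H\<^sub>\<delta>\<close>, pulled back from the coordinate hyperplane
  \<open>t\<^sub>i = 0\<close>. This hyperplane is identified with the functions on \<open>UNIV - {i}\<close>, with Lebesgue
  measure as the product of copies of \<open>lborel\<close>; for \<open>s = 1\<close> it is the unit mass on a single
  point. The value does not depend on \<open>i\<close>.\<close>

definition meas_H :: "'n \<Rightarrow> (real ^ 'n::finite) set \<Rightarrow> real" where
  "meas_H i X = measure (\<Pi>\<^sub>M j\<in>UNIV - {i}. (lborel :: real measure))
                  ((\<lambda>t. \<lambda>j\<in>UNIV - {i}. t $ j) ` X)"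

definition c_P :: "(real ^ 'n::finite) set \<Rightarrow> real" where
  "c_P P = (THE c. \<forall>i. \<exists>C. \<exists>\<delta>\<^sub>0 > 0. \<forall>\<delta>. 0 < \<delta> \<and> \<delta> < \<delta>\<^sub>0 \<longrightarrow>
      \<bar>meas_H i (hyperplane_H P \<delta> \<inter> P) - c * \<delta> ^ (CARD('n) - 1 - max_face_dim P)\<bar>
        \<le> C * \<delta> ^ (CARD('n) - max_face_dim P))"

text \<open>The range of summation is finite whenever \<open>polyhedron_P K \<alpha> \<omega>\<close> is bounded,
  \<open>\<alpha> \<ge> 0\<close> and \<open>\<omega> > 0\<close>: every \<open>i\<close> then has some \<open>j \<in> K\<close> with \<open>\<alpha> i j > 0\<close>.\<close>

definition S_sum ::
    "'k set \<Rightarrow> ('n::finite \<Rightarrow> 'k \<Rightarrow> real) \<Rightarrow> (nat ^ 'n \<Rightarrow> real) \<Rightarrow> real \<Rightarrow> real" where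
  "S_sum K \<alpha> f B =
     (\<Sum>y | (\<forall>i. 1 \<le> y $ i) \<and> (\<forall>j\<in>K. (\<Prod>i\<in>UNIV. real (y $ i) powr \<alpha> i j) \<le> B). f y)"

end

theory Submission
  imports Defs "HOL-Probability.Distributions"
begin

text \<open>
Put \<open>x i = \<omega> i * ln (y i)\<close> and \<open>L = ln B\<close>. The conditions on \<open>y\<close> say that \<open>x\<close> lies in \<open>L\<close> times
the polyhedron \<open>P\<close>, and by Property I the weights \<open>f\<close> of the box \<open>x \<le> b\<close> add up to
\<open>CM * exp (\<Sum>b)\<close> up to an error \<open>O(CE * exp (\<Sum>b - \<kappa> * min b))\<close>. So \<open>f\<close> behaves like the density
\<open>CM * exp (\<Sum>x)\<close>, and the sum should be \<open>CM * L ^ s * J L\<close> with \<open>J L\<close> the integral of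
\<open>exp (L * \<Sum>u)\<close> over \<open>u \<in> P\<close>.

The integral. Slicing \<open>P\<close> by the hyperplanes \<open>\<Sum>u = a - \<delta>\<close> turns \<open>J L\<close> into \<open>exp (a * L)\<close> times
the Laplace transform at \<open>L\<close> of the slice volume \<open>V \<delta>\<close>. With \<open>n = s - 1 - k\<close> one has
\<open>V \<delta> = c * \<delta> ^ n + O(\<delta> ^ (n + 1))\<close> (\<open>slice_asymptotic\<close>), whence
\<open>L ^ s * J L = n! * c * L ^ k * exp (a * L) + O(L ^ k / L * exp (a * L))\<close>, and \<open>c = c_P P\<close>
(\<open>exp_measure_P\<close>). For the slice volumes, a point at depth
\<open>\<delta>\<close> is written as a point of the affine hull of the maximal face \<open>F\<close> plus \<open>\<delta>\<close> times a transversal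
vector. This change of variables is a shear of determinant \<open>\<delta> ^ n\<close>, and the new variables stay
bounded because the distance of \<open>t \<in> P\<close> from \<open>F\<close> is \<open>O(a - \<Sum>t)\<close> (\<open>polytope_dist_face_le\<close>). An
inequality defining \<open>P\<close> that is an equality on \<open>F\<close> is independent of \<open>\<delta>\<close> in the new variables;
the truth of any other one changes with \<open>\<delta>\<close> only in a strip of width \<open>O(\<delta>)\<close>
(\<open>emeasure_pt_change_le\<close>). Hence the volume in the new variables converges linearly in \<open>\<delta>\<close>.

The boundary. No coordinate vanishes identically on \<open>F\<close>. The same strip argument therefore shows
that the part of \<open>P\<close> with \<open>u l \<le> \<epsilon>\<close> contributes to \<open>L ^ s * J L\<close> at most
\<open>O((\<epsilon> * L + 1) * L ^ k / L * exp (a * L))\<close> (\<open>exp_measure_near_hyperplane_le\<close>), and the weights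
\<open>f\<close> of the points with a coordinate \<open>x l \<le> T\<close> are bounded in the same way, with \<open>\<epsilon> = T / L\<close>
(\<open>sum_points_near_le\<close>). With \<open>T\<close> a multiple of \<open>ln L\<close> this is the source of the factor
\<open>ln (ln B)\<close>.

The comparison. The other points are sorted into cells of side \<open>1 / L\<close>. Inclusion-exclusion over
the corners turns Property I into an asymptotic formula for each cell (\<open>cell_sum_asymptotic\<close>), and
as all coordinates exceed \<open>T\<close> its error is so small that it can be multiplied by the number of
cells, a power of \<open>L\<close>. Since \<open>P\<close> contains with a point the whole box below it, moving the cells by
one step along the diagonal brings those that meet \<open>L\<close> times \<open>P\<close> inside it, or makes those inside
cover it up to the boundary part above; and such a step changes masses only by the factor
\<open>exp (\<plusminus> s / L)\<close> (\<open>outer_mass_le\<close>, \<open>inner_mass_ge\<close>). The two bounds sandwich the sum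
(\<open>sum_points_asymptotic\<close>).
\<close>

section \<open>Lebesgue measure on coordinate spaces\<close>

abbreviation leb_on :: "'a set \<Rightarrow> ('a \<Rightarrow> real) measure" where
  "leb_on J \<equiv> Pi\<^sub>M J (\<lambda>_. lborel)"

interpretation lborels: product_sigma_finite "\<lambda>_::'a. lborel :: real measure"
  by standard

lemma nn_integral_leb_on_affine:
  fixes d :: real
  assumes "finite W" "0 < d" and g: "g \<in> borel_measurable (leb_on W)"
  shows "(\<integral>\<^sup>+ z. g z \<partial>leb_on W)
       = ennreal (d ^ card W) * (\<integral>\<^sup>+ z. g (\<lambda>j\<in>W. c j + d * z j) \<partial>leb_on W)"
  using assms(1) g
proof (induction W arbitrary: g rule: finite_induct)
  case empty
  then show ?case by (simp add: PiM_empty nn_integral_count_space_finite restrict_def)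
next
  case (insert i W)
  note [measurable] = insert.prems
  let ?I = "\<lambda>x. \<integral>\<^sup>+ y. g (x(i := y)) \<partial>lborel"
  let ?T = "\<lambda>V z. \<lambda>j\<in>V. c j + d * z j"
  have T: "?T (insert i W) (x(i := y)) = (?T W x)(i := c i + d * y)" for x y
    using insert.hyps by (auto simp: fun_eq_iff)
  have meas_I: "?I \<in> borel_measurable (leb_on W)"
    by measurable
  have m1: "(\<lambda>y. g (x(i := y))) \<in> borel_measurable borel" if "x \<in> space (leb_on W)" for x
    using that by measurable
  have "(\<integral>\<^sup>+ z. g z \<partial>leb_on (insert i W)) = (\<integral>\<^sup>+ x. ?I x \<partial>leb_on W)"
    by (rule lborels.product_nn_integral_insert) (use insert in auto)
  also have "\<dots> = ennreal (d ^ card W) * (\<integral>\<^sup>+ x. ?I (?T W x) \<partial>leb_on W)"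
    by (rule insert.IH[OF meas_I])
  also have "(\<integral>\<^sup>+ x. ?I (?T W x) \<partial>leb_on W)
      = (\<integral>\<^sup>+ x. ennreal d * (\<integral>\<^sup>+ y. g ((?T W x)(i := c i + d * y)) \<partial>lborel) \<partial>leb_on W)"
  proof (rule nn_integral_cong)
    fix x :: "'a \<Rightarrow> real"
    have "?T W x \<in> space (leb_on W)"
      by (auto simp: space_PiM)
    from nn_integral_real_affine[OF m1[OF this], of d "c i"]
    show "?I (?T W x) = ennreal d * (\<integral>\<^sup>+ y. g ((?T W x)(i := c i + d * y)) \<partial>lborel)"
      using \<open>0 < d\<close> by simp
  qed
  also have "\<dots> = ennreal d * (\<integral>\<^sup>+ x. (\<integral>\<^sup>+ y. g (?T (insert i W) (x(i := y))) \<partial>lborel) \<partial>leb_on W)"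
    unfolding T
  proof (rule nn_integral_cmult)
    show "(\<lambda>x. \<integral>\<^sup>+ y. g ((?T W x)(i := c i + d * y)) \<partial>lborel) \<in> borel_measurable (leb_on W)"
      unfolding T[symmetric] by measurable
  qed
  also have "(\<integral>\<^sup>+ x. (\<integral>\<^sup>+ y. g (?T (insert i W) (x(i := y))) \<partial>lborel) \<partial>leb_on W)
      = (\<integral>\<^sup>+ z. g (?T (insert i W) z) \<partial>leb_on (insert i W))"
    by (rule lborels.product_nn_integral_insert[symmetric]) (use insert in auto)
  finally have eq: "(\<integral>\<^sup>+ z. g z \<partial>leb_on (insert i W)) = ennreal (d ^ card W) *
      (ennreal d * (\<integral>\<^sup>+ z. g (?T (insert i W) z) \<partial>leb_on (insert i W)))" .
  have d: "ennreal (d ^ card (insert i W)) = ennreal (d ^ card W) * ennreal d"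
    using insert.hyps \<open>0 < d\<close> by (simp add: ennreal_mult mult.commute)
  show ?case
    unfolding d eq by (simp only: mult.assoc)
qed

text \<open>The map is triangular: coordinates in \<open>K\<close> stay, and those in \<open>W\<close> are scaled by \<open>d\<close> after a
translation that depends on the coordinates in \<open>K\<close> only. By Fubini it suffices to treat each
fibre over \<open>K\<close>, where the translation is constant.\<close>

lemma nn_integral_leb_on_shear:
  fixes d :: real
  assumes fin: "finite K" "finite W" and disj: "K \<inter> W = {}" and "0 < d"
    and g[measurable]: "g \<in> borel_measurable (leb_on (K \<union> W))"
    and \<phi>[measurable]: "\<And>j. j \<in> W \<Longrightarrow> \<phi> j \<in> borel_measurable (leb_on K)"
  shows "(\<integral>\<^sup>+ z. g z \<partial>leb_on (K \<union> W)) = ennreal (d ^ card W) *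
      (\<integral>\<^sup>+ z. g (\<lambda>j\<in>K \<union> W. if j \<in> K then z j else \<phi> j (restrict z K) + d * z j) \<partial>leb_on (K \<union> W))"
proof -
  let ?T = "\<lambda>z. \<lambda>j\<in>K \<union> W. if j \<in> K then z j else \<phi> j (restrict z K) + d * z j"
  have T_meas: "?T \<in> leb_on (K \<union> W) \<rightarrow>\<^sub>M leb_on (K \<union> W)"
  proof (rule measurable_restrict)
    fix j assume j: "j \<in> K \<union> W"
    show "(\<lambda>z. if j \<in> K then z j else \<phi> j (restrict z K) + d * z j) \<in> leb_on (K \<union> W) \<rightarrow>\<^sub>M lborel"
    proof (cases "j \<in> K")
      case True
      then show ?thesis using j by simp
    next
      case False
      then have [measurable]: "\<phi> j \<in> borel_measurable (leb_on K)" using j by auto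
      have [measurable]: "(\<lambda>z. restrict z K) \<in> leb_on (K \<union> W) \<rightarrow>\<^sub>M leb_on K"
        by (rule measurable_restrict_subset) auto
      have [measurable]: "(\<lambda>z. z j) \<in> borel_measurable (leb_on (K \<union> W))"
        using j by (auto intro: measurable_component_singleton)
      show ?thesis using False by simp
    qed
  qed
  have gT[measurable]: "(\<lambda>z. g (?T z)) \<in> borel_measurable (leb_on (K \<union> W))"
    by (rule measurable_compose[OF T_meas g])
  have inner: "(\<integral>\<^sup>+ y. g (merge K W (x, y)) \<partial>leb_on W)
      = ennreal (d ^ card W) * (\<integral>\<^sup>+ y. g (?T (merge K W (x, y))) \<partial>leb_on W)"
    if x: "x \<in> space (leb_on K)" for x
  proof -
    have m: "(\<lambda>y. g (merge K W (x, y))) \<in> borel_measurable (leb_on W)"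
      using x by measurable
    have eq: "merge K W (x, \<lambda>j\<in>W. \<phi> j x + d * y j) = ?T (merge K W (x, y))" for y
    proof (rule ext)
      fix j
      have "restrict (merge K W (x, y)) K = x"
        using x by (auto simp: merge_def fun_eq_iff space_PiM PiE_def extensional_def)
      then show "merge K W (x, \<lambda>j\<in>W. \<phi> j x + d * y j) j = ?T (merge K W (x, y)) j"
        using disj by (simp add: merge_def)
    qed
    show ?thesis
      using nn_integral_leb_on_affine[OF fin(2) \<open>0 < d\<close> m, of "\<lambda>j. \<phi> j x"] unfolding eq .
  qed
  have "(\<integral>\<^sup>+ z. g z \<partial>leb_on (K \<union> W))
      = (\<integral>\<^sup>+ x. (\<integral>\<^sup>+ y. g (merge K W (x, y)) \<partial>leb_on W) \<partial>leb_on K)"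
    by (rule lborels.product_nn_integral_fold) (use fin disj in auto)
  also have "\<dots> = (\<integral>\<^sup>+ x. ennreal (d ^ card W) *
      (\<integral>\<^sup>+ y. g (?T (merge K W (x, y))) \<partial>leb_on W) \<partial>leb_on K)"
    by (rule nn_integral_cong) (rule inner)
  also have "\<dots> = ennreal (d ^ card W) *
      (\<integral>\<^sup>+ x. (\<integral>\<^sup>+ y. g (?T (merge K W (x, y))) \<partial>leb_on W) \<partial>leb_on K)"
  proof (rule nn_integral_cmult)
    interpret W: sigma_finite_measure "leb_on W" by (rule lborels.sigma_finite[OF fin(2)])
    show "(\<lambda>x. \<integral>\<^sup>+ y. g (?T (merge K W (x, y))) \<partial>leb_on W) \<in> borel_measurable (leb_on K)"
      by (rule W.borel_measurable_nn_integral) measurable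
  qed
  also have "(\<integral>\<^sup>+ x. (\<integral>\<^sup>+ y. g (?T (merge K W (x, y))) \<partial>leb_on W) \<partial>leb_on K)
      = (\<integral>\<^sup>+ z. g (?T z) \<partial>leb_on (K \<union> W))"
    by (rule lborels.product_nn_integral_fold[symmetric]) (use fin disj in auto)
  finally show ?thesis .
qed

lemma emeasure_leb_on_box:
  assumes "finite J" "0 \<le> M"
  shows "emeasure (leb_on J) (PiE J (\<lambda>_. {-M..M})) = ennreal ((2 * M) ^ card J)"
  using assms by (subst lborels.emeasure_PiM) (auto simp: ennreal_power)

text \<open>If some coefficient \<open>\<eta> i\<close> is nonzero, every line in direction \<open>i\<close> meets the strip in an interval
of length \<open>2 * \<epsilon> / \<bar>\<eta> i\<bar>\<close>. If all vanish, the functional is a nonzero constant \<open>h\<close>, the strip is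
empty for \<open>\<epsilon> < \<bar>h\<bar>\<close>, and for larger \<open>\<epsilon>\<close> the volume of the box is already \<open>O(\<epsilon>)\<close>.\<close>

lemma emeasure_strip_le:
  fixes \<eta> :: "'a \<Rightarrow> real"
  assumes fin: "finite J" and M: "0 \<le> M" and nz: "h \<noteq> 0 \<or> (\<exists>j\<in>J. \<eta> j \<noteq> 0)"
  shows "\<exists>C\<ge>0. \<forall>\<epsilon>\<ge>0. emeasure (leb_on J)
      {z \<in> PiE J (\<lambda>_. {-M..M}). \<bar>h + (\<Sum>j\<in>J. \<eta> j * z j)\<bar> \<le> \<epsilon>} \<le> ennreal (C * \<epsilon>)"
proof (cases "\<exists>j\<in>J. \<eta> j \<noteq> 0")
  case False
  then have h: "h \<noteq> 0" and S: "(\<Sum>j\<in>J. \<eta> j * z j) = 0" for z using nz by auto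
  define C where "C = (2 * M) ^ card J / \<bar>h\<bar>"
  have "C \<ge> 0" using M by (simp add: C_def)
  moreover have "emeasure (leb_on J) {z \<in> PiE J (\<lambda>_. {-M..M}). \<bar>h + (\<Sum>j\<in>J. \<eta> j * z j)\<bar> \<le> \<epsilon>}
      \<le> ennreal (C * \<epsilon>)" if "\<epsilon> \<ge> 0" for \<epsilon>
  proof (cases "\<bar>h\<bar> \<le> \<epsilon>")
    case True
    have "(2 * M) ^ card J * \<bar>h\<bar> \<le> (2 * M) ^ card J * \<epsilon>"
      using True M by (intro mult_left_mono) auto
    then have "(2 * M) ^ card J \<le> C * \<epsilon>"
      using h by (simp add: C_def field_simps)
    then show ?thesis
      using True by (simp add: S emeasure_leb_on_box[OF fin M] ennreal_leI)
  next
    case False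
    then show ?thesis by (simp add: S)
  qed
  ultimately show ?thesis by blast
next
  case True
  then obtain i where i: "i \<in> J" "\<eta> i \<noteq> 0" by auto
  define I where "I = J - {i}"
  have J: "J = insert i I" "i \<notin> I" "finite I" using i fin by (auto simp: I_def)
  define C where "C = 2 / \<bar>\<eta> i\<bar> * (2 * M) ^ card I"
  have "C \<ge> 0" using M by (simp add: C_def)
  moreover have "emeasure (leb_on J) {z \<in> PiE J (\<lambda>_. {-M..M}). \<bar>h + (\<Sum>j\<in>J. \<eta> j * z j)\<bar> \<le> \<epsilon>}
      \<le> ennreal (C * \<epsilon>)" (is "emeasure _ ?X \<le> _") if \<epsilon>: "\<epsilon> \<ge> 0" for \<epsilon>
  proof -
    have [measurable]: "?X \<in> sets (leb_on J)"
    proof -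
      have 1: "PiE J (\<lambda>_. {-M..M}) \<in> sets (leb_on J)"
        using fin by (intro sets_PiM_I_finite) auto
      have "{z \<in> space (leb_on J). \<bar>h + (\<Sum>j\<in>J. \<eta> j * z j)\<bar> \<le> \<epsilon>} \<in> sets (leb_on J)"
        by measurable
      from sets.Int[OF 1 this] show ?thesis
        by (rule back_subst[where P="\<lambda>x. x \<in> sets (leb_on J)"]) (auto simp: space_PiM PiE_def)
    qed
    have X'[measurable]: "?X \<in> sets (leb_on (insert i I))" using \<open>?X \<in> sets (leb_on J)\<close> J by simp
    have "emeasure (leb_on J) ?X = (\<integral>\<^sup>+ z. indicator ?X z \<partial>leb_on (insert i I))"
      using J by simp
    also have "\<dots> = (\<integral>\<^sup>+ x. (\<integral>\<^sup>+ y. indicator ?X (x(i := y)) \<partial>lborel) \<partial>leb_on I)"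
      by (rule lborels.product_nn_integral_insert) (use J in auto)
    also have "\<dots> \<le> (\<integral>\<^sup>+ x. ennreal (2 * \<epsilon> / \<bar>\<eta> i\<bar>) * indicator (PiE I (\<lambda>_. {-M..M})) x \<partial>leb_on I)"
    proof (rule nn_integral_mono)
      fix x assume x: "x \<in> space (leb_on I)"
      let ?s = "h + (\<Sum>j\<in>I. \<eta> j * x j)"
      let ?A = "{y. \<bar>y - (- ?s / \<eta> i)\<bar> \<le> \<epsilon> / \<bar>\<eta> i\<bar>}"
      have A: "?A = {- ?s / \<eta> i - \<epsilon> / \<bar>\<eta> i\<bar> .. - ?s / \<eta> i + \<epsilon> / \<bar>\<eta> i\<bar>}" by auto
      have sum: "(\<Sum>j\<in>J. \<eta> j * (x(i := y)) j) = \<eta> i * y + (\<Sum>j\<in>I. \<eta> j * x j)" for y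
      proof -
        have "(\<Sum>j\<in>I. \<eta> j * (x(i := y)) j) = (\<Sum>j\<in>I. \<eta> j * x j)"
          using J by (intro sum.cong) auto
        then show ?thesis using J by simp
      qed
      have "indicator ?X (x(i := y)) \<le> (indicator ?A y * indicator (PiE I (\<lambda>_. {-M..M})) x :: ennreal)" for y
      proof (cases "x(i := y) \<in> ?X")
        case True
        then have "\<bar>h + (\<Sum>j\<in>J. \<eta> j * (x(i := y)) j)\<bar> \<le> \<epsilon>"
          and box: "x(i := y) \<in> PiE J (\<lambda>_. {-M..M})"
          by blast+
        then have le: "\<bar>?s + \<eta> i * y\<bar> \<le> \<epsilon>"
          unfolding sum by (simp only: add.assoc add.commute[of "\<eta> i * y"])
        have "x \<in> PiE I (\<lambda>_. {-M..M})"
        proof (rule PiE_I)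
          fix j assume "j \<in> I"
          then have "(x(i := y)) j \<in> {-M..M}" using box J by (intro PiE_mem[OF box]) auto
          then show "x j \<in> {-M..M}" using J \<open>j \<in> I\<close> by (metis fun_upd_apply)
        next
          fix j assume "j \<notin> I"
          then show "x j = undefined" using x by (auto simp: space_PiM PiE_def extensional_def)
        qed
        moreover have "\<bar>y - (- ?s / \<eta> i)\<bar> = \<bar>?s + \<eta> i * y\<bar> / \<bar>\<eta> i\<bar>"
        proof -
          have "y - (- ?s / \<eta> i) = (?s + \<eta> i * y) / \<eta> i"
            using i by (simp add: add_divide_distrib diff_divide_distrib)
          then show ?thesis by (simp only: abs_divide)
        qed
        then have "y \<in> ?A" using le by (simp add: divide_right_mono)
        ultimately show ?thesis by (simp add: indicator_def)
      qed simp
      then have "(\<integral>\<^sup>+ y. indicator ?X (x(i := y)) \<partial>lborel)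
          \<le> (\<integral>\<^sup>+ y. indicator ?A y * indicator (PiE I (\<lambda>_. {-M..M})) x \<partial>lborel)"
        by (intro nn_integral_mono) auto
      also have "\<dots> = emeasure lborel ?A * indicator (PiE I (\<lambda>_. {-M..M})) x"
        unfolding A by (subst nn_integral_multc) auto
      also have "emeasure lborel ?A = ennreal (2 * \<epsilon> / \<bar>\<eta> i\<bar>)"
        unfolding A using \<epsilon> by (subst emeasure_lborel_Icc) (auto simp: field_simps)
      finally show "(\<integral>\<^sup>+ y. indicator ?X (x(i := y)) \<partial>lborel)
          \<le> ennreal (2 * \<epsilon> / \<bar>\<eta> i\<bar>) * indicator (PiE I (\<lambda>_. {-M..M})) x" .
    qed
    also have "\<dots> = ennreal (2 * \<epsilon> / \<bar>\<eta> i\<bar>) * emeasure (leb_on I) (PiE I (\<lambda>_. {-M..M}))"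
      using J by (subst nn_integral_cmult_indicator) (auto intro!: sets_PiM_I_finite)
    also have "\<dots> = ennreal (C * \<epsilon>)"
      unfolding emeasure_leb_on_box[OF \<open>finite I\<close> M] C_def
      using \<epsilon> M by (simp add: ennreal_mult[symmetric] mult_ac)
    finally show ?thesis .
  qed
  ultimately show ?thesis by blast
qed

lemma nn_integral_power_exp:
  fixes R :: real
  assumes R: "0 < R"
  shows "(\<integral>\<^sup>+ x. ennreal (x ^ m * exp (- (R * x))) * indicator {0..} x \<partial>lborel)
    = ennreal (fact m / R ^ Suc m)"
proof -
  have "ennreal (fact m) = (\<integral>\<^sup>+ x. ennreal (x ^ m * exp (- x)) * indicator {0..} x \<partial>lborel)"
    by (subst nn_intergal_power_times_exp_Ici) simp
  also have "\<dots> = ennreal R * (\<integral>\<^sup>+ x. ennreal ((R * x) ^ m * exp (- (R * x))) * indicator {0..} (R * x) \<partial>lborel)"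
    using R by (subst nn_integral_real_affine[where c=R and t=0]) auto
  also have "\<dots> = (\<integral>\<^sup>+ x. ennreal R * (ennreal ((R * x) ^ m * exp (- (R * x))) * indicator {0..} (R * x)) \<partial>lborel)"
    by (subst nn_integral_cmult) auto
  also have "\<dots> = (\<integral>\<^sup>+ x. ennreal (R ^ Suc m) * (ennreal (x ^ m * exp (- (R * x))) * indicator {0..} x) \<partial>lborel)"
  proof (rule nn_integral_cong)
    fix x :: real
    show "ennreal R * (ennreal ((R * x) ^ m * exp (- (R * x))) * indicator {0..} (R * x))
      = ennreal (R ^ Suc m) * (ennreal (x ^ m * exp (- (R * x))) * indicator {0..} x)"
    proof (cases "0 \<le> x")
      case True
      then show ?thesis
        using R by (simp add: ennreal_mult[symmetric] power_mult_distrib mult_ac)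
    next
      case False
      then have "\<not> 0 \<le> R * x" using R by (simp add: zero_le_mult_iff)
      with False show ?thesis by simp
    qed
  qed
  also have "\<dots> = ennreal (R ^ Suc m) * (\<integral>\<^sup>+ x. ennreal (x ^ m * exp (- (R * x))) * indicator {0..} x \<partial>lborel)"
    by (subst nn_integral_cmult) auto
  finally have eq: "ennreal (fact m) = ennreal (R ^ Suc m) *
      (\<integral>\<^sup>+ x. ennreal (x ^ m * exp (- (R * x))) * indicator {0..} x \<partial>lborel)" (is "_ = _ * ?I") .
  have "?I = ennreal (1 / R ^ Suc m) * (ennreal (R ^ Suc m) * ?I)"
    using R by (simp add: mult.assoc[symmetric] ennreal_mult[symmetric] del: power_Suc)
  also have "\<dots> = ennreal (fact m / R ^ Suc m)"
    unfolding eq[symmetric] using R by (simp add: ennreal_mult[symmetric])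
  finally show ?thesis .
qed

section \<open>Slices by hyperplanes of constant coordinate sum\<close>

definition lift :: "'n::finite \<Rightarrow> real \<Rightarrow> ('n \<Rightarrow> real) \<Rightarrow> real ^ 'n" where
  "lift i \<sigma> z = (\<chi> j. if j = i then \<sigma> - (\<Sum>l\<in>UNIV - {i}. z l) else z j)"

definition slice :: "(real ^ 'n::finite) set \<Rightarrow> 'n \<Rightarrow> real \<Rightarrow> ('n \<Rightarrow> real) set" where
  "slice X i \<sigma> = {z \<in> space (leb_on (UNIV - {i})). lift i \<sigma> z \<in> X}"

text \<open>In the coordinates \<open>u i = \<omega> i * ln (y i) / R\<close>, this is up to the factor \<open>R ^ CARD('n)\<close> the
density that Property I predicts for \<open>f\<close>: the box \<open>u \<le> b\<close> then gets about
\<open>exp (R * \<Sum>b)\<close>.\<close>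

definition exp_measure :: "real \<Rightarrow> ('n::finite \<Rightarrow> real) measure" where
  "exp_measure R = density (leb_on UNIV) (\<lambda>u. ennreal (exp (R * (\<Sum>j\<in>UNIV. u j))))"

lemma measurable_vec_lambda:
  assumes "\<And>j. (\<lambda>x. f x j :: real) \<in> borel_measurable M"
  shows "(\<lambda>x. \<chi> j. (f x j :: real)) \<in> M \<rightarrow>\<^sub>M (borel :: (real ^ 'n::finite) measure)"
  unfolding borel_measurable_euclidean_space[of "\<lambda>x. \<chi> j. f x j"]
  using assms by (auto simp: Basis_vec_def inner_axis)

lemma measurable_lift:
  "(\<lambda>p. lift i (snd p) (fst p)) \<in> leb_on (UNIV - {i}) \<Otimes>\<^sub>M lborel \<rightarrow>\<^sub>M borel"
  unfolding lift_def
proof (rule measurable_vec_lambda)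
  fix j
  have c[measurable]: "(\<lambda>p. fst p l) \<in> borel_measurable (leb_on (UNIV - {i}) \<Otimes>\<^sub>M lborel)"
    if "l \<noteq> i" for l
    using that measurable_compose[OF measurable_fst measurable_component_singleton, of l "UNIV - {i}"
        "\<lambda>_. lborel"] by simp
  have "(\<lambda>p. snd p - (\<Sum>l\<in>UNIV - {i}. fst p l)) \<in> borel_measurable (leb_on (UNIV - {i}) \<Otimes>\<^sub>M lborel)"
    by (intro borel_measurable_diff borel_measurable_sum) auto
  then show "(\<lambda>p. if j = i then snd p - (\<Sum>l\<in>UNIV - {i}. fst p l) else fst p j)
      \<in> borel_measurable (leb_on (UNIV - {i}) \<Otimes>\<^sub>M lborel)"
    using c by (cases "j = i") auto
qed

lemma measurable_lift_fixed [measurable]: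
  "lift i \<sigma> \<in> leb_on (UNIV - {i}) \<rightarrow>\<^sub>M borel"
proof -
  have "(\<lambda>z. (z, \<sigma>)) \<in> leb_on (UNIV - {i}) \<rightarrow>\<^sub>M leb_on (UNIV - {i}) \<Otimes>\<^sub>M lborel"
    by simp
  from measurable_compose[OF this measurable_lift] show ?thesis by simp
qed

lemma sets_slice [measurable]:
  "X \<in> sets borel \<Longrightarrow> slice X i \<sigma> \<in> sets (leb_on (UNIV - {i}))"
  using measurable_sets[OF measurable_lift_fixed]
  by (simp add: slice_def vimage_def Int_def conj_commute)

lemma sum_lift: "(\<Sum>j\<in>UNIV. lift i \<sigma> z $ j) = \<sigma>"
proof -
  have "(\<Sum>j\<in>UNIV. lift i \<sigma> z $ j) = lift i \<sigma> z $ i + (\<Sum>j\<in>UNIV - {i}. lift i \<sigma> z $ j)"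
    by (simp add: sum.remove)
  also have "(\<Sum>j\<in>UNIV - {i}. lift i \<sigma> z $ j) = (\<Sum>j\<in>UNIV - {i}. z j)"
    by (intro sum.cong) (auto simp: lift_def)
  finally show ?thesis by (simp add: lift_def)
qed

text \<open>The substitution that replaces the coordinate \<open>u i\<close> by the sum \<open>\<sigma>\<close> of all coordinates has
determinant 1, and the density depends on \<open>\<sigma>\<close> only.\<close>

lemma emeasure_exp_measure_slices:
  fixes X :: "(real ^ 'n::finite) set"
  assumes X[measurable]: "X \<in> sets borel"
  shows "emeasure (exp_measure R) {u. (\<chi> j. u j) \<in> X}
    = (\<integral>\<^sup>+ \<sigma>. ennreal (exp (R * \<sigma>)) * emeasure (leb_on (UNIV - {i})) (slice X i \<sigma>) \<partial>lborel)"
proof -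
  let ?J = "UNIV - {i}"
  let ?Y = "{u. (\<chi> j. u j) \<in> X}"
  let ?S = "\<lambda>u :: 'n \<Rightarrow> real. \<Sum>j\<in>UNIV. u j"
  interpret J: sigma_finite_measure "leb_on ?J" by (rule lborels.sigma_finite) simp
  interpret P: pair_sigma_finite "leb_on ?J" lborel ..
  have vec[measurable]: "(\<lambda>u. \<chi> j. u j) \<in> leb_on UNIV \<rightarrow>\<^sub>M (borel :: (real ^ 'n) measure)"
    by (rule measurable_vec_lambda) simp
  have Y[measurable]: "?Y \<in> sets (leb_on UNIV)"
    using measurable_sets[OF vec X] by (simp add: vimage_def space_PiM PiE_def)
  have S[measurable]: "?S \<in> borel_measurable (leb_on UNIV)" by simp
  have ins: "UNIV = insert i ?J" by auto
  have upd: "(\<chi> j. (x(i := t + 1 * \<sigma>)) j) = lift i \<sigma> x" "?S (x(i := t + 1 * \<sigma>)) = \<sigma>"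
    if "t = - (\<Sum>l\<in>?J. x l)" for x t \<sigma>
  proof -
    show eq: "(\<chi> j. (x(i := t + 1 * \<sigma>)) j) = lift i \<sigma> x"
      using that by (auto simp: lift_def vec_eq_iff)
    have "?S (x(i := t + 1 * \<sigma>)) = (\<Sum>j\<in>UNIV. (\<chi> j. (x(i := t + 1 * \<sigma>)) j) $ j)" by simp
    then show "?S (x(i := t + 1 * \<sigma>)) = \<sigma>" unfolding eq sum_lift .
  qed
  have "emeasure (exp_measure R) ?Y = (\<integral>\<^sup>+ u. ennreal (exp (R * ?S u)) * indicator ?Y u \<partial>leb_on UNIV)"
    unfolding exp_measure_def by (subst emeasure_density) auto
  also have "\<dots> = (\<integral>\<^sup>+ u. ennreal (exp (R * ?S u)) * indicator ?Y u \<partial>leb_on (insert i ?J))"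
    using ins by simp
  also have "\<dots> = (\<integral>\<^sup>+ x. (\<integral>\<^sup>+ y. ennreal (exp (R * ?S (x(i := y)))) * indicator ?Y (x(i := y)) \<partial>lborel) \<partial>leb_on ?J)"
  proof (rule lborels.product_nn_integral_insert)
    show "(\<lambda>u. ennreal (exp (R * ?S u)) * indicator ?Y u) \<in> borel_measurable (leb_on (insert i ?J))"
      unfolding ins[symmetric] by measurable
  qed auto
  also have "\<dots> = (\<integral>\<^sup>+ x. (\<integral>\<^sup>+ \<sigma>. ennreal (exp (R * \<sigma>)) * indicator X (lift i \<sigma> x) \<partial>lborel) \<partial>leb_on ?J)"
  proof (rule nn_integral_cong)
    fix x assume x: "x \<in> space (leb_on ?J)"
    let ?t = "- (\<Sum>l\<in>?J. x l)"
    have up: "(\<lambda>y. x(i := y)) \<in> lborel \<rightarrow>\<^sub>M leb_on UNIV"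
      using x measurable_fun_upd[of UNIV ?J i "\<lambda>_. x" lborel "\<lambda>_. lborel" "\<lambda>y. y"] by auto
    have m: "(\<lambda>y. ennreal (exp (R * ?S (x(i := y)))) * indicator ?Y (x(i := y))) \<in> borel_measurable borel"
      using measurable_compose[OF up, of "\<lambda>u. ennreal (exp (R * ?S u)) * indicator ?Y u" borel]
      by simp
    have ind: "indicator ?Y (x(i := ?t + 1 * \<sigma>)) = (indicator X (lift i \<sigma> x) :: ennreal)" for \<sigma>
      by (simp only: indicator_def mem_Collect_eq upd(1)[OF refl])
    show "(\<integral>\<^sup>+ y. ennreal (exp (R * ?S (x(i := y)))) * indicator ?Y (x(i := y)) \<partial>lborel)
        = (\<integral>\<^sup>+ \<sigma>. ennreal (exp (R * \<sigma>)) * indicator X (lift i \<sigma> x) \<partial>lborel)"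
      by (subst nn_integral_real_affine[OF m, of 1 ?t])
         (simp_all only: upd(2)[OF refl] ind, simp)
  qed
  also have "\<dots> = (\<integral>\<^sup>+ \<sigma>. (\<integral>\<^sup>+ x. ennreal (exp (R * \<sigma>)) * indicator X (lift i \<sigma> x) \<partial>leb_on ?J) \<partial>lborel)"
  proof (rule P.Fubini'[symmetric])
    have [measurable]: "(\<lambda>p. indicator X (lift i (snd p) (fst p)) :: ennreal)
        \<in> borel_measurable (leb_on ?J \<Otimes>\<^sub>M lborel)"
      by (rule measurable_compose[OF measurable_lift]) simp
    show "(\<lambda>(x, \<sigma>). ennreal (exp (R * \<sigma>)) * indicator X (lift i \<sigma> x))
        \<in> borel_measurable (leb_on ?J \<Otimes>\<^sub>M lborel)"
      unfolding case_prod_beta by measurable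
  qed
  also have "\<dots> = (\<integral>\<^sup>+ \<sigma>. ennreal (exp (R * \<sigma>)) * emeasure (leb_on ?J) (slice X i \<sigma>) \<partial>lborel)"
  proof (rule nn_integral_cong)
    fix \<sigma> :: real
    have "(\<integral>\<^sup>+ x. ennreal (exp (R * \<sigma>)) * indicator X (lift i \<sigma> x) \<partial>leb_on ?J)
        = (\<integral>\<^sup>+ x. ennreal (exp (R * \<sigma>)) * indicator (slice X i \<sigma>) x \<partial>leb_on ?J)"
      by (rule nn_integral_cong) (auto simp: slice_def indicator_def)
    then show "(\<integral>\<^sup>+ x. ennreal (exp (R * \<sigma>)) * indicator X (lift i \<sigma> x) \<partial>leb_on ?J)
        = ennreal (exp (R * \<sigma>)) * emeasure (leb_on ?J) (slice X i \<sigma>)"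
      by (simp add: nn_integral_cmult_indicator)
  qed
  finally show ?thesis .
qed

lemma restrict_hyperplane_eq_slice:
  "(\<lambda>t. \<lambda>j\<in>UNIV - {i}. t $ j) ` ({t. (\<Sum>j\<in>UNIV. t $ j) = \<sigma>} \<inter> X) = slice X i \<sigma>"
proof (intro equalityI subsetI)
  fix z assume "z \<in> (\<lambda>t. \<lambda>j\<in>UNIV - {i}. t $ j) ` ({t. (\<Sum>j\<in>UNIV. t $ j) = \<sigma>} \<inter> X)"
  then obtain t where t: "(\<Sum>j\<in>UNIV. t $ j) = \<sigma>" "t \<in> X" and z: "z = (\<lambda>j\<in>UNIV - {i}. t $ j)" by auto
  have "(\<Sum>j\<in>UNIV - {i}. z j) = (\<Sum>j\<in>UNIV - {i}. t $ j)"
    by (intro sum.cong) (auto simp: z)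
  moreover have "\<sigma> = t $ i + (\<Sum>j\<in>UNIV - {i}. t $ j)"
    unfolding t(1)[symmetric] by (simp add: sum.remove)
  ultimately have "lift i \<sigma> z = t"
    by (auto simp: lift_def vec_eq_iff z)
  then show "z \<in> slice X i \<sigma>"
    using t by (auto simp: slice_def space_PiM z)
next
  fix z assume z: "z \<in> slice X i \<sigma>"
  then have "z = (\<lambda>j\<in>UNIV - {i}. lift i \<sigma> z $ j)"
    by (auto simp: slice_def space_PiM PiE_def extensional_def lift_def fun_eq_iff)
  then show "z \<in> (\<lambda>t. \<lambda>j\<in>UNIV - {i}. t $ j) ` ({t. (\<Sum>j\<in>UNIV. t $ j) = \<sigma>} \<inter> X)"
    using z sum_lift[of i \<sigma> z] by (auto simp: slice_def intro!: image_eqI[where x="lift i \<sigma> z"])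
qed

lemma meas_H_slice:
  "meas_H i (hyperplane_H P \<delta> \<inter> P) = measure (leb_on (UNIV - {i})) (slice P i (max_value P - \<delta>))"
  unfolding meas_H_def hyperplane_H_def restrict_hyperplane_eq_slice ..

section \<open>A distance bound and adapted coordinates for a face\<close>

text \<open>The defect \<open>a - u \<bullet> t\<close> of a convex combination \<open>t\<close> of vertices is the weighted mean of the
defects of the vertices. A vertex off the face has a positive defect, so the total weight of such
vertices is \<open>O(a - u \<bullet> t)\<close>; moving that weight to one point of the face displaces \<open>t\<close> by
as much at most.\<close>

lemma polytope_dist_face_le:
  fixes P :: "'a::euclidean_space set"
  assumes "polytope P" "P \<noteq> {}" and a: "\<And>t. t \<in> P \<Longrightarrow> u \<bullet> t \<le> a" and q: "q \<in> P" "u \<bullet> q = a"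
  shows "\<exists>C\<ge>0. \<forall>t\<in>P. \<exists>q\<in>P. u \<bullet> q = a \<and> norm (t - q) \<le> C * (a - u \<bullet> t)"
proof -
  obtain V where V: "finite V" "P = convex hull V" using assms(1) by (auto simp: polytope_def)
  have VP: "V \<subseteq> P" using V(2) hull_subset[of V convex] by simp
  \<comment> \<open>the vertices off the face\<close>
  define Z where "Z = {v \<in> V. u \<bullet> v \<noteq> a}"
  \<comment> \<open>\<open>Z\<close> may be empty; the summand 1 in the witness makes \<open>m\<close> positive\<close>
  have "\<exists>m>0. \<forall>v\<in>Z. norm (v - q) \<le> m * (a - u \<bullet> v)"
  proof -
    have pos: "a - u \<bullet> v > 0" if "v \<in> Z" for v
      using that a[of v] VP by (auto simp: Z_def)
    have fin: "finite Z" using V by (simp add: Z_def)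
    define m where "m = 1 + (\<Sum>v\<in>Z. norm (v - q) / (a - u \<bullet> v))"
    have nn: "0 \<le> norm (v - q) / (a - u \<bullet> v)" if "v \<in> Z" for v
      using pos[OF that] by simp
    have "m > 0" unfolding m_def using sum_nonneg[of Z "\<lambda>v. norm (v - q) / (a - u \<bullet> v)"] nn by auto
    moreover have "norm (v - q) \<le> m * (a - u \<bullet> v)" if v: "v \<in> Z" for v
    proof -
      have "norm (v - q) / (a - u \<bullet> v) \<le> (\<Sum>v\<in>Z. norm (v - q) / (a - u \<bullet> v))"
        by (rule member_le_sum[OF v]) (use nn fin in auto)
      then have "norm (v - q) / (a - u \<bullet> v) \<le> m" by (simp add: m_def)
      then show ?thesis using pos[OF v] by (simp add: field_simps)
    qed
    ultimately show ?thesis by blast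
  qed
  then obtain m where m: "m > 0" "\<And>v. v \<in> Z \<Longrightarrow> norm (v - q) \<le> m * (a - u \<bullet> v)" by auto
  have "\<exists>q'\<in>P. u \<bullet> q' = a \<and> norm (t - q') \<le> m * (a - u \<bullet> t)" if t: "t \<in> P" for t
  proof -
    obtain w where w: "\<forall>v\<in>V. 0 \<le> w v" "sum w V = 1" "(\<Sum>v\<in>V. w v *\<^sub>R v) = t"
      using t unfolding V(2) convex_hull_finite[OF V(1)] by auto
    define q' where "q' = (\<Sum>v\<in>V. w v *\<^sub>R (if v \<in> Z then q else v))"
    have "q' \<in> P"
      unfolding q'_def
    proof (rule convex_sum)
      show "convex P" using V by simp
    qed (use V w q VP in auto)
    moreover have "u \<bullet> q' = (\<Sum>v\<in>V. w v * a)"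
      unfolding q'_def inner_sum_right by (intro sum.cong) (auto simp: q Z_def)
    then have "u \<bullet> q' = a" using w by (simp add: sum_distrib_right[symmetric])
    moreover have "norm (t - q') \<le> m * (a - u \<bullet> t)"
    proof -
      have "t - q' = (\<Sum>v\<in>V. w v *\<^sub>R (v - (if v \<in> Z then q else v)))"
        unfolding q'_def w(3)[symmetric] by (simp add: sum_subtractf scaleR_diff_right)
      then have "norm (t - q') \<le> (\<Sum>v\<in>V. norm (w v *\<^sub>R (v - (if v \<in> Z then q else v))))"
        by (simp only: norm_sum)
      also have "\<dots> \<le> (\<Sum>v\<in>V. w v * (m * (a - u \<bullet> v)))"
      proof (rule sum_mono)
        fix v assume v: "v \<in> V"
        show "norm (w v *\<^sub>R (v - (if v \<in> Z then q else v))) \<le> w v * (m * (a - u \<bullet> v))"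
          using v w m a[of v] VP by (cases "v \<in> Z") (auto intro!: mult_left_mono)
      qed
      also have "\<dots> = m * ((\<Sum>v\<in>V. w v) * a - (\<Sum>v\<in>V. w v * (u \<bullet> v)))"
        by (simp add: sum_distrib_left sum_distrib_right algebra_simps sum_subtractf)
      also have "(\<Sum>v\<in>V. w v * (u \<bullet> v)) = u \<bullet> t"
        unfolding w(3)[symmetric] by (simp add: inner_sum_right)
      also have "(\<Sum>v\<in>V. w v) = 1" by (rule w(2))
      finally show ?thesis by simp
    qed
    ultimately show ?thesis by blast
  qed
  then show ?thesis using m(1) by (intro exI[of _ m]) auto
qed

text \<open>\<open>K\<close> is a smallest set of coordinates, not containing \<open>i\<close>, such that a vector of \<open>L\<close> is
determined by its entries in \<open>K\<close>. All coordinates but \<open>i\<close> have this property because the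
entries sum to zero. Minimality yields, for each \<open>j \<in> K\<close>, a nonzero vector of \<open>L\<close> whose only
nonzero entry in \<open>K\<close> is the one at \<open>j\<close>; normalised, these form the basis \<open>b\<close>. Its
duality to coordinates is what makes the change of variables below a shear.\<close>

lemma subspace_coordinate_basis:
  fixes L :: "(real ^ 'n::finite) set"
  assumes L: "subspace L" and zero: "\<And>v. v \<in> L \<Longrightarrow> (\<Sum>j\<in>UNIV. v $ j) = 0"
  shows "\<exists>K b. i \<notin> K \<and> card K = dim L \<and> (\<forall>j\<in>K. b j \<in> L) \<and>
      (\<forall>j\<in>K. \<forall>l\<in>K. b j $ l = (if j = l then 1 else 0)) \<and>
      (\<forall>v\<in>L. v = (\<Sum>j\<in>K. (v $ j) *\<^sub>R b j))"
proof -
  define G where "G K \<longleftrightarrow> i \<notin> K \<and> (\<forall>v\<in>L. (\<forall>j\<in>K. v $ j = 0) \<longrightarrow> v = 0)" for K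
  have "G (UNIV - {i})"
    unfolding G_def
  proof (intro conjI ballI impI)
    fix v assume v: "v \<in> L" "\<forall>j\<in>UNIV - {i}. v $ j = 0"
    have "(\<Sum>j\<in>UNIV. v $ j) = v $ i + (\<Sum>j\<in>UNIV - {i}. v $ j)"
      by (simp add: sum.remove)
    then have "v $ i = 0" using zero[OF v(1)] v(2) by simp
    then show "v = 0" using v(2) by (auto simp: vec_eq_iff)
  qed simp
  then obtain K where K: "G K" and min: "\<And>K'. G K' \<Longrightarrow> card K \<le> card K'"
    using ex_has_least_nat[of G "UNIV - {i}" card] by auto
  have "\<exists>b. b \<in> L \<and> (\<forall>l\<in>K. b $ l = (if j = l then 1 else 0))" if j: "j \<in> K" for j
  proof -
    have "\<not> G (K - {j})"
      using min[of "K - {j}"] j by (metis card_Diff1_less finite leD)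
    then obtain v where v: "v \<in> L" "\<forall>l\<in>K - {j}. v $ l = 0" "v \<noteq> 0"
      using K by (auto simp: G_def)
    have "v $ j \<noteq> 0"
      using v K by (auto simp: G_def)
    then show ?thesis
      using v L by (intro exI[of _ "(1 / v $ j) *\<^sub>R v"]) (auto simp: subspace_scale)
  qed
  then obtain b where b: "\<And>j. j \<in> K \<Longrightarrow> b j \<in> L"
      "\<And>j l. j \<in> K \<Longrightarrow> l \<in> K \<Longrightarrow> b j $ l = (if j = l then 1 else 0)"
    by metis
  have sum_nth: "(\<Sum>j\<in>K. c j *\<^sub>R b j) $ l = c l" if "l \<in> K" for c l
  proof -
    have "(\<Sum>j\<in>K. c j *\<^sub>R b j) $ l = (\<Sum>j\<in>K. if j = l then c l else 0)"
      unfolding sum_component by (intro sum.cong) (auto simp: b that)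
    then show ?thesis using that by simp
  qed
  have rep: "v = (\<Sum>j\<in>K. (v $ j) *\<^sub>R b j)" if v: "v \<in> L" for v
  proof -
    have "v - (\<Sum>j\<in>K. (v $ j) *\<^sub>R b j) \<in> L"
      using L v b by (intro subspace_diff subspace_sum subspace_scale) auto
    moreover have "\<forall>l\<in>K. (v - (\<Sum>j\<in>K. (v $ j) *\<^sub>R b j)) $ l = 0"
      using sum_nth by simp
    ultimately have "v - (\<Sum>j\<in>K. (v $ j) *\<^sub>R b j) = 0"
      using K unfolding G_def by blast
    then show ?thesis by simp
  qed
  have inj: "inj_on b K"
    using b(2) by (intro inj_onI) (metis zero_neq_one)
  have indep: "independent (b ` K)"
  proof (rule independent_if_scalars_zero)
    fix f x assume f: "(\<Sum>x\<in>b ` K. f x *\<^sub>R x) = 0" and "x \<in> b ` K"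
    then obtain l where l: "l \<in> K" "x = b l" by auto
    have "(\<Sum>j\<in>K. f (b j) *\<^sub>R b j) = 0" using f inj by (simp add: sum.reindex)
    then show "f x = 0" using sum_nth[OF l(1), of "\<lambda>j. f (b j)"] l by simp
  qed simp
  have "L \<subseteq> span (b ` K)"
  proof
    fix v assume "v \<in> L"
    then have "v = (\<Sum>j\<in>K. (v $ j) *\<^sub>R b j)" by (rule rep)
    then show "v \<in> span (b ` K)"
      by (metis (no_types, lifting) image_eqI span_base span_scale span_sum)
  qed
  then have "dim L = card (b ` K)"
    using indep b by (intro dim_unique[of "b ` K"]) auto
  then have "card K = dim L" using inj by (simp add: card_image)
  then show ?thesis
    using K b rep unfolding G_def by (intro exI[of _ K] exI[of _ b]) auto
qed

section \<open>Volumes of slices near the maximal face\<close>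

locale bounded_polyhedron =
  fixes M :: "'m set" and \<beta> :: "'m \<Rightarrow> real" and \<gamma> :: "'m \<Rightarrow> real ^ 'n::finite"
    and P :: "(real ^ 'n) set"
  assumes finite_M: "finite M"
    and P_eq: "P = {t. \<forall>m\<in>M. 0 \<le> \<beta> m + \<gamma> m \<bullet> t}"
    and bounded_P: "bounded P"
    and P_nonempty: "P \<noteq> {}"
begin

abbreviation a :: real where "a \<equiv> max_value P"
abbreviation F :: "(real ^ 'n) set" where "F \<equiv> max_face P"
abbreviation codim :: nat where "codim \<equiv> CARD('n) - 1 - max_face_dim P"

lemma sum_eq_inner: "(\<Sum>j\<in>UNIV. (t :: real ^ 'n) $ j) = (\<chi> j. 1) \<bullet> t"
  by (simp add: inner_vec_def)

lemma polytope_P: "polytope P"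
proof -
  have "0 \<le> \<beta> m + \<gamma> m \<bullet> t \<longleftrightarrow> - \<beta> m \<le> \<gamma> m \<bullet> t" for m t by linarith
  then have "P = \<Inter> ((\<lambda>m. {t. - \<beta> m \<le> \<gamma> m \<bullet> t}) ` M)"
    unfolding P_eq by auto
  moreover have "polyhedron (\<Inter> ((\<lambda>m. {t. - \<beta> m \<le> \<gamma> m \<bullet> t}) ` M))"
    using finite_M by (intro polyhedron_Inter) (auto intro: polyhedron_halfspace_ge)
  ultimately show ?thesis using bounded_P by (simp add: polytope_eq_bounded_polyhedron)
qed

lemma closed_P: "closed P"
  using polytope_P by (simp add: polytope_imp_compact compact_imp_closed)

lemma borel_P [measurable]: "P \<in> sets borel"
  using closed_P by simp

lemma a_attained: "\<exists>q\<in>P. (\<Sum>j\<in>UNIV. q $ j) = a"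
  and sum_le_a: "t \<in> P \<Longrightarrow> (\<Sum>j\<in>UNIV. t $ j) \<le> a"
proof -
  have "compact P" using polytope_P by (rule polytope_imp_compact)
  moreover have "continuous_on P (\<lambda>t. \<Sum>j\<in>UNIV. t $ j)"
    by (intro continuous_intros)
  ultimately obtain q where q: "q \<in> P" "\<And>t. t \<in> P \<Longrightarrow> (\<Sum>j\<in>UNIV. t $ j) \<le> (\<Sum>j\<in>UNIV. q $ j)"
    using continuous_attains_sup[of P "\<lambda>t. \<Sum>j\<in>UNIV. t $ j"] P_nonempty by blast
  have "a = (\<Sum>j\<in>UNIV. q $ j)"
    unfolding max_value_def by (rule Greatest_equality) (use q in auto)
  then show "\<exists>q\<in>P. (\<Sum>j\<in>UNIV. q $ j) = a" "t \<in> P \<Longrightarrow> (\<Sum>j\<in>UNIV. t $ j) \<le> a"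
    using q by auto
qed

lemma face_dist_le:
  "\<exists>C\<ge>0. \<forall>t\<in>P. \<exists>q\<in>F. norm (t - q) \<le> C * (a - (\<Sum>j\<in>UNIV. t $ j))"
proof -
  obtain q where "q \<in> P" "(\<Sum>j\<in>UNIV. q $ j) = a" using a_attained by auto
  from polytope_dist_face_le[OF polytope_P P_nonempty _ this(1), of "\<chi> j. 1" a] this sum_le_a
  show ?thesis unfolding max_face_def sum_eq_inner by blast
qed

end

text \<open>Coordinates near the maximal face \<open>F\<close>, adapted to slices that are measured after dropping the
coordinate \<open>i\<close>. The coordinates in \<open>K\<close> parametrise the affine hull of \<open>F\<close>, through the basis
\<open>b\<close> of its direction space that is dual to them; the remaining coordinates other than \<open>i\<close> measure
the displacement from this affine hull.\<close>

locale slice_coordinates = bounded_polyhedron M \<beta> \<gamma> P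
  for M :: "'m set" and \<beta> \<gamma> and P :: "(real ^ 'n::finite) set" +
  fixes i :: 'n and K :: "'n set" and b :: "'n \<Rightarrow> real ^ 'n" and p :: "real ^ 'n"
  assumes i_notin: "i \<notin> K" and card_K: "card K = max_face_dim P"
    and p_in: "p \<in> F"
    and b_span: "\<And>j. j \<in> K \<Longrightarrow> b j \<in> span ((\<lambda>q. q - p) ` F)"
    and b_dual: "\<And>j l. j \<in> K \<Longrightarrow> l \<in> K \<Longrightarrow> b j $ l = (if j = l then 1 else 0)"
    and F_rep: "\<And>q. q \<in> F \<Longrightarrow> q = p + (\<Sum>j\<in>K. (q $ j - p $ j) *\<^sub>R b j)"
begin

abbreviation J :: "'n set" where "J \<equiv> UNIV - {i}"
abbreviation W :: "'n set" where "W \<equiv> UNIV - {i} - K"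

definition dir :: "('n \<Rightarrow> real) \<Rightarrow> real ^ 'n" where
  "dir z = (\<Sum>j\<in>W. z j *\<^sub>R (axis j 1 - axis i 1)) - axis i 1"

text \<open>The point of the hyperplane at depth \<open>\<delta>\<close> below the maximum with parameters \<open>z\<close>: a point of the affine
hull of \<open>F\<close> plus \<open>\<delta>\<close> times a vector \<open>dir z\<close> of coordinate sum \<open>-1\<close>. Near the face a slice has
size \<open>\<delta>\<close> in the transversal directions, so the parameters stay bounded as \<open>\<delta>\<close> tends to 0.\<close>

definition pt :: "real \<Rightarrow> ('n \<Rightarrow> real) \<Rightarrow> real ^ 'n" where
  "pt \<delta> z = p + (\<Sum>j\<in>K. (z j - p $ j) *\<^sub>R b j) + \<delta> *\<^sub>R dir z"

lemma J_split: "J = K \<union> W" "K \<inter> W = {}"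
  using i_notin by auto

lemma card_W: "card W = codim"
proof -
  have "card W = card J - card K" using i_notin by (intro card_Diff_subset) auto
  then show ?thesis by (simp add: card_K)
qed

lemma sum_b: "j \<in> K \<Longrightarrow> (\<Sum>l\<in>UNIV. b j $ l) = 0"
proof -
  assume "j \<in> K"
  then have "b j \<in> span ((\<lambda>q. q - p) ` F)" by (rule b_span)
  also have "\<dots> \<subseteq> {v. (\<chi> j. 1) \<bullet> v = 0}"
  proof (rule span_minimal)
    show "(\<lambda>q. q - p) ` F \<subseteq> {v. (\<chi> j. 1) \<bullet> v = 0}"
      using p_in by (auto simp: max_face_def sum_eq_inner inner_diff_right)
    show "subspace {v :: real ^ 'n. (\<chi> j. 1) \<bullet> v = 0}" by (rule subspace_hyperplane)
  qed
  finally show ?thesis by (simp add: sum_eq_inner)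
qed

lemma sum_axis: "(\<Sum>l\<in>UNIV. axis j (1::real) $ l) = 1"
  by (simp add: axis_def)

lemma sum_pt: "(\<Sum>l\<in>UNIV. pt \<delta> z $ l) = a - \<delta>"
proof -
  have "(\<chi> j. 1) \<bullet> b j = 0" if "j \<in> K" for j
    using sum_b[OF that] by (simp add: sum_eq_inner)
  moreover have "(\<chi> j. 1) \<bullet> axis j (1::real) = 1" for j :: 'n
    using sum_axis[of j] by (simp add: sum_eq_inner)
  moreover have "(\<chi> j. 1) \<bullet> p = a"
    using p_in by (simp add: max_face_def sum_eq_inner)
  ultimately show ?thesis
    unfolding sum_eq_inner pt_def dir_def
    by (simp add: inner_add_right inner_diff_right inner_sum_right)
qed

lemma dir_nth: "j \<noteq> i \<Longrightarrow> dir z $ j = (if j \<in> K then 0 else z j)"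
proof -
  assume j: "j \<noteq> i"
  have "dir z $ j = (\<Sum>l\<in>W. z l * (if j = l then 1 else 0))"
    using j by (simp add: dir_def axis_def)
  also have "\<dots> = (\<Sum>l\<in>W. if l = j then z j else 0)"
    by (intro sum.cong) auto
  finally show ?thesis using j by simp
qed

lemma pt_nth_K: "j \<in> K \<Longrightarrow> pt \<delta> z $ j = z j"
proof -
  assume j: "j \<in> K"
  have "(\<Sum>l\<in>K. (z l - p $ l) * b l $ j) = (\<Sum>l\<in>K. if l = j then z j - p $ j else 0)"
    by (intro sum.cong) (auto simp: b_dual j)
  moreover have "j \<noteq> i" using j i_notin by auto
  ultimately show ?thesis using j by (simp add: pt_def dir_nth)
qed

lemma pt_nth_W: "j \<in> W \<Longrightarrow> pt \<delta> z $ j = p $ j + (\<Sum>l\<in>K. (z l - p $ l) * b l $ j) + \<delta> * z j"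
  by (simp add: pt_def dir_nth)

lemma lift_pt: "lift i (a - \<delta>) (\<lambda>j\<in>J. pt \<delta> z $ j) = pt \<delta> z"
proof -
  have "(\<Sum>l\<in>UNIV. pt \<delta> z $ l) = pt \<delta> z $ i + (\<Sum>l\<in>J. pt \<delta> z $ l)"
    by (simp add: sum.remove)
  then show ?thesis by (auto simp: lift_def vec_eq_iff sum_pt)
qed

text \<open>In the coordinates other than \<open>i\<close>, the map \<open>pt \<delta>\<close> fixes those in \<open>K\<close> and scales the other
\<open>codim\<close> ones by \<open>\<delta>\<close> after a shift that depends on those in \<open>K\<close>.\<close>

lemma emeasure_slice:
  assumes \<delta>: "0 < \<delta>" and [measurable]: "X \<in> sets borel"
  shows "emeasure (leb_on J) (slice X i (a - \<delta>))
    = ennreal (\<delta> ^ codim) * emeasure (leb_on J) {z \<in> space (leb_on J). pt \<delta> z \<in> X}"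
    and "{z \<in> space (leb_on J). pt \<delta> z \<in> X} \<in> sets (leb_on J)"
proof -
  define \<phi> where "\<phi> j z = p $ j + (\<Sum>l\<in>K. (z l - p $ l) * b l $ j)" for j z
  define T where "T z = (\<lambda>j\<in>J. if j \<in> K then z j else \<phi> j (restrict z K) + \<delta> * z j)" for z
  have T_pt: "T z = (\<lambda>j\<in>J. pt \<delta> z $ j)" for z
    by (auto simp: T_def \<phi>_def fun_eq_iff pt_nth_K pt_nth_W)
  have T_iff: "T z \<in> slice X i (a - \<delta>) \<longleftrightarrow> pt \<delta> z \<in> X" for z
    by (simp add: slice_def T_pt lift_pt space_PiM)
  have [measurable]: "\<phi> j \<in> borel_measurable (leb_on K)" for j
    unfolding \<phi>_def by measurable
  have compK[measurable]: "(\<lambda>z. z l) \<in> borel_measurable (leb_on J)" if "l \<in> J" for l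
    using measurable_component_singleton[OF that, of "\<lambda>_. lborel"] by simp
  have [measurable]: "(\<lambda>z. restrict z K) \<in> leb_on J \<rightarrow>\<^sub>M leb_on K"
    by (rule measurable_restrict_subset) (use i_notin in auto)
  have T_meas[measurable]: "T \<in> leb_on J \<rightarrow>\<^sub>M leb_on J"
    unfolding T_def
  proof (rule measurable_restrict)
    fix j assume "j \<in> J"
    then show "(\<lambda>z. if j \<in> K then z j else \<phi> j (restrict z K) + \<delta> * z j) \<in> leb_on J \<rightarrow>\<^sub>M lborel"
      by (cases "j \<in> K") auto
  qed
  have "T -` slice X i (a - \<delta>) \<inter> space (leb_on J) \<in> sets (leb_on J)"
    by (rule measurable_sets[OF T_meas]) simp
  also have "T -` slice X i (a - \<delta>) \<inter> space (leb_on J) = {z \<in> space (leb_on J). pt \<delta> z \<in> X}"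
    using T_iff by auto
  finally show *[measurable]: "{z \<in> space (leb_on J). pt \<delta> z \<in> X} \<in> sets (leb_on J)" .
  have "emeasure (leb_on J) (slice X i (a - \<delta>)) = (\<integral>\<^sup>+ z. indicator (slice X i (a - \<delta>)) z \<partial>leb_on J)"
    by simp
  also have "\<dots> = ennreal (\<delta> ^ card W) * (\<integral>\<^sup>+ z. indicator (slice X i (a - \<delta>)) (T z) \<partial>leb_on J)"
    using nn_integral_leb_on_shear[of K W \<delta> "indicator (slice X i (a - \<delta>))" \<phi>] \<delta> J_split
    unfolding T_def by (simp add: J_split(1)[symmetric])
  also have "(\<integral>\<^sup>+ z. indicator (slice X i (a - \<delta>)) (T z) \<partial>leb_on J)
      = (\<integral>\<^sup>+ z. indicator {z \<in> space (leb_on J). pt \<delta> z \<in> X} z \<partial>leb_on J)"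
    by (rule nn_integral_cong) (auto simp: indicator_def T_iff)
  finally show "emeasure (leb_on J) (slice X i (a - \<delta>))
    = ennreal (\<delta> ^ codim) * emeasure (leb_on J) {z \<in> space (leb_on J). pt \<delta> z \<in> X}"
    by (simp add: card_W)
qed

text \<open>A point of \<open>P\<close> at depth \<open>\<delta>\<close> has distance \<open>O(\<delta>)\<close> from \<open>F\<close>, so that its displacement
\<open>\<delta> * z j\<close> from the affine hull of \<open>F\<close> is \<open>O(\<delta>)\<close> too.\<close>

lemma pt_box: "\<exists>B\<ge>0. \<forall>\<delta>>0. \<forall>z\<in>space (leb_on J). pt \<delta> z \<in> P \<longrightarrow> z \<in> PiE J (\<lambda>_. {-B..B})"
proof -
  obtain C where C: "C \<ge> 0" "\<And>t. t \<in> P \<Longrightarrow> \<exists>q\<in>F. norm (t - q) \<le> C * (a - (\<Sum>j\<in>UNIV. t $ j))"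
    using face_dist_le by auto
  obtain B1 where B1: "\<And>t. t \<in> P \<Longrightarrow> norm t \<le> B1"
    using bounded_P by (auto simp: bounded_iff)
  define S where "S = (\<Sum>l\<in>UNIV. \<Sum>j\<in>UNIV. \<bar>b l $ j\<bar>)"
  define B where "B = \<bar>B1\<bar> + C * (1 + S)"
  have S0: "S \<ge> 0" by (simp add: S_def sum_nonneg)
  then have B0: "B \<ge> 0" using C by (simp add: B_def)
  have "\<bar>z j\<bar> \<le> B" if \<delta>: "\<delta> > 0" and z: "pt \<delta> z \<in> P" and j: "j \<in> J" for \<delta> z j
  proof (cases "j \<in> K")
    case True
    have "\<bar>z j\<bar> \<le> norm (pt \<delta> z)"
      using component_le_norm_cart[of "pt \<delta> z" j] by (simp add: pt_nth_K True)
    also have "\<dots> \<le> B"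
    proof -
      have "0 \<le> C * (1 + S)" using C(1) S0 by simp
      then show ?thesis using B1[OF z] unfolding B_def by linarith
    qed
    finally show ?thesis .
  next
    case False
    obtain q where q: "q \<in> F" "norm (pt \<delta> z - q) \<le> C * \<delta>"
      using C(2)[OF z] by (auto simp: sum_pt)
    have comp: "\<bar>pt \<delta> z $ l - q $ l\<bar> \<le> C * \<delta>" for l
      using component_le_norm_cart[of "pt \<delta> z - q" l] q(2) by simp
    have "q $ j = p $ j + (\<Sum>l\<in>K. (q $ l - p $ l) * b l $ j)"
      by (subst F_rep[OF q(1)]) simp
    then have "\<delta> * z j = (pt \<delta> z $ j - q $ j) - (\<Sum>l\<in>K. (z l - q $ l) * b l $ j)"
      using j False by (simp add: pt_nth_W algebra_simps sum_subtractf)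
    also have "\<bar>\<dots>\<bar> \<le> C * \<delta> + (\<Sum>l\<in>K. C * \<delta> * \<bar>b l $ j\<bar>)"
    proof -
      have "\<bar>\<Sum>l\<in>K. (z l - q $ l) * b l $ j\<bar> \<le> (\<Sum>l\<in>K. \<bar>(z l - q $ l) * b l $ j\<bar>)"
        by (rule sum_abs)
      also have "\<dots> \<le> (\<Sum>l\<in>K. C * \<delta> * \<bar>b l $ j\<bar>)"
      proof (rule sum_mono)
        fix l assume "l \<in> K"
        then have "\<bar>z l - q $ l\<bar> \<le> C * \<delta>" using comp[of l] by (simp add: pt_nth_K)
        then show "\<bar>(z l - q $ l) * b l $ j\<bar> \<le> C * \<delta> * \<bar>b l $ j\<bar>"
          by (simp add: abs_mult mult_right_mono)
      qed
      finally show ?thesis using comp[of j] by linarith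
    qed
    also have "(\<Sum>l\<in>K. C * \<delta> * \<bar>b l $ j\<bar>) \<le> C * \<delta> * S"
    proof -
      have "(\<Sum>l\<in>K. \<bar>b l $ j\<bar>) \<le> (\<Sum>l\<in>UNIV. \<bar>b l $ j\<bar>)"
        by (rule sum_mono2) auto
      also have "\<dots> \<le> S" unfolding S_def
        by (intro sum_mono member_le_sum) auto
      finally show ?thesis
        using C(1) \<delta> by (simp add: sum_distrib_left[symmetric] mult_left_mono)
    qed
    finally have "\<delta> * \<bar>z j\<bar> \<le> \<delta> * (C * (1 + S))"
      using \<delta> by (simp add: abs_mult algebra_simps)
    then have "\<bar>z j\<bar> \<le> C * (1 + S)" using \<delta> by simp
    then show ?thesis by (simp add: B_def)
  qed
  then have "\<forall>\<delta>>0. \<forall>z\<in>space (leb_on J). pt \<delta> z \<in> P \<longrightarrow> z \<in> PiE J (\<lambda>_. {-B..B})"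
    by (auto simp: space_PiM PiE_iff abs_le_iff minus_le_iff)
  then show ?thesis using B0 by blast
qed

text \<open>\<open>flat h \<eta> z\<close> is the value of the affine functional \<open>h + \<eta> \<bullet> t\<close> at the point of the affine hull
of \<open>F\<close> with parameters \<open>z\<close>, written out with its coefficients as a functional of \<open>z\<close>.\<close>

definition flat_const :: "real \<Rightarrow> real ^ 'n \<Rightarrow> real" where
  "flat_const h \<eta> = h + \<eta> \<bullet> p - (\<Sum>j\<in>K. p $ j * (\<eta> \<bullet> b j))"

definition flat_coeff :: "real ^ 'n \<Rightarrow> 'n \<Rightarrow> real" where
  "flat_coeff \<eta> j = (if j \<in> K then \<eta> \<bullet> b j else 0)"

definition flat :: "real \<Rightarrow> real ^ 'n \<Rightarrow> ('n \<Rightarrow> real) \<Rightarrow> real" where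
  "flat h \<eta> z = flat_const h \<eta> + (\<Sum>j\<in>J. flat_coeff \<eta> j * z j)"

lemma flat_eq: "flat h \<eta> z = h + \<eta> \<bullet> (p + (\<Sum>j\<in>K. (z j - p $ j) *\<^sub>R b j))"
proof -
  have "(\<Sum>j\<in>J. flat_coeff \<eta> j * z j) = (\<Sum>j\<in>K. z j * (\<eta> \<bullet> b j))"
    by (rule sum.mono_neutral_cong_right) (use i_notin in \<open>auto simp: flat_coeff_def\<close>)
  then show ?thesis
    by (simp add: flat_def flat_const_def inner_add_right inner_sum_right algebra_simps sum_subtractf)
qed

lemma functional_pt: "h + \<eta> \<bullet> pt \<delta> z = flat h \<eta> z + \<delta> * (\<eta> \<bullet> dir z)"
  by (simp add: flat_eq pt_def inner_add_right)

lemma flat_face: "q \<in> F \<Longrightarrow> flat h \<eta> (\<lambda>j. q $ j) = h + \<eta> \<bullet> q"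
  unfolding flat_eq using F_rep[of q] by simp

lemma flat_nontrivial:
  assumes "q \<in> F" "h + \<eta> \<bullet> q \<noteq> 0"
  shows "flat_const h \<eta> \<noteq> 0 \<or> (\<exists>j\<in>J. flat_coeff \<eta> j \<noteq> 0)"
proof (rule ccontr)
  assume "\<not> ?thesis"
  then have "flat h \<eta> (\<lambda>j. q $ j) = 0" by (simp add: flat_def)
  then show False using flat_face[OF assms(1), of h \<eta>] assms(2) by simp
qed

lemma flat_trivial:
  assumes "\<And>q. q \<in> F \<Longrightarrow> h + \<eta> \<bullet> q = 0"
  shows "flat h \<eta> z = 0"
proof -
  have "\<eta> \<bullet> b j = 0" if "j \<in> K" for j
  proof -
    have "span ((\<lambda>q. q - p) ` F) \<subseteq> {v. \<eta> \<bullet> v = 0}"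
    proof (rule span_minimal)
      show "(\<lambda>q. q - p) ` F \<subseteq> {v. \<eta> \<bullet> v = 0}"
        using assms assms[OF p_in] by (auto simp: inner_diff_right) (metis add_left_cancel)
    qed (rule subspace_hyperplane)
    then show ?thesis using b_span[OF that] by auto
  qed
  then show ?thesis
    using assms[OF p_in] by (simp add: flat_eq inner_add_right inner_sum_right)
qed

lemma dir_bounded: "\<exists>D\<ge>0. \<forall>z\<in>PiE J (\<lambda>_. {-B..B}). \<bar>\<eta> \<bullet> dir z\<bar> \<le> D"
proof -
  define D where "D = (\<Sum>j\<in>W. \<bar>B\<bar> * \<bar>\<eta> \<bullet> (axis j 1 - axis i 1)\<bar>) + \<bar>\<eta> \<bullet> axis i 1\<bar>"
  have "\<bar>\<eta> \<bullet> dir z\<bar> \<le> D" if z: "z \<in> PiE J (\<lambda>_. {-B..B})" for z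
  proof -
    have "\<eta> \<bullet> dir z = (\<Sum>j\<in>W. z j * (\<eta> \<bullet> (axis j 1 - axis i 1))) - \<eta> \<bullet> axis i 1"
      by (simp add: dir_def inner_diff_right inner_sum_right)
    moreover have "\<bar>\<Sum>j\<in>W. z j * (\<eta> \<bullet> (axis j 1 - axis i 1))\<bar>
        \<le> (\<Sum>j\<in>W. \<bar>z j * (\<eta> \<bullet> (axis j 1 - axis i 1))\<bar>)" by (rule sum_abs)
    moreover have "(\<Sum>j\<in>W. \<bar>z j * (\<eta> \<bullet> (axis j 1 - axis i 1))\<bar>)
        \<le> (\<Sum>j\<in>W. \<bar>B\<bar> * \<bar>\<eta> \<bullet> (axis j 1 - axis i 1)\<bar>)"
    proof (rule sum_mono)
      fix j assume "j \<in> W"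
      then have "z j \<in> {-B..B}" using z by (intro PiE_mem[OF z]) auto
      then have "\<bar>z j\<bar> \<le> \<bar>B\<bar>" by auto
      then show "\<bar>z j * (\<eta> \<bullet> (axis j 1 - axis i 1))\<bar> \<le> \<bar>B\<bar> * \<bar>\<eta> \<bullet> (axis j 1 - axis i 1)\<bar>"
        by (simp add: abs_mult mult_right_mono)
    qed
    ultimately show ?thesis unfolding D_def by linarith
  qed
  moreover have "D \<ge> 0" by (simp add: D_def sum_nonneg)
  ultimately show ?thesis by blast
qed

lemma emeasure_flat_strip:
  assumes "q \<in> F" "h + \<eta> \<bullet> q \<noteq> 0" "0 \<le> B"
  shows "\<exists>C\<ge>0. \<forall>\<epsilon>\<ge>0. emeasure (leb_on J) {z \<in> PiE J (\<lambda>_. {-B..B}). \<bar>flat h \<eta> z\<bar> \<le> \<epsilon>} \<le> ennreal (C * \<epsilon>)"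
  unfolding flat_def
  by (rule emeasure_strip_le) (use assms flat_nontrivial[OF assms(1,2)] in auto)

lemma sets_flat_strip:
  "{z \<in> PiE J (\<lambda>_. {-B..B}). \<bar>flat h \<eta> z\<bar> \<le> \<epsilon>} \<in> sets (leb_on J)"
proof -
  have 1: "PiE J (\<lambda>_. {-B..B}) \<in> sets (leb_on J)"
    by (intro sets_PiM_I_finite) auto
  have [measurable]: "flat h \<eta> \<in> borel_measurable (leb_on J)"
    unfolding flat_def by measurable
  have "{z \<in> space (leb_on J). \<bar>flat h \<eta> z\<bar> \<le> \<epsilon>} \<in> sets (leb_on J)"
    by measurable
  from sets.Int[OF 1 this] show ?thesis
    by (rule back_subst[where P="\<lambda>x. x \<in> sets (leb_on J)"]) (auto simp: space_PiM PiE_def)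
qed

lemma emeasure_near_zero_le:
  assumes "q \<in> F" "h + \<eta> \<bullet> q \<noteq> 0"
  shows "\<exists>C\<ge>0. \<forall>\<delta>>0. \<forall>\<epsilon>\<ge>0.
    emeasure (leb_on J) {z \<in> space (leb_on J). pt \<delta> z \<in> P \<inter> {t. \<bar>h + \<eta> \<bullet> t\<bar> \<le> \<epsilon>}} \<le> ennreal (C * (\<delta> + \<epsilon>))"
proof -
  obtain B where B: "B \<ge> 0"
    "\<And>\<delta> z. \<delta> > 0 \<Longrightarrow> z \<in> space (leb_on J) \<Longrightarrow> pt \<delta> z \<in> P \<Longrightarrow> z \<in> PiE J (\<lambda>_. {-B..B})"
    using pt_box by blast
  obtain D where D: "D \<ge> 0" "\<And>z. z \<in> PiE J (\<lambda>_. {-B..B}) \<Longrightarrow> \<bar>\<eta> \<bullet> dir z\<bar> \<le> D"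
    using dir_bounded[of B \<eta>] by blast
  obtain C where C: "C \<ge> 0" "\<And>\<epsilon>. \<epsilon> \<ge> 0 \<Longrightarrow>
      emeasure (leb_on J) {z \<in> PiE J (\<lambda>_. {-B..B}). \<bar>flat h \<eta> z\<bar> \<le> \<epsilon>} \<le> ennreal (C * \<epsilon>)"
    using emeasure_flat_strip[OF assms B(1)] by blast
  have "emeasure (leb_on J) {z \<in> space (leb_on J). pt \<delta> z \<in> P \<inter> {t. \<bar>h + \<eta> \<bullet> t\<bar> \<le> \<epsilon>}}
      \<le> ennreal (C * (1 + D) * (\<delta> + \<epsilon>))" if "\<delta> > 0" "\<epsilon> \<ge> 0" for \<delta> \<epsilon>
  proof -
    have "\<bar>flat h \<eta> z\<bar> \<le> \<epsilon> + \<delta> * D"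
      if "z \<in> PiE J (\<lambda>_. {-B..B})" "\<bar>h + \<eta> \<bullet> pt \<delta> z\<bar> \<le> \<epsilon>" for z
    proof -
      have "\<delta> * \<bar>\<eta> \<bullet> dir z\<bar> \<le> \<delta> * D"
        using D(2)[OF that(1)] \<open>\<delta> > 0\<close> by simp
      then have "\<bar>\<delta> * (\<eta> \<bullet> dir z)\<bar> \<le> \<delta> * D" using \<open>\<delta> > 0\<close> by (simp add: abs_mult)
      then show ?thesis using that(2) unfolding functional_pt by linarith
    qed
    then have "{z \<in> space (leb_on J). pt \<delta> z \<in> P \<inter> {t. \<bar>h + \<eta> \<bullet> t\<bar> \<le> \<epsilon>}}
        \<subseteq> {z \<in> PiE J (\<lambda>_. {-B..B}). \<bar>flat h \<eta> z\<bar> \<le> \<epsilon> + \<delta> * D}"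
      using B(2)[OF \<open>\<delta> > 0\<close>] by blast
    then have "emeasure (leb_on J) {z \<in> space (leb_on J). pt \<delta> z \<in> P \<inter> {t. \<bar>h + \<eta> \<bullet> t\<bar> \<le> \<epsilon>}}
        \<le> emeasure (leb_on J) {z \<in> PiE J (\<lambda>_. {-B..B}). \<bar>flat h \<eta> z\<bar> \<le> \<epsilon> + \<delta> * D}"
      by (rule emeasure_mono) (rule sets_flat_strip)
    also have "\<dots> \<le> ennreal (C * (\<epsilon> + \<delta> * D))"
      using that D by (intro C(2)) auto
    also have "\<dots> \<le> ennreal (C * (1 + D) * (\<delta> + \<epsilon>))"
    proof -
      have "\<epsilon> + \<delta> * D \<le> (1 + D) * (\<delta> + \<epsilon>)" using that D by (simp add: algebra_simps)
      then show ?thesis using C(1) by (simp add: ennreal_leI mult_left_mono mult.assoc)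
    qed
    finally show ?thesis .
  qed
  then show ?thesis using C D by (intro exI[of _ "C * (1 + D)"]) auto
qed

text \<open>An inequality that is an equality on all of \<open>F\<close> reads \<open>0 \<le> \<delta> * (\<gamma> m \<bullet> dir z)\<close> in the parameters,
which does not depend on \<open>\<delta>\<close>. Any other one, \<open>0 \<le> flat (\<beta> m) (\<gamma> m) z + \<delta> * (\<gamma> m \<bullet> dir z)\<close>, can
hold for \<open>\<delta>\<close> and fail for \<open>\<delta>'\<close> only where \<open>flat (\<beta> m) (\<gamma> m) z\<close> is \<open>O(max \<delta> \<delta>')\<close>, and this is a
strip.\<close>

lemma emeasure_pt_change_le:
  "\<exists>C\<ge>0. \<forall>\<delta>>0. \<forall>\<delta>'>0.
    emeasure (leb_on J) ({z \<in> space (leb_on J). pt \<delta> z \<in> P} - {z \<in> space (leb_on J). pt \<delta>' z \<in> P})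
      \<le> ennreal (C * max \<delta> \<delta>')"
proof -
  obtain B where B: "B \<ge> 0"
    "\<And>\<delta> z. \<delta> > 0 \<Longrightarrow> z \<in> space (leb_on J) \<Longrightarrow> pt \<delta> z \<in> P \<Longrightarrow> z \<in> PiE J (\<lambda>_. {-B..B})"
    using pt_box by blast
  let ?box = "PiE J (\<lambda>_. {-B..B})"
  \<comment> \<open>the inequalities that are strict somewhere on the face\<close>
  define M1 where "M1 = {m \<in> M. \<exists>q\<in>F. \<beta> m + \<gamma> m \<bullet> q \<noteq> 0}"
  have fin: "finite M1" using finite_M by (simp add: M1_def)
  have "\<forall>m. \<exists>D\<ge>0. \<forall>z\<in>?box. \<bar>\<gamma> m \<bullet> dir z\<bar> \<le> D"
    using dir_bounded by blast
  from choice[OF this] obtain D where "\<forall>m. 0 \<le> D m \<and> (\<forall>z\<in>?box. \<bar>\<gamma> m \<bullet> dir z\<bar> \<le> D m)"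
    by blast
  then have D: "\<And>m. D m \<ge> 0" "\<And>m z. z \<in> ?box \<Longrightarrow> \<bar>\<gamma> m \<bullet> dir z\<bar> \<le> D m"
    by blast+
  have "\<forall>m\<in>M1. \<exists>C\<ge>0. \<forall>\<epsilon>\<ge>0.
      emeasure (leb_on J) {z \<in> ?box. \<bar>flat (\<beta> m) (\<gamma> m) z\<bar> \<le> \<epsilon>} \<le> ennreal (C * \<epsilon>)"
    using emeasure_flat_strip[OF _ _ B(1)] unfolding M1_def by blast
  from bchoice[OF this] obtain C where "\<forall>m\<in>M1. 0 \<le> C m \<and> (\<forall>\<epsilon>\<ge>0.
      emeasure (leb_on J) {z \<in> ?box. \<bar>flat (\<beta> m) (\<gamma> m) z\<bar> \<le> \<epsilon>} \<le> ennreal (C m * \<epsilon>))"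
    by blast
  then have C: "\<And>m. m \<in> M1 \<Longrightarrow> C m \<ge> 0" "\<And>m \<epsilon>. m \<in> M1 \<Longrightarrow> \<epsilon> \<ge> 0 \<Longrightarrow>
      emeasure (leb_on J) {z \<in> ?box. \<bar>flat (\<beta> m) (\<gamma> m) z\<bar> \<le> \<epsilon>} \<le> ennreal (C m * \<epsilon>)"
    by blast+
  define C' where "C' = (\<Sum>m\<in>M1. C m * D m)"
  have "emeasure (leb_on J) ({z \<in> space (leb_on J). pt \<delta> z \<in> P} - {z \<in> space (leb_on J). pt \<delta>' z \<in> P})
      \<le> ennreal (C' * max \<delta> \<delta>')" (is "emeasure _ ?X \<le> _") if \<delta>: "\<delta> > 0" "\<delta>' > 0" for \<delta> \<delta>'
  proof -
    let ?d = "max \<delta> \<delta>'"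
    let ?S = "\<lambda>m. {z \<in> ?box. \<bar>flat (\<beta> m) (\<gamma> m) z\<bar> \<le> ?d * D m}"
    have "?X \<subseteq> (\<Union>m\<in>M1. ?S m)"
    proof
      fix z assume z: "z \<in> ?X"
      then have box: "z \<in> ?box" using B(2) \<delta> by auto
      obtain m where m: "m \<in> M" "\<beta> m + \<gamma> m \<bullet> pt \<delta>' z < 0" "0 \<le> \<beta> m + \<gamma> m \<bullet> pt \<delta> z"
        using z by (auto simp: P_eq not_le)
      let ?e = "\<gamma> m \<bullet> dir z" and ?f = "flat (\<beta> m) (\<gamma> m) z"
      have f: "?f + \<delta>' * ?e < 0" "0 \<le> ?f + \<delta> * ?e"
        using m by (simp_all add: functional_pt)
      have m1: "m \<in> M1"
      proof (rule ccontr)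
        assume "m \<notin> M1"
        then have "?f = 0" using m(1) by (intro flat_trivial) (auto simp: M1_def)
        then show False using f \<delta> by (auto simp: mult_less_0_iff zero_le_mult_iff)
      qed
      have "\<bar>\<delta> * ?e\<bar> \<le> ?d * D m" "\<bar>\<delta>' * ?e\<bar> \<le> ?d * D m"
        using \<delta> D box by (auto simp: abs_mult intro!: mult_mono)
      then have "\<bar>?f\<bar> \<le> ?d * D m" using f by linarith
      then show "z \<in> (\<Union>m\<in>M1. ?S m)" using m1 box by blast
    qed
    then have "emeasure (leb_on J) ?X \<le> emeasure (leb_on J) (\<Union>m\<in>M1. ?S m)"
      by (rule emeasure_mono) (intro sets.finite_UN fin sets_flat_strip)
    also have "\<dots> \<le> (\<Sum>m\<in>M1. emeasure (leb_on J) (?S m))"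
      by (intro emeasure_subadditive_finite fin) (use sets_flat_strip in auto)
    also have "\<dots> \<le> (\<Sum>m\<in>M1. ennreal (C m * (?d * D m)))"
      using \<delta> D by (intro sum_mono C) auto
    also have "\<dots> = ennreal (\<Sum>m\<in>M1. C m * (?d * D m))"
      using \<delta> D C by (intro sum_ennreal) (auto intro!: mult_nonneg_nonneg)
    also have "(\<Sum>m\<in>M1. C m * (?d * D m)) = C' * ?d"
      by (simp add: C'_def sum_distrib_left sum_distrib_right mult_ac)
    finally show ?thesis .
  qed
  moreover have "C' \<ge> 0" using C D by (auto simp: C'_def intro!: sum_nonneg)
  ultimately show ?thesis by blast
qed

lemma emeasure_pt_finite: "\<delta> > 0 \<Longrightarrow> emeasure (leb_on J) {z \<in> space (leb_on J). pt \<delta> z \<in> P} < \<infinity>"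
proof -
  assume \<delta>: "\<delta> > 0"
  obtain B where B: "B \<ge> 0"
    "\<And>\<delta> z. \<delta> > 0 \<Longrightarrow> z \<in> space (leb_on J) \<Longrightarrow> pt \<delta> z \<in> P \<Longrightarrow> z \<in> PiE J (\<lambda>_. {-B..B})"
    using pt_box by blast
  have "emeasure (leb_on J) {z \<in> space (leb_on J). pt \<delta> z \<in> P} \<le> emeasure (leb_on J) (PiE J (\<lambda>_. {-B..B}))"
    by (intro emeasure_mono sets_PiM_I_finite) (use B(2) \<delta> in auto)
  also have "\<dots> < \<infinity>" using B(1) by (subst emeasure_leb_on_box) auto
  finally show ?thesis .
qed

text \<open>After division by \<open>\<delta> ^ codim\<close> the volume of the slice is the volume \<open>N \<delta>\<close> of the parameter set, and
\<open>N \<delta>\<close> is Cauchy as \<open>\<delta>\<close> tends to 0, with a linear rate.\<close>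

lemma slice_asymptotic:
  "\<exists>c C. 0 \<le> c \<and> 0 \<le> C \<and> (\<forall>\<delta>>0. emeasure (leb_on J) (slice P i (a - \<delta>)) < \<infinity> \<and>
     \<bar>measure (leb_on J) (slice P i (a - \<delta>)) - c * \<delta> ^ codim\<bar> \<le> C * \<delta> ^ Suc codim)"
proof -
  define X where "X \<delta> = {z \<in> space (leb_on J). pt \<delta> z \<in> P}" for \<delta>
  define N where "N \<delta> = measure (leb_on J) (X \<delta>)" for \<delta>
  have X_sets: "X \<delta> \<in> sets (leb_on J)" if "\<delta> > 0" for \<delta>
    unfolding X_def using emeasure_slice(2)[OF that borel_P] .
  have X_fin: "emeasure (leb_on J) (X \<delta>) \<noteq> \<infinity>" if "\<delta> > 0" for \<delta>
    unfolding X_def using emeasure_pt_finite[OF that] by auto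
  obtain C where C: "C \<ge> 0" "\<And>\<delta> \<delta>'. \<delta> > 0 \<Longrightarrow> \<delta>' > 0 \<Longrightarrow>
      emeasure (leb_on J) (X \<delta> - X \<delta>') \<le> ennreal (C * max \<delta> \<delta>')"
    using emeasure_pt_change_le unfolding X_def by blast
  have le: "N \<delta> \<le> N \<delta>' + C * max \<delta> \<delta>'" if "\<delta> > 0" "\<delta>' > 0" for \<delta> \<delta>'
  proof -
    have "emeasure (leb_on J) (X \<delta>) \<le> emeasure (leb_on J) (X \<delta>' \<union> (X \<delta> - X \<delta>'))"
      by (intro emeasure_mono) (use X_sets that in auto)
    also have "\<dots> \<le> emeasure (leb_on J) (X \<delta>') + emeasure (leb_on J) (X \<delta> - X \<delta>')"
      by (intro emeasure_subadditive) (use X_sets that in auto)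
    also have "\<dots> \<le> ennreal (N \<delta>') + ennreal (C * max \<delta> \<delta>')"
      using C(2)[OF that] X_fin[OF that(2)] by (simp add: N_def emeasure_eq_ennreal_measure)
    also have "\<dots> = ennreal (N \<delta>' + C * max \<delta> \<delta>')"
      using that C(1) by (simp add: N_def)
    finally have "ennreal (N \<delta>) \<le> ennreal (N \<delta>' + C * max \<delta> \<delta>')"
      using X_fin[OF that(1)] by (simp add: N_def emeasure_eq_ennreal_measure)
    then show ?thesis
      using that C(1) by (subst (asm) ennreal_le_iff) (auto simp: N_def)
  qed
  have diff: "\<bar>N \<delta> - N \<delta>'\<bar> \<le> C * max \<delta> \<delta>'" if "\<delta> > 0" "\<delta>' > 0" for \<delta> \<delta>'
    using le[OF that] le[OF that(2,1)] by (simp add: max.commute)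
  define x where "x m = N (inverse (real (Suc m)))" for m
  have "Cauchy x"
  proof (rule metric_CauchyI)
    fix e :: real assume e: "e > 0"
    obtain m0 where m0: "inverse (real (Suc m0)) < e / (C + 1)"
      using reals_Archimedean[of "e / (C + 1)"] e C(1) by auto
    have "dist (x m) (x m') < e" if "m \<ge> m0" "m' \<ge> m0" for m m'
    proof -
      have "dist (x m) (x m') \<le> C * max (inverse (real (Suc m))) (inverse (real (Suc m')))"
        unfolding dist_real_def x_def by (rule diff) auto
      also have "\<dots> \<le> C * inverse (real (Suc m0))"
        using that C(1) by (intro mult_left_mono) (auto intro!: le_imp_inverse_le)
      also have "\<dots> \<le> C * (e / (C + 1))"
        using m0 C(1) by (intro mult_left_mono) auto
      also have "\<dots> < e" using e C(1) by (simp add: field_simps)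
      finally show ?thesis .
    qed
    then show "\<exists>M. \<forall>m\<ge>M. \<forall>n\<ge>M. dist (x m) (x n) < e" by blast
  qed
  then obtain c where c: "x \<longlonglongrightarrow> c" using Cauchy_convergent_iff convergent_def by blast
  have c0: "c \<ge> 0" by (rule LIMSEQ_le_const[OF c]) (auto simp: x_def N_def)
  have lim: "\<bar>N \<delta> - c\<bar> \<le> C * \<delta>" if \<delta>: "\<delta> > 0" for \<delta>
  proof (rule LIMSEQ_le_const2)
    show "(\<lambda>m. \<bar>N \<delta> - x m\<bar>) \<longlonglongrightarrow> \<bar>N \<delta> - c\<bar>" by (intro tendsto_intros c)
    obtain m0 where m0: "inverse (real (Suc m0)) < \<delta>" using reals_Archimedean[OF \<delta>] by auto
    have "\<bar>N \<delta> - x m\<bar> \<le> C * \<delta>" if "m \<ge> m0" for m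
    proof -
      have "inverse (real (Suc m)) \<le> inverse (real (Suc m0))"
        using that by (intro le_imp_inverse_le) auto
      then have "max \<delta> (inverse (real (Suc m))) = \<delta>" using m0 by (intro max_absorb1) linarith
      then show ?thesis using diff[OF \<delta>, of "inverse (real (Suc m))"] by (simp add: x_def)
    qed
    then show "\<exists>N'. \<forall>m\<ge>N'. \<bar>N \<delta> - x m\<bar> \<le> C * \<delta>" by blast
  qed
  have "emeasure (leb_on J) (slice P i (a - \<delta>)) < \<infinity> \<and>
     \<bar>measure (leb_on J) (slice P i (a - \<delta>)) - c * \<delta> ^ codim\<bar> \<le> C * \<delta> ^ Suc codim" if \<delta>: "\<delta> > 0" for \<delta>
  proof -
    have eq: "emeasure (leb_on J) (slice P i (a - \<delta>)) = ennreal (\<delta> ^ codim * N \<delta>)"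
      using emeasure_slice(1)[OF \<delta> borel_P] X_fin[OF \<delta>] \<delta>
      unfolding N_def X_def[symmetric] by (simp add: emeasure_eq_ennreal_measure ennreal_mult)
    then have "measure (leb_on J) (slice P i (a - \<delta>)) = \<delta> ^ codim * N \<delta>"
      using \<delta> by (simp add: measure_def N_def)
    then have "measure (leb_on J) (slice P i (a - \<delta>)) - c * \<delta> ^ codim = \<delta> ^ codim * (N \<delta> - c)"
      by (simp add: algebra_simps)
    then have "\<bar>measure (leb_on J) (slice P i (a - \<delta>)) - c * \<delta> ^ codim\<bar> = \<delta> ^ codim * \<bar>N \<delta> - c\<bar>"
      using \<delta> by (simp add: abs_mult)
    also have "\<dots> \<le> \<delta> ^ codim * (C * \<delta>)"
      using lim[OF \<delta>] \<delta> by (intro mult_left_mono) auto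
    finally show ?thesis using eq by (simp add: mult_ac)
  qed
  then show ?thesis using c0 C(1) by blast
qed

lemma slice_near_zero_le:
  assumes "q \<in> F" "h + \<eta> \<bullet> q \<noteq> 0"
  shows "\<exists>C\<ge>0. \<forall>\<delta>>0. \<forall>\<epsilon>\<ge>0. emeasure (leb_on J) (slice (P \<inter> {t. \<bar>h + \<eta> \<bullet> t\<bar> \<le> \<epsilon>}) i (a - \<delta>))
    \<le> ennreal (C * \<delta> ^ codim * (\<delta> + \<epsilon>))"
proof -
  obtain C where C: "C \<ge> 0" "\<And>\<delta> \<epsilon>. \<delta> > 0 \<Longrightarrow> \<epsilon> \<ge> 0 \<Longrightarrow> emeasure (leb_on J)
      {z \<in> space (leb_on J). pt \<delta> z \<in> P \<inter> {t. \<bar>h + \<eta> \<bullet> t\<bar> \<le> \<epsilon>}} \<le> ennreal (C * (\<delta> + \<epsilon>))"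
    using emeasure_near_zero_le[OF assms] by blast
  have "emeasure (leb_on J) (slice (P \<inter> {t. \<bar>h + \<eta> \<bullet> t\<bar> \<le> \<epsilon>}) i (a - \<delta>))
      \<le> ennreal (C * \<delta> ^ codim * (\<delta> + \<epsilon>))" if "\<delta> > 0" "\<epsilon> \<ge> 0" for \<delta> \<epsilon>
  proof -
    have "closed {t. \<bar>h + \<eta> \<bullet> t\<bar> \<le> \<epsilon>}"
      by (intro closed_Collect_le continuous_intros)
    then have "P \<inter> {t. \<bar>h + \<eta> \<bullet> t\<bar> \<le> \<epsilon>} \<in> sets borel"
      by (intro sets.Int borel_P borel_closed)
    from emeasure_slice(1)[OF that(1) this]
    have "emeasure (leb_on J) (slice (P \<inter> {t. \<bar>h + \<eta> \<bullet> t\<bar> \<le> \<epsilon>}) i (a - \<delta>))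
        \<le> ennreal (\<delta> ^ codim) * ennreal (C * (\<delta> + \<epsilon>))"
      using C(2)[OF that] by (simp add: mult_left_mono)
    also have "\<dots> = ennreal (C * \<delta> ^ codim * (\<delta> + \<epsilon>))"
      using that C(1) by (simp add: ennreal_mult[symmetric] mult_ac)
    finally show ?thesis .
  qed
  then show ?thesis using C(1) by blast
qed

end

section \<open>Exponential integrals over the polyhedron\<close>

lemma borel_measurable_emeasure_slice [measurable]:
  assumes X: "X \<in> sets borel"
  shows "(\<lambda>\<sigma>. emeasure (leb_on (UNIV - {i})) (slice X i \<sigma>)) \<in> borel_measurable borel"
proof -
  let ?J = "UNIV - {i}"
  interpret J: sigma_finite_measure "leb_on ?J" by (rule lborels.sigma_finite) simp
  have m: "(\<lambda>p. indicator X (lift i (fst p) (snd p)) :: ennreal) \<in> borel_measurable (lborel \<Otimes>\<^sub>M leb_on ?J)"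
  proof -
    have "(\<lambda>p. (snd p, fst p)) \<in> lborel \<Otimes>\<^sub>M leb_on ?J \<rightarrow>\<^sub>M leb_on ?J \<Otimes>\<^sub>M lborel" by measurable
    from measurable_compose[OF measurable_compose[OF this measurable_lift], of "indicator X" borel] X
    show ?thesis by simp
  qed
  have "(\<lambda>\<sigma>. \<integral>\<^sup>+ z. indicator X (lift i \<sigma> z) \<partial>leb_on ?J) \<in> borel_measurable lborel"
    by (rule J.borel_measurable_nn_integral) (use m in \<open>simp add: case_prod_beta\<close>)
  moreover have "(\<integral>\<^sup>+ z. indicator X (lift i \<sigma> z) \<partial>leb_on ?J) = emeasure (leb_on ?J) (slice X i \<sigma>)" for \<sigma>
  proof -
    have "(\<integral>\<^sup>+ z. indicator X (lift i \<sigma> z) \<partial>leb_on ?J) = (\<integral>\<^sup>+ z. indicator (slice X i \<sigma>) z \<partial>leb_on ?J)"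
      by (rule nn_integral_cong) (auto simp: slice_def indicator_def)
    then show ?thesis using X by simp
  qed
  ultimately show ?thesis by simp
qed

lemma nn_integral_shifted_power_exp:
  fixes R a c :: real
  assumes "0 < R" "0 \<le> c"
  shows "(\<integral>\<^sup>+ x. ennreal (exp (R * (a - x)) * (c * x ^ n)) * indicator {0..} x \<partial>lborel)
    = ennreal (exp (a * R) * (c * fact n / R ^ Suc n))"
proof -
  have "(\<integral>\<^sup>+ x. ennreal (exp (R * (a - x)) * (c * x ^ n)) * indicator {0..} x \<partial>lborel)
      = (\<integral>\<^sup>+ x. ennreal (exp (a * R) * c) * (ennreal (x ^ n * exp (- (R * x))) * indicator {0..} x) \<partial>lborel)"
  proof (rule nn_integral_cong)
    fix x :: real
    have "exp (R * (a - x)) = exp (a * R) * exp (- (R * x))"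
      by (simp add: exp_add[symmetric] algebra_simps)
    then show "ennreal (exp (R * (a - x)) * (c * x ^ n)) * indicator {0..} x
        = ennreal (exp (a * R) * c) * (ennreal (x ^ n * exp (- (R * x))) * indicator {0..} x)"
      using assms by (cases "0 \<le> x") (simp_all add: ennreal_mult[symmetric] mult_ac)
  qed
  also have "\<dots> = ennreal (exp (a * R) * c) * ennreal (fact n / R ^ Suc n)"
    by (subst nn_integral_cmult) (simp_all add: nn_integral_power_exp[OF assms(1)])
  also have "\<dots> = ennreal (exp (a * R) * (c * fact n / R ^ Suc n))"
    using assms by (subst ennreal_mult[symmetric]) (simp_all add: mult_ac)
  finally show ?thesis .
qed

lemma exp_weighted_nn_integral_le:
  fixes V :: "real \<Rightarrow> ennreal"
  assumes R: "0 < R" and c: "0 \<le> c" "0 \<le> C"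
    and neg: "\<And>x. x < 0 \<Longrightarrow> V x = 0"
    and le: "\<And>x. x > 0 \<Longrightarrow> V x \<le> ennreal (c * x ^ n + C * x ^ Suc n)"
  shows "(\<integral>\<^sup>+ x. ennreal (exp (R * (a - x))) * V x \<partial>lborel)
    \<le> ennreal (exp (a * R) * (c * fact n / R ^ Suc n + C * fact (Suc n) / R ^ Suc (Suc n)))"
proof -
  let ?f = "\<lambda>c n x. ennreal (exp (R * (a - x)) * (c * x ^ n)) * indicator {0..} x"
  have "AE x :: real in lborel. x \<noteq> 0" by (rule AE_lborel_singleton)
  then have "AE x in lborel. ennreal (exp (R * (a - x))) * V x \<le> ?f c n x + ?f C (Suc n) x"
  proof eventually_elim
    case (elim x)
    show ?case
    proof (cases "x < 0")
      case False
      then have x: "x > 0" using elim by simp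
      have "ennreal (exp (R * (a - x))) * V x
          \<le> ennreal (exp (R * (a - x))) * ennreal (c * x ^ n + C * x ^ Suc n)"
        using le[OF x] by (rule mult_left_mono) simp
      also have "\<dots> = ?f c n x + ?f C (Suc n) x"
        using x c by (simp add: ennreal_mult[symmetric] ennreal_plus[symmetric] distrib_left
            del: ennreal_plus)
      finally show ?thesis .
    qed (simp add: neg)
  qed
  then have "(\<integral>\<^sup>+ x. ennreal (exp (R * (a - x))) * V x \<partial>lborel)
      \<le> (\<integral>\<^sup>+ x. ?f c n x + ?f C (Suc n) x \<partial>lborel)"
    by (rule nn_integral_mono_AE)
  also have "\<dots> = (\<integral>\<^sup>+ x. ?f c n x \<partial>lborel) + (\<integral>\<^sup>+ x. ?f C (Suc n) x \<partial>lborel)"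
    by (rule nn_integral_add) auto
  also have "\<dots> = ennreal (exp (a * R) * (c * fact n / R ^ Suc n + C * fact (Suc n) / R ^ Suc (Suc n)))"
    unfolding nn_integral_shifted_power_exp[OF R c(1)] nn_integral_shifted_power_exp[OF R c(2)]
    using R c by (subst ennreal_plus[symmetric]) (auto simp: distrib_left)
  finally show ?thesis .
qed

lemma exp_weighted_nn_integral_ge:
  fixes V :: "real \<Rightarrow> ennreal"
  assumes R: "0 < R" and c: "0 \<le> c" "0 \<le> C" and [measurable]: "V \<in> borel_measurable borel"
    and le: "\<And>x. x > 0 \<Longrightarrow> ennreal (c * x ^ n) \<le> V x + ennreal (C * x ^ Suc n)"
  shows "ennreal (exp (a * R) * (c * fact n / R ^ Suc n))
    \<le> (\<integral>\<^sup>+ x. ennreal (exp (R * (a - x))) * V x \<partial>lborel)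
      + ennreal (exp (a * R) * (C * fact (Suc n) / R ^ Suc (Suc n)))"
proof -
  let ?f = "\<lambda>c n x. ennreal (exp (R * (a - x)) * (c * x ^ n)) * indicator {0..} x"
  have "AE x :: real in lborel. x \<noteq> 0" by (rule AE_lborel_singleton)
  then have "AE x in lborel. ?f c n x \<le> ennreal (exp (R * (a - x))) * V x + ?f C (Suc n) x"
  proof eventually_elim
    case (elim x)
    show ?case
    proof (cases "x < 0")
      case False
      then have x: "x > 0" using elim by simp
      have "?f c n x = ennreal (exp (R * (a - x))) * ennreal (c * x ^ n)"
        using x c by (simp add: ennreal_mult)
      also have "\<dots> \<le> ennreal (exp (R * (a - x))) * (V x + ennreal (C * x ^ Suc n))"
        using le[OF x] by (rule mult_left_mono) simp
      also have "\<dots> = ennreal (exp (R * (a - x))) * V x + ?f C (Suc n) x"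
        using x c by (simp add: ennreal_mult distrib_left)
      finally show ?thesis .
    qed simp
  qed
  then have "(\<integral>\<^sup>+ x. ?f c n x \<partial>lborel)
      \<le> (\<integral>\<^sup>+ x. ennreal (exp (R * (a - x))) * V x + ?f C (Suc n) x \<partial>lborel)"
    by (rule nn_integral_mono_AE)
  also have "\<dots> = (\<integral>\<^sup>+ x. ennreal (exp (R * (a - x))) * V x \<partial>lborel) + (\<integral>\<^sup>+ x. ?f C (Suc n) x \<partial>lborel)"
    by (rule nn_integral_add) auto
  finally show ?thesis
    unfolding nn_integral_shifted_power_exp[OF R c(1)] nn_integral_shifted_power_exp[OF R c(2)] .
qed

lemma eq_if_dist_le_inverse:
  fixes x y :: real
  assumes "\<And>R. 0 < R \<Longrightarrow> \<bar>x - y\<bar> \<le> D / R"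
  shows "x = y"
proof (rule ccontr)
  assume "x \<noteq> y"
  then have d: "\<bar>x - y\<bar> > 0" by simp
  have D: "D > 0" using assms[of 1] d by simp
  have "\<bar>x - y\<bar> \<le> D / (2 * D / \<bar>x - y\<bar>)"
    using d D by (intro assms) auto
  then show False using d D by simp
qed

context bounded_polyhedron begin

lemma slice_coordinates_exist: "\<exists>K b p. slice_coordinates M \<beta> \<gamma> P i K b p"
proof -
  obtain p where p: "p \<in> F" using a_attained by (auto simp: max_face_def)
  let ?L = "span ((\<lambda>q. q - p) ` F)"
  have "?L \<subseteq> {v. (\<chi> j. 1) \<bullet> v = 0}"
  proof (rule span_minimal)
    show "(\<lambda>q. q - p) ` F \<subseteq> {v. (\<chi> j. 1) \<bullet> v = 0}"
      using p by (auto simp: max_face_def sum_eq_inner inner_diff_right)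
  qed (rule subspace_hyperplane)
  then have zero: "\<And>v. v \<in> ?L \<Longrightarrow> (\<Sum>j\<in>UNIV. v $ j) = 0" by (auto simp: sum_eq_inner)
  have "aff_dim F = int (dim ((+) (- p) ` F))"
    using p by (intro aff_dim_eq_dim) (simp add: hull_inc)
  moreover have "(+) (- p) ` F = (\<lambda>q. q - p) ` F" by (intro image_cong) auto
  ultimately have dim: "dim ?L = max_face_dim P"
    by (simp add: max_face_dim_def)
  obtain K b where K: "i \<notin> K" "card K = dim ?L" "\<forall>j\<in>K. b j \<in> ?L"
      "\<forall>j\<in>K. \<forall>l\<in>K. b j $ l = (if j = l then 1 else 0)"
      "\<forall>v\<in>?L. v = (\<Sum>j\<in>K. (v $ j) *\<^sub>R b j)"
    using subspace_coordinate_basis[of ?L i, OF subspace_span zero] by blast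
  have rep: "q = p + (\<Sum>j\<in>K. (q $ j - p $ j) *\<^sub>R b j)" if "q \<in> F" for q
  proof -
    have "q - p \<in> ?L" using that by (simp add: span_base)
    then have "q - p = (\<Sum>j\<in>K. ((q - p) $ j) *\<^sub>R b j)" using K(5) by blast
    then show ?thesis by (simp add: algebra_simps)
  qed
  have "slice_coordinates M \<beta> \<gamma> P i K b p"
    by standard (use K dim p rep in auto)
  then show ?thesis by blast
qed

text \<open>The coordinates in \<open>K\<close> are \<open>max_face_dim P\<close> many and do not include the dropped one. So the
truncated subtractions in \<open>codim\<close> and in the exponents that define \<open>c_P\<close> are exact.\<close>

lemma max_face_dim_less: "max_face_dim P < CARD('n)"
proof -
  obtain K b p where "slice_coordinates M \<beta> \<gamma> P undefined K b p"
    using slice_coordinates_exist by blast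
  then interpret slice_coordinates M \<beta> \<gamma> P undefined K b p .
  have "card K < CARD('n)" using i_notin by (intro psubset_card_mono) auto
  then show ?thesis by (simp add: card_K)
qed

lemma slice_empty: "\<delta> < 0 \<Longrightarrow> slice P i (a - \<delta>) = {}"
  using sum_le_a sum_lift[of i "a - \<delta>"] by (fastforce simp: slice_def)

lemma emeasure_exp_measure_depth:
  assumes "X \<in> sets borel"
  shows "emeasure (exp_measure R) {u. (\<chi> j. u j) \<in> X}
    = (\<integral>\<^sup>+ x. ennreal (exp (R * (a - x))) * emeasure (leb_on (UNIV - {i})) (slice X i (a - x)) \<partial>lborel)"
proof -
  note [measurable] = assms
  show ?thesis
    unfolding emeasure_exp_measure_slices[OF assms, of R i]
    by (subst nn_integral_real_affine[where c="-1" and t=a]) simp_all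
qed

lemma exp_measure_P_fixed_coordinate:
  "\<exists>c C. 0 \<le> c \<and> 0 \<le> C \<and>
     (\<forall>\<delta>>0. \<bar>meas_H i (hyperplane_H P \<delta> \<inter> P) - c * \<delta> ^ codim\<bar> \<le> C * \<delta> ^ Suc codim) \<and>
     (\<forall>R>0. emeasure (exp_measure R) {u. (\<chi> j. u j) \<in> P} < \<infinity> \<and>
       \<bar>measure (exp_measure R) {u. (\<chi> j. u j) \<in> P} - exp (a * R) * (c * fact codim / R ^ Suc codim)\<bar>
         \<le> exp (a * R) * (C * fact (Suc codim) / R ^ Suc (Suc codim)))"
proof -
  obtain K b p where "slice_coordinates M \<beta> \<gamma> P i K b p"
    using slice_coordinates_exist by blast
  then interpret slice_coordinates M \<beta> \<gamma> P i K b p .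
  let ?V = "\<lambda>\<delta>. emeasure (leb_on J) (slice P i (a - \<delta>))"
  obtain c C where c: "0 \<le> c" "0 \<le> C" and fin: "\<And>\<delta>. \<delta> > 0 \<Longrightarrow> ?V \<delta> < \<infinity>"
    and asym: "\<And>\<delta>. \<delta> > 0 \<Longrightarrow>
      \<bar>measure (leb_on J) (slice P i (a - \<delta>)) - c * \<delta> ^ codim\<bar> \<le> C * \<delta> ^ Suc codim"
    using slice_asymptotic by blast
  have V: "?V \<delta> = ennreal (measure (leb_on J) (slice P i (a - \<delta>)))" if "\<delta> > 0" for \<delta>
    using fin[OF that] by (intro emeasure_eq_ennreal_measure) auto
  have up: "?V \<delta> \<le> ennreal (c * \<delta> ^ codim + C * \<delta> ^ Suc codim)" if "\<delta> > 0" for \<delta>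
    unfolding V[OF that] using asym[OF that] by (intro ennreal_leI) linarith
  have low: "ennreal (c * \<delta> ^ codim) \<le> ?V \<delta> + ennreal (C * \<delta> ^ Suc codim)" if "\<delta> > 0" for \<delta>
  proof -
    have "?V \<delta> + ennreal (C * \<delta> ^ Suc codim)
        = ennreal (measure (leb_on J) (slice P i (a - \<delta>)) + C * \<delta> ^ Suc codim)"
      unfolding V[OF that] using c that by (intro ennreal_plus[symmetric]) auto
    then show ?thesis using asym[OF that] by (simp only:) (intro ennreal_leI, linarith)
  qed
  have "emeasure (exp_measure R) {u. (\<chi> j. u j) \<in> P} < \<infinity> \<and>
       \<bar>measure (exp_measure R) {u. (\<chi> j. u j) \<in> P} - exp (a * R) * (c * fact codim / R ^ Suc codim)\<bar>
         \<le> exp (a * R) * (C * fact (Suc codim) / R ^ Suc (Suc codim))" if R: "R > 0" for R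
  proof -
    let ?E = "emeasure (exp_measure R) {u. (\<chi> j. u j) \<in> P}"
    let ?x = "exp (a * R) * (c * fact codim / R ^ Suc codim)"
    let ?y = "exp (a * R) * (C * fact (Suc codim) / R ^ Suc (Suc codim))"
    have nn: "?x \<ge> 0" "?y \<ge> 0" using c R by auto
    have "?E \<le> ennreal (exp (a * R) * (c * fact codim / R ^ Suc codim + C * fact (Suc codim) / R ^ Suc (Suc codim)))"
      unfolding emeasure_exp_measure_depth[OF borel_P, of R i]
      by (rule exp_weighted_nn_integral_le) (use R c up slice_empty in auto)
    then have 1: "?E \<le> ennreal (?x + ?y)" by (simp add: distrib_left)
    have 2: "ennreal ?x \<le> ?E + ennreal ?y"
      unfolding emeasure_exp_measure_depth[OF borel_P, of R i]
      by (rule exp_weighted_nn_integral_ge) (use R c low in auto)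
    have fin: "?E < \<infinity>" using 1 by (rule le_less_trans) simp
    then have E: "?E = ennreal (measure (exp_measure R) {u. (\<chi> j. u j) \<in> P})"
      by (intro emeasure_eq_ennreal_measure) auto
    have "measure (exp_measure R) {u. (\<chi> j. u j) \<in> P} \<le> ?x + ?y"
      using 1 nn unfolding E by (subst (asm) ennreal_le_iff) auto
    moreover have "?x \<le> measure (exp_measure R) {u. (\<chi> j. u j) \<in> P} + ?y"
    proof -
      have "ennreal ?x \<le> ennreal (measure (exp_measure R) {u. (\<chi> j. u j) \<in> P} + ?y)"
        using 2 nn unfolding E by (subst ennreal_plus) auto
      then show ?thesis using nn by (subst (asm) ennreal_le_iff) auto
    qed
    ultimately show ?thesis using fin by (simp add: abs_le_iff)
  qed
  moreover have "\<forall>\<delta>>0. \<bar>meas_H i (hyperplane_H P \<delta> \<inter> P) - c * \<delta> ^ codim\<bar> \<le> C * \<delta> ^ Suc codim"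
    unfolding meas_H_slice using asym by blast
  ultimately show ?thesis using c by blast
qed

text \<open>For each dropped coordinate \<open>i\<close> the slices have a leading coefficient \<open>c i\<close>. The exponential
integral of \<open>P\<close> does not refer to \<open>i\<close>, and its leading term determines \<open>c i\<close>; so all \<open>c i\<close> agree,
and their common value meets the description that defines \<open>c_P\<close>.\<close>

theorem exp_measure_P:
  "\<exists>C\<ge>0. \<forall>R>0. emeasure (exp_measure R) {u. (\<chi> j. u j) \<in> P} < \<infinity> \<and>
     \<bar>measure (exp_measure R) {u. (\<chi> j. u j) \<in> P} - exp (a * R) * (fact codim * c_P P / R ^ Suc codim)\<bar>
       \<le> exp (a * R) * (C / R ^ Suc (Suc codim))"
  and c_P_nonneg: "0 \<le> c_P P"
proof -
  let ?J = "\<lambda>R. measure (exp_measure R) {u. (\<chi> j. u j) \<in> P}"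
  let ?Q = "\<lambda>i c C. 0 \<le> c \<and> 0 \<le> C \<and>
     (\<forall>\<delta>>0. \<bar>meas_H i (hyperplane_H P \<delta> \<inter> P) - c * \<delta> ^ codim\<bar> \<le> C * \<delta> ^ Suc codim) \<and>
     (\<forall>R>0. emeasure (exp_measure R) {u. (\<chi> j. u j) \<in> P} < \<infinity> \<and>
       \<bar>?J R - exp (a * R) * (c * fact codim / R ^ Suc codim)\<bar>
         \<le> exp (a * R) * (C * fact (Suc codim) / R ^ Suc (Suc codim)))"
  have "\<forall>i. \<exists>c C. ?Q i c C"
    using exp_measure_P_fixed_coordinate by blast
  from choice[OF this] obtain c where "\<forall>i. \<exists>C. ?Q i (c i) C"
    by blast
  from choice[OF this] obtain C where "\<forall>i. ?Q i (c i) (C i)"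
    by blast
  note each = spec[OF this]
  have c: "0 \<le> c i" "0 \<le> C i" for i
    using each[of i] by blast+
  have m: "\<bar>meas_H i (hyperplane_H P \<delta> \<inter> P) - c i * \<delta> ^ codim\<bar> \<le> C i * \<delta> ^ Suc codim"
    if "\<delta> > 0" for i \<delta>
    using each[of i] that by (elim conjE) blast
  have fin: "emeasure (exp_measure R) {u. (\<chi> j. u j) \<in> P} < \<infinity>"
    and e: "\<bar>?J R - exp (a * R) * (c i * fact codim / R ^ Suc codim)\<bar>
         \<le> exp (a * R) * (C i * fact (Suc codim) / R ^ Suc (Suc codim))" if "R > 0" for i R
    using each[of i] that by blast+
  have c_eq: "c i = c j" for i j
  proof -
    have "c i * fact codim = c j * fact codim"
    proof (rule eq_if_dist_le_inverse)
      fix R :: real assume R: "R > 0"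
      have "\<bar>exp (a * R) * (c i * fact codim / R ^ Suc codim) - exp (a * R) * (c j * fact codim / R ^ Suc codim)\<bar>
          \<le> exp (a * R) * (C i * fact (Suc codim) / R ^ Suc (Suc codim))
            + exp (a * R) * (C j * fact (Suc codim) / R ^ Suc (Suc codim))"
        using e[OF R, of i] e[OF R, of j] by linarith
      moreover have "exp (a * R) * (c i * fact codim / R ^ Suc codim) - exp (a * R) * (c j * fact codim / R ^ Suc codim)
          = exp (a * R) / R ^ Suc codim * (c i * fact codim - c j * fact codim)"
        by (simp add: right_diff_distrib)
      moreover have "exp (a * R) * (C i * fact (Suc codim) / R ^ Suc (Suc codim))
            + exp (a * R) * (C j * fact (Suc codim) / R ^ Suc (Suc codim))
          = exp (a * R) / R ^ Suc codim * ((C i + C j) * fact (Suc codim) / R)"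
        using R by (simp add: field_simps del: fact_Suc)
      ultimately have "exp (a * R) / R ^ Suc codim * \<bar>c i * fact codim - c j * fact codim\<bar>
          \<le> exp (a * R) / R ^ Suc codim * ((C i + C j) * fact (Suc codim) / R)"
        using R by (simp add: abs_mult del: fact_Suc power_Suc)
      moreover have "exp (a * R) / R ^ Suc codim > 0" using R by simp
      ultimately show "\<bar>c i * fact codim - c j * fact codim\<bar> \<le> (C i + C j) * fact (Suc codim) / R"
        by (simp only: mult_le_cancel_left_pos)
    qed
    then show ?thesis by simp
  qed
  \<comment> \<open>all \<open>c i\<close> are equal, so any index serves\<close>
  define c0 where "c0 = c undefined"
  have ci: "c i = c0" for i using c_eq unfolding c0_def by blast
  have exponent: "CARD('n) - max_face_dim P = Suc codim"
    using max_face_dim_less by simp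
  have cP: "c_P P = c0"
    unfolding c_P_def exponent
  proof (rule the_equality)
    show "\<forall>i. \<exists>C. \<exists>\<delta>\<^sub>0>0. \<forall>\<delta>. 0 < \<delta> \<and> \<delta> < \<delta>\<^sub>0 \<longrightarrow>
        \<bar>meas_H i (hyperplane_H P \<delta> \<inter> P) - c0 * \<delta> ^ codim\<bar> \<le> C * \<delta> ^ Suc codim"
    proof
      fix i
      show "\<exists>C. \<exists>\<delta>\<^sub>0>0. \<forall>\<delta>. 0 < \<delta> \<and> \<delta> < \<delta>\<^sub>0 \<longrightarrow>
        \<bar>meas_H i (hyperplane_H P \<delta> \<inter> P) - c0 * \<delta> ^ codim\<bar> \<le> C * \<delta> ^ Suc codim"
        using m[of _ i] unfolding ci by (intro exI[of _ "C i"] exI[of _ 1]) auto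
    qed
  next
    fix d assume "\<forall>i. \<exists>C. \<exists>\<delta>\<^sub>0>0. \<forall>\<delta>. 0 < \<delta> \<and> \<delta> < \<delta>\<^sub>0 \<longrightarrow>
        \<bar>meas_H i (hyperplane_H P \<delta> \<inter> P) - d * \<delta> ^ codim\<bar> \<le> C * \<delta> ^ Suc codim"
    then obtain C' \<delta>\<^sub>0 where d: "\<delta>\<^sub>0 > 0" "\<And>\<delta>. 0 < \<delta> \<Longrightarrow> \<delta> < \<delta>\<^sub>0 \<Longrightarrow>
        \<bar>meas_H undefined (hyperplane_H P \<delta> \<inter> P) - d * \<delta> ^ codim\<bar> \<le> C' * \<delta> ^ Suc codim" by blast
    define D where "D = C' + C undefined"
    have close: "\<bar>d - c0\<bar> \<le> D * \<delta>" if \<delta>: "0 < \<delta>" "\<delta> < \<delta>\<^sub>0" for \<delta>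
    proof -
      have "\<bar>d * \<delta> ^ codim - c0 * \<delta> ^ codim\<bar> \<le> C' * \<delta> ^ Suc codim + C undefined * \<delta> ^ Suc codim"
        using d(2)[OF \<delta>] m[OF \<delta>(1), of undefined] unfolding ci by linarith
      moreover have "d * \<delta> ^ codim - c0 * \<delta> ^ codim = \<delta> ^ codim * (d - c0)"
        "C' * \<delta> ^ Suc codim + C undefined * \<delta> ^ Suc codim = \<delta> ^ codim * (D * \<delta>)"
        by (simp_all add: D_def algebra_simps)
      ultimately have "\<delta> ^ codim * \<bar>d - c0\<bar> \<le> \<delta> ^ codim * (D * \<delta>)"
        using \<delta> by (simp only: abs_mult abs_power2 abs_of_pos zero_less_power)
      then show ?thesis using \<delta> by simp
    qed
    have "(\<lambda>\<delta>. D * \<delta>) \<midarrow>0\<rightarrow> D * 0" by (intro tendsto_intros)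
    then have lim: "((\<lambda>\<delta>. D * \<delta>) \<longlongrightarrow> 0) (at_right 0)"
      by (simp add: filterlim_at_split)
    have "eventually (\<lambda>\<delta>. \<bar>d - c0\<bar> \<le> D * \<delta>) (at_right 0)"
      using d(1) close eventually_at_right_field[of "\<lambda>\<delta>. \<bar>d - c0\<bar> \<le> D * \<delta>" "0::real"] by auto
    from tendsto_lowerbound[OF lim this] have "\<bar>d - c0\<bar> \<le> 0" by simp
    then show "d = c0" by simp
  qed
  show "0 \<le> c_P P" using c by (simp add: cP c0_def)
  have "emeasure (exp_measure R) {u. (\<chi> j. u j) \<in> P} < \<infinity> \<and>
     \<bar>?J R - exp (a * R) * (fact codim * c_P P / R ^ Suc codim)\<bar>
       \<le> exp (a * R) * (C undefined * fact (Suc codim) / R ^ Suc (Suc codim))" if "R > 0" for R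
    using fin[OF that] e[OF that, of undefined] unfolding ci cP mult.commute[of "fact codim"]
    by blast
  moreover have "0 \<le> C undefined * fact (Suc codim)" using c by simp
  ultimately show "\<exists>C\<ge>0. \<forall>R>0. emeasure (exp_measure R) {u. (\<chi> j. u j) \<in> P} < \<infinity> \<and>
     \<bar>?J R - exp (a * R) * (fact codim * c_P P / R ^ Suc codim)\<bar> \<le> exp (a * R) * (C / R ^ Suc (Suc codim))"
    by blast
qed

text \<open>A coordinate that is not identically zero on \<open>F\<close> is small only in a strip of the parameters, of
width \<open>O(\<epsilon> + \<delta>)\<close> at depth \<open>\<delta>\<close>.\<close>

lemma exp_measure_near_hyperplane_le:
  assumes q: "q \<in> F" "q $ l \<noteq> 0"
  shows "\<exists>C\<ge>0. \<forall>R>0. \<forall>\<epsilon>\<ge>0. emeasure (exp_measure R) {u. (\<chi> j. u j) \<in> P \<and> \<bar>u l\<bar> \<le> \<epsilon>}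
    \<le> ennreal (C * exp (a * R) * (\<epsilon> / R ^ Suc codim + 1 / R ^ Suc (Suc codim)))"
proof -
  obtain K b p where "slice_coordinates M \<beta> \<gamma> P undefined K b p"
    using slice_coordinates_exist by blast
  then interpret slice_coordinates M \<beta> \<gamma> P undefined K b p .
  let ?X = "\<lambda>\<epsilon>. P \<inter> {t. \<bar>t $ l\<bar> \<le> \<epsilon>}"
  have sl: "0 + axis l 1 \<bullet> t = t $ l" for t :: "real ^ 'n"
    by (simp add: inner_axis inner_commute)
  obtain C where C: "C \<ge> 0" "\<And>\<delta> \<epsilon>. \<delta> > 0 \<Longrightarrow> \<epsilon> \<ge> 0 \<Longrightarrow>
      emeasure (leb_on J) (slice (?X \<epsilon>) undefined (a - \<delta>)) \<le> ennreal (C * \<delta> ^ codim * (\<delta> + \<epsilon>))"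
    using slice_near_zero_le[OF q(1), of 0 "axis l 1"] q(2) unfolding sl by blast
  define C' where "C' = C * fact (Suc codim)"
  have "emeasure (exp_measure R) {u. (\<chi> j. u j) \<in> P \<and> \<bar>u l\<bar> \<le> \<epsilon>}
      \<le> ennreal (C' * exp (a * R) * (\<epsilon> / R ^ Suc codim + 1 / R ^ Suc (Suc codim)))"
    if R: "R > 0" "\<epsilon> \<ge> 0" for R \<epsilon>
  proof -
    have "closed {t :: real ^ 'n. \<bar>t $ l\<bar> \<le> \<epsilon>}"
      by (intro closed_Collect_le continuous_intros)
    then have X: "?X \<epsilon> \<in> sets borel" by (intro sets.Int borel_P borel_closed)
    have "slice (?X \<epsilon>) undefined (a - \<delta>) = {}" if "\<delta> < 0" for \<delta>
      using slice_empty[OF that, of undefined] by (auto simp: slice_def)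
    moreover have "emeasure (leb_on J) (slice (?X \<epsilon>) undefined (a - \<delta>))
        \<le> ennreal (C * \<epsilon> * \<delta> ^ codim + C * \<delta> ^ Suc codim)" if "\<delta> > 0" for \<delta>
      using C(2)[OF that R(2)] by (simp add: algebra_simps)
    ultimately have "emeasure (exp_measure R) {u. (\<chi> j. u j) \<in> ?X \<epsilon>}
      \<le> ennreal (exp (a * R) * (C * \<epsilon> * fact codim / R ^ Suc codim + C * fact (Suc codim) / R ^ Suc (Suc codim)))"
      unfolding emeasure_exp_measure_depth[OF X, of R undefined]
      by (intro exp_weighted_nn_integral_le) (use R C in auto)
    also have "\<dots> \<le> ennreal (C' * exp (a * R) * (\<epsilon> / R ^ Suc codim + 1 / R ^ Suc (Suc codim)))"
    proof (rule ennreal_leI)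
      have "C * \<epsilon> * fact codim / R ^ Suc codim \<le> C * \<epsilon> * fact (Suc codim) / R ^ Suc codim"
        using R C(1) by (intro divide_right_mono mult_left_mono fact_mono) auto
      then have "C * \<epsilon> * fact codim / R ^ Suc codim + C * fact (Suc codim) / R ^ Suc (Suc codim)
          \<le> C' * (\<epsilon> / R ^ Suc codim + 1 / R ^ Suc (Suc codim))"
        by (simp add: C'_def algebra_simps del: fact_Suc power_Suc)
      then show "exp (a * R) * (C * \<epsilon> * fact codim / R ^ Suc codim + C * fact (Suc codim) / R ^ Suc (Suc codim))
          \<le> C' * exp (a * R) * (\<epsilon> / R ^ Suc codim + 1 / R ^ Suc (Suc codim))"
        by (simp add: mult.assoc mult.left_commute[of C'] del: fact_Suc power_Suc)
    qed
    finally show ?thesis by simp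
  qed
  moreover have "C' \<ge> 0" using C by (simp add: C'_def)
  ultimately show ?thesis by blast
qed

end

section \<open>Box sums and cell sums\<close>

definition log_coord :: "('n::finite \<Rightarrow> real) \<Rightarrow> nat ^ 'n \<Rightarrow> 'n \<Rightarrow> real" where
  "log_coord \<omega> y i = \<omega> i * ln (real (y $ i))"

definition box_sum :: "(nat ^ 'n::finite \<Rightarrow> real) \<Rightarrow> ('n \<Rightarrow> real) \<Rightarrow> ('n \<Rightarrow> real) \<Rightarrow> real" where
  "box_sum f \<omega> b = (\<Sum>y | \<forall>i. 1 \<le> y $ i \<and> log_coord \<omega> y i \<le> b i. f y)"

definition cell_sum ::
    "(nat ^ 'n::finite \<Rightarrow> real) \<Rightarrow> ('n \<Rightarrow> real) \<Rightarrow> ('n \<Rightarrow> real) \<Rightarrow> ('n \<Rightarrow> real) \<Rightarrow> real" where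
  "cell_sum f \<omega> lo hi =
     (\<Sum>y | \<forall>i. 1 \<le> y $ i \<and> lo i < log_coord \<omega> y i \<and> log_coord \<omega> y i \<le> hi i. f y)"

lemma log_coord_le_iff:
  assumes "0 < \<omega> i" "1 \<le> y $ i"
  shows "log_coord \<omega> y i \<le> c \<longleftrightarrow> real (y $ i) \<le> exp (c / \<omega> i)"
proof -
  have "log_coord \<omega> y i \<le> c \<longleftrightarrow> ln (real (y $ i)) \<le> c / \<omega> i"
    using assms by (simp add: log_coord_def field_simps)
  also have "\<dots> \<longleftrightarrow> real (y $ i) \<le> exp (c / \<omega> i)"
    using assms(2) by (subst ln_le_cancel_iff[symmetric]) auto
  finally show ?thesis .
qed

lemma log_coord_nonneg: "0 < \<omega> i \<Longrightarrow> 1 \<le> y $ i \<Longrightarrow> 0 \<le> log_coord \<omega> y i"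
  by (simp add: log_coord_def)

lemma finite_bounded_nat_functions: "finite {q :: 'n::finite \<Rightarrow> nat. \<forall>i. q i \<le> N i}"
proof -
  have "{q. \<forall>i. q i \<le> N i} = PiE UNIV (\<lambda>i. {..N i})" by (auto simp: PiE_def)
  then show ?thesis by (simp add: finite_PiE)
qed

lemma finite_log_box:
  assumes "\<And>i. 0 < \<omega> i"
  shows "finite {y :: nat ^ 'n::finite. \<forall>i. 1 \<le> y $ i \<and> log_coord \<omega> y i \<le> b i}"
proof (rule finite_subset)
  let ?N = "\<lambda>i. nat \<lfloor>exp (b i / \<omega> i)\<rfloor>"
  show "{y :: nat ^ 'n. \<forall>i. 1 \<le> y $ i \<and> log_coord \<omega> y i \<le> b i}
      \<subseteq> vec_lambda ` {q. \<forall>i. q i \<le> ?N i}"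
  proof
    fix y :: "nat ^ 'n" assume y: "y \<in> {y. \<forall>i. 1 \<le> y $ i \<and> log_coord \<omega> y i \<le> b i}"
    have "y $ i \<le> ?N i" for i
      using y assms log_coord_le_iff[of \<omega> i y "b i"] by (simp add: le_nat_floor)
    then show "y \<in> vec_lambda ` {q. \<forall>i. q i \<le> ?N i}"
      by (intro image_eqI[of _ _ "vec_nth y"]) (auto simp: vec_nth_inverse)
  qed
qed (simp add: finite_bounded_nat_functions)

text \<open>The exponential form of Property I: the exponents \<open>\<omega> i\<close> are absorbed by the coordinates, and the
saving becomes \<open>exp (- \<kappa> * \<tau>)\<close> when all coordinates of the corner are at least \<open>\<tau>\<close>.\<close>

lemma box_sum_asymptotic:
  fixes f :: "nat ^ 'n::finite \<Rightarrow> real"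
  assumes I: "property_I A \<Delta> \<omega> CM CE f" and \<kappa>: "0 \<le> \<kappa>" "\<And>i. \<kappa> * \<omega> i \<le> \<Delta>"
    and b: "0 \<le> \<tau>" "\<And>i. \<tau> \<le> b i"
  shows "\<bar>box_sum f \<omega> b - CM * exp (\<Sum>i\<in>UNIV. b i)\<bar>
    \<le> \<bar>A\<bar> * CE * exp (\<Sum>i\<in>UNIV. b i) * exp (- (\<kappa> * \<tau>))"
proof -
  have \<omega>: "0 < \<omega> i" and CE: "0 \<le> CE" for i using I by (auto simp: property_I_def)
  define B :: "real ^ 'n" where "B = (\<chi> i. exp (b i / \<omega> i))"
  have b0: "0 \<le> b i" for i using b(1) b(2)[of i] by linarith
  have B1: "1 \<le> B $ i" for i using b0[of i] \<omega>[of i] by (simp add: B_def)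
  have prod: "(\<Prod>i\<in>UNIV. (B $ i) powr \<omega> i) = exp (\<Sum>i\<in>UNIV. b i)"
    unfolding exp_sum[OF finite]
    by (intro prod.cong) (use \<omega> in \<open>auto simp: B_def powr_def less_imp_neq[symmetric]\<close>)
  have sum: "(\<Sum>y | \<forall>i. 1 \<le> y $ i \<and> real (y $ i) \<le> B $ i. f y) = box_sum f \<omega> b"
  proof -
    have "1 \<le> y $ i \<and> real (y $ i) \<le> B $ i \<longleftrightarrow> 1 \<le> y $ i \<and> log_coord \<omega> y i \<le> b i" for y i
      using log_coord_le_iff[where \<omega> = \<omega>, OF \<omega>, of y i "b i"] by (auto simp: B_def)
    then show ?thesis unfolding box_sum_def by (simp only:)
  qed
  have min: "(MIN i. B $ i) powr (- \<Delta>) \<le> exp (- (\<kappa> * \<tau>))"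
  proof -
    have "(MIN i. B $ i) \<in> range (\<lambda>i. B $ i)" by (rule Min_in) auto
    then obtain i where i: "(MIN i. B $ i) = B $ i" by (elim rangeE)
    have "(B $ i) powr (- \<Delta>) = exp (- (\<Delta> / \<omega> i * b i))"
      by (simp add: B_def powr_def)
    also have "\<dots> \<le> exp (- (\<kappa> * \<tau>))"
    proof -
      have "\<kappa> * \<tau> \<le> \<kappa> * b i" using b(2) \<kappa>(1) by (rule mult_left_mono)
      also have "\<dots> \<le> \<Delta> / \<omega> i * b i"
        using \<kappa>(2)[of i] \<omega>[of i] b0[of i] by (intro mult_right_mono) (auto simp: field_simps)
      finally show ?thesis by simp
    qed
    finally show ?thesis unfolding i .
  qed
  let ?E = "exp (\<Sum>i\<in>UNIV. b i)"
  have "\<bar>box_sum f \<omega> b - CM * ?E\<bar> \<le> A * (CE * ?E * (MIN i. B $ i) powr (- \<Delta>))"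
    using I B1 unfolding property_I_def prod[symmetric] sum[symmetric] by blast
  also have "\<dots> \<le> \<bar>A\<bar> * (CE * ?E * (MIN i. B $ i) powr (- \<Delta>))"
    using CE by (intro mult_right_mono) auto
  also have "\<dots> \<le> \<bar>A\<bar> * (CE * ?E * exp (- (\<kappa> * \<tau>)))"
    using CE min by (intro mult_left_mono) auto
  finally show ?thesis by (simp add: mult.assoc)
qed

lemma prod_diff_corners:
  fixes lo hi :: "'n::finite \<Rightarrow> real"
  shows "(\<Prod>i\<in>UNIV. hi i - lo i)
    = (\<Sum>X\<in>UNIV. (-1) ^ card X * (\<Prod>i\<in>UNIV. if i \<in> X then lo i else hi i))"
proof -
  have "(\<Prod>i\<in>UNIV. if i \<in> X then lo i else hi i) = (\<Prod>i\<in>X. lo i) * (\<Prod>i\<in>UNIV - X. hi i)" for X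
    by (subst prod.If_cases) (simp_all add: Compl_eq_Diff_UNIV)
  then show ?thesis
    using prod_diff_conv_sum[of "UNIV :: 'n set" hi lo] by (simp add: mult.assoc)
qed

text \<open>Inclusion-exclusion over the corners: the indicator of a half-open cell is the product over the
coordinates of differences of indicators of half-lines.\<close>

lemma cell_sum_corners:
  fixes f :: "nat ^ 'n::finite \<Rightarrow> real"
  assumes \<omega>: "\<And>i. 0 < \<omega> i" and le: "\<And>i. lo i \<le> hi i"
  shows "cell_sum f \<omega> lo hi
    = (\<Sum>X\<in>UNIV. (-1) ^ card X * box_sum f \<omega> (\<lambda>i. if i \<in> X then lo i else hi i))"
proof -
  let ?x = "log_coord \<omega>"
  let ?U = "{y :: nat ^ 'n. \<forall>i. 1 \<le> y $ i \<and> ?x y i \<le> hi i}"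
  let ?b = "\<lambda>X i. if i \<in> X then lo i else hi i"
  have fin: "finite ?U" by (rule finite_log_box[OF \<omega>])
  have filter: "(\<Sum>y | y \<in> ?U \<and> Q y. f y) = (\<Sum>y\<in>?U. f y * (if Q y then 1 else 0))" for Q
    by (subst sum.inter_filter[OF fin]) (rule sum.cong, auto)
  have ind: "(if \<forall>i. P i then 1 else 0 :: real) = (\<Prod>i\<in>UNIV. if P i then 1 else 0)" for P :: "'n \<Rightarrow> bool"
    by (cases "\<forall>i. P i") (auto intro!: prod_zero)
  have box: "box_sum f \<omega> (?b X) = (\<Sum>y\<in>?U. f y * (\<Prod>i\<in>UNIV. if i \<in> X then if ?x y i \<le> lo i then 1 else 0 else if ?x y i \<le> hi i then 1 else 0))"
    for X
  proof -
    have "box_sum f \<omega> (?b X) = (\<Sum>y\<in>?U. f y * (if \<forall>i. ?x y i \<le> ?b X i then 1 else 0))"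
    proof -
      have "{y :: nat ^ 'n. \<forall>i. 1 \<le> y $ i \<and> ?x y i \<le> ?b X i} = {y \<in> ?U. \<forall>i. ?x y i \<le> ?b X i}"
        using le by (auto split: if_splits intro: order_trans)
      then show ?thesis
        unfolding box_sum_def by (simp only: filter)
    qed
    also have "\<dots> = (\<Sum>y\<in>?U. f y * (\<Prod>i\<in>UNIV. if i \<in> X then if ?x y i \<le> lo i then 1 else 0 else if ?x y i \<le> hi i then 1 else 0))"
      unfolding ind by (intro sum.cong arg_cong2[of _ _ _ _ "(*)"] prod.cong) auto
    finally show ?thesis .
  qed
  have "cell_sum f \<omega> lo hi = (\<Sum>y\<in>?U. f y * (if \<forall>i. lo i < ?x y i then 1 else 0))"
  proof -
    have "{y :: nat ^ 'n. \<forall>i. 1 \<le> y $ i \<and> lo i < ?x y i \<and> ?x y i \<le> hi i} = {y \<in> ?U. \<forall>i. lo i < ?x y i}"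
      by auto
    then show ?thesis
      unfolding cell_sum_def by (simp only: filter)
  qed
  also have "\<dots> = (\<Sum>y\<in>?U. f y * (\<Prod>i\<in>UNIV. (if ?x y i \<le> hi i then 1 else 0) - (if ?x y i \<le> lo i then 1 else 0)))"
    unfolding ind by (intro sum.cong arg_cong2[of _ _ _ _ "(*)"] prod.cong) (auto simp: not_less)
  also have "\<dots> = (\<Sum>y\<in>?U. \<Sum>X\<in>UNIV. (-1) ^ card X *
      (f y * (\<Prod>i\<in>UNIV. if i \<in> X then if ?x y i \<le> lo i then 1 else 0 else if ?x y i \<le> hi i then 1 else 0)))"
    unfolding prod_diff_corners by (simp add: sum_distrib_left mult.left_commute)
  also have "\<dots> = (\<Sum>X\<in>UNIV. (-1) ^ card X * box_sum f \<omega> (?b X))"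
    unfolding box by (subst sum.swap) (simp add: sum_distrib_left)
  finally show ?thesis .
qed

lemma cell_sum_asymptotic:
  fixes f :: "nat ^ 'n::finite \<Rightarrow> real"
  assumes I: "property_I A \<Delta> \<omega> CM CE f" and \<kappa>: "0 \<le> \<kappa>" "\<And>i. \<kappa> * \<omega> i \<le> \<Delta>"
    and b: "0 \<le> \<tau>" "\<And>i. \<tau> \<le> lo i" "\<And>i. lo i \<le> hi i"
  shows "\<bar>cell_sum f \<omega> lo hi - CM * (\<Prod>i\<in>UNIV. exp (hi i) - exp (lo i))\<bar>
    \<le> 2 ^ CARD('n) * (\<bar>A\<bar> * CE * exp (\<Sum>i\<in>UNIV. hi i) * exp (- (\<kappa> * \<tau>)))"
proof -
  have \<omega>: "0 < \<omega> i" and CE: "0 \<le> CE" for i using I by (auto simp: property_I_def)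
  let ?b = "\<lambda>X i. if i \<in> X then lo i else hi i"
  let ?e = "\<bar>A\<bar> * CE * exp (\<Sum>i\<in>UNIV. hi i) * exp (- (\<kappa> * \<tau>))"
  have "(\<Prod>i\<in>UNIV. exp (hi i) - exp (lo i)) = (\<Sum>X\<in>UNIV. (-1) ^ card X * exp (\<Sum>i\<in>UNIV. ?b X i))"
    unfolding prod_diff_corners exp_sum[OF finite] by (simp add: if_distrib)
  then have "cell_sum f \<omega> lo hi - CM * (\<Prod>i\<in>UNIV. exp (hi i) - exp (lo i))
      = (\<Sum>X\<in>UNIV. (-1) ^ card X * (box_sum f \<omega> (?b X) - CM * exp (\<Sum>i\<in>UNIV. ?b X i)))"
    unfolding cell_sum_corners[OF \<omega> b(3)]
    by (simp add: sum_distrib_left right_diff_distrib sum_subtractf mult.left_commute)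
  also have "\<bar>\<dots>\<bar> \<le> (\<Sum>X\<in>(UNIV :: 'n set set). ?e)"
  proof (rule sum_abs[THEN order_trans], rule sum_mono)
    fix X :: "'n set"
    have "\<tau> \<le> ?b X i" for i using b(2)[of i] b(3)[of i] by auto
    from box_sum_asymptotic[OF I \<kappa> b(1) this]
    have "\<bar>box_sum f \<omega> (?b X) - CM * exp (\<Sum>i\<in>UNIV. ?b X i)\<bar>
        \<le> \<bar>A\<bar> * CE * exp (\<Sum>i\<in>UNIV. ?b X i) * exp (- (\<kappa> * \<tau>))" .
    also have "\<dots> \<le> ?e"
      using CE b(3) by (intro mult_right_mono mult_left_mono) (auto intro!: sum_mono)
    finally show "\<bar>(-1) ^ card X * (box_sum f \<omega> (?b X) - CM * exp (\<Sum>i\<in>UNIV. ?b X i))\<bar> \<le> ?e"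
      by (simp add: abs_mult power_abs)
  qed
  also have "\<dots> = 2 ^ CARD('n) * ?e"
    by (simp add: card_Pow flip: Pow_UNIV)
  finally show ?thesis .
qed

section \<open>Grid cells under the exponential measure\<close>

text \<open>The shift \<open>d\<close> makes it possible to compare a cell with its translates along the diagonal of the
grid under one index \<open>q\<close>.\<close>

definition cell :: "real \<Rightarrow> real \<Rightarrow> ('n \<Rightarrow> nat) \<Rightarrow> ('n \<Rightarrow> real) set" where
  "cell \<eta> d q = {v. \<forall>i. \<eta> * (real (q i) + d) < v i \<and> v i \<le> \<eta> * (real (q i) + d + 1)}"

definition cell_mass :: "real \<Rightarrow> real \<Rightarrow> ('n::finite \<Rightarrow> nat) \<Rightarrow> real" where
  "cell_mass \<eta> d q = (\<Prod>i\<in>UNIV. exp (\<eta> * (real (q i) + d + 1)) - exp (\<eta> * (real (q i) + d)))"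

lemma cell_unique:
  assumes "0 < \<eta>" "v \<in> cell \<eta> d q" "v \<in> cell \<eta> d q'"
  shows "q = q'"
proof
  fix i
  have "\<eta> * (real (q i) + d) < \<eta> * (real (q' i) + d + 1)"
      "\<eta> * (real (q' i) + d) < \<eta> * (real (q i) + d + 1)"
    using assms(2,3) unfolding cell_def by (blast intro: less_le_trans)+
  then have "real (q i) + d < real (q' i) + d + 1" "real (q' i) + d < real (q i) + d + 1"
    using assms(1) by (simp_all only: mult_less_cancel_left_pos)
  then show "q i = q' i" by linarith
qed

text \<open>A translation along the diagonal multiplies the mass by a constant. With \<open>\<eta> = 1 / L\<close> and one step
this constant is \<open>1 + O(1 / L)\<close>, so cells that cross the boundary of the region can be moved
inside at no significant cost.\<close>

lemma cell_mass_shift: 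
  "cell_mass \<eta> (d + c) q = exp (\<eta> * c * CARD('n)) * cell_mass \<eta> d (q :: 'n::finite \<Rightarrow> nat)"
proof -
  have "exp (\<eta> * (real (q i) + (d + c) + 1)) - exp (\<eta> * (real (q i) + (d + c)))
      = exp (\<eta> * c) * (exp (\<eta> * (real (q i) + d + 1)) - exp (\<eta> * (real (q i) + d)))" for i
    by (simp add: right_diff_distrib exp_add[symmetric] algebra_simps)
  then have "cell_mass \<eta> (d + c) q = exp (\<eta> * c) ^ CARD('n) * cell_mass \<eta> d q"
    by (simp add: cell_mass_def prod.distrib)
  then show ?thesis by (simp add: exp_of_nat_mult[symmetric] mult.commute)
qed

lemma cell_mass_nonneg: "0 \<le> \<eta> \<Longrightarrow> 0 \<le> cell_mass \<eta> d q"
  unfolding cell_mass_def by (intro prod_nonneg) (auto intro!: mult_left_mono)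

lemma nn_integral_exp_interval:
  fixes R :: real
  assumes R: "0 < R" and le: "l \<le> h"
  shows "(\<integral>\<^sup>+ x. ennreal (exp (R * x)) * indicator {x. l < R * x \<and> R * x \<le> h} x \<partial>lborel)
    = ennreal ((exp h - exp l) / R)"
proof -
  have "AE x :: real in lborel. x \<noteq> l / R" by (rule AE_lborel_singleton)
  then have "AE x in lborel. ennreal (exp (R * x)) * indicator {x. l < R * x \<and> R * x \<le> h} x
      = ennreal (exp (R * x)) * indicator {l / R..h / R} x"
  proof eventually_elim
    case (elim x)
    have "l < R * x \<and> R * x \<le> h \<longleftrightarrow> x \<in> {l / R..h / R}"
      using elim R by (auto simp: field_simps)
    then show ?case by (simp add: indicator_def)
  qed
  then have "(\<integral>\<^sup>+ x. ennreal (exp (R * x)) * indicator {x. l < R * x \<and> R * x \<le> h} x \<partial>lborel)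
      = (\<integral>\<^sup>+ x. ennreal (exp (R * x)) * indicator {l / R..h / R} x \<partial>lborel)"
    by (rule nn_integral_cong_AE)
  also have "\<dots> = ennreal (exp (R * (h / R)) / R - exp (R * (l / R)) / R)"
    by (rule nn_integral_FTC_Icc)
       (use R le in \<open>auto intro!: derivative_eq_intros divide_right_mono simp: field_simps has_real_derivative_iff_has_vector_derivative[symmetric]\<close>)
  finally show ?thesis using R by (simp add: diff_divide_distrib)
qed

lemma emeasure_exp_measure_cell:
  fixes q :: "'n::finite \<Rightarrow> nat"
  assumes R: "0 < R" and \<eta>: "0 < \<eta>"
  shows "emeasure (exp_measure R) {u. (\<lambda>i. R * u i) \<in> cell \<eta> d q}
      = ennreal (cell_mass \<eta> d q / R ^ CARD('n))"
    and "{u. (\<lambda>i. R * u i) \<in> cell \<eta> d q} \<in> sets (leb_on UNIV)"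
proof -
  let ?l = "\<lambda>i. \<eta> * (real (q i) + d)" and ?h = "\<lambda>i. \<eta> * (real (q i) + d + 1)"
  let ?I = "\<lambda>i. {x. ?l i < R * x \<and> R * x \<le> ?h i}"
  let ?C = "{u. (\<lambda>i. R * u i) \<in> cell \<eta> d q}"
  have C: "?C = PiE UNIV ?I" by (auto simp: cell_def PiE_def)
  show sets: "?C \<in> sets (leb_on UNIV)"
    unfolding C by (intro sets_PiM_I_finite) auto
  have le: "?l i \<le> ?h i" for i using \<eta> by (intro mult_left_mono) auto
  have "emeasure (exp_measure R) ?C
      = (\<integral>\<^sup>+ u. ennreal (exp (R * (\<Sum>j\<in>UNIV. u j))) * indicator ?C u \<partial>leb_on UNIV)"
    unfolding exp_measure_def using sets by (subst emeasure_density) auto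
  also have "\<dots> = (\<integral>\<^sup>+ u. (\<Prod>i\<in>UNIV. ennreal (exp (R * u i)) * indicator (?I i) (u i)) \<partial>leb_on UNIV)"
  proof (rule nn_integral_cong)
    fix u :: "'n \<Rightarrow> real"
    have "ennreal (exp (R * (\<Sum>j\<in>UNIV. u j))) = (\<Prod>i\<in>UNIV. ennreal (exp (R * u i)))"
      by (simp add: prod_ennreal sum_distrib_left exp_sum)
    moreover have "indicator ?C u = (\<Prod>i\<in>UNIV. indicator (?I i) (u i) :: ennreal)"
    proof (cases "u \<in> ?C")
      case True
      then show ?thesis unfolding C by (auto simp: PiE_def Pi_def)
    next
      case False
      then have "\<exists>i. u i \<notin> ?I i" unfolding C by auto
      then show ?thesis using False by (auto intro!: prod_zero[symmetric] simp: indicator_def)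
    qed
    ultimately show "ennreal (exp (R * (\<Sum>j\<in>UNIV. u j))) * indicator ?C u
        = (\<Prod>i\<in>UNIV. ennreal (exp (R * u i)) * indicator (?I i) (u i))"
      by (simp add: prod.distrib)
  qed
  also have "\<dots> = (\<Prod>i\<in>UNIV. \<integral>\<^sup>+ x. ennreal (exp (R * x)) * indicator (?I i) x \<partial>lborel)"
    by (rule lborels.product_nn_integral_prod) auto
  also have "\<dots> = (\<Prod>i\<in>UNIV. ennreal ((exp (?h i) - exp (?l i)) / R))"
    by (intro prod.cong nn_integral_exp_interval R le refl)
  also have "\<dots> = ennreal (\<Prod>i\<in>UNIV. (exp (?h i) - exp (?l i)) / R)"
    using R le by (intro prod_ennreal) auto
  also have "(\<Prod>i\<in>UNIV. (exp (?h i) - exp (?l i)) / R) = cell_mass \<eta> d q / R ^ CARD('n)"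
    by (simp add: cell_mass_def prod_dividef)
  finally show "emeasure (exp_measure R) ?C = ennreal (cell_mass \<eta> d q / R ^ CARD('n))" .
qed

lemma emeasure_exp_measure_cells:
  fixes G :: "('n::finite \<Rightarrow> nat) set"
  assumes "finite G" "0 < R" "0 < \<eta>"
  shows "emeasure (exp_measure R) (\<Union>q\<in>G. {u. (\<lambda>i. R * u i) \<in> cell \<eta> d q})
      = ennreal ((\<Sum>q\<in>G. cell_mass \<eta> d q) / R ^ CARD('n))"
proof -
  let ?C = "\<lambda>q. {u. (\<lambda>i. R * u i) \<in> cell \<eta> d q}"
  have "emeasure (exp_measure R) (\<Union>q\<in>G. ?C q) = (\<Sum>q\<in>G. emeasure (exp_measure R) (?C q))"
  proof (rule sum_emeasure[symmetric])
    show "?C ` G \<subseteq> sets (exp_measure R)"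
      using emeasure_exp_measure_cell(2)[OF assms(2,3)] by (auto simp: exp_measure_def)
    show "disjoint_family_on ?C G"
      using cell_unique[OF assms(3)] by (auto simp: disjoint_family_on_def)
  qed fact
  also have "\<dots> = (\<Sum>q\<in>G. ennreal (cell_mass \<eta> d q / R ^ CARD('n)))"
    by (simp add: emeasure_exp_measure_cell(1)[OF assms(2,3)])
  also have "\<dots> = ennreal (\<Sum>q\<in>G. cell_mass \<eta> d q / R ^ CARD('n))"
    using assms cell_mass_nonneg[of \<eta> d] by (intro sum_ennreal divide_nonneg_nonneg) auto
  finally show ?thesis by (simp add: sum_divide_distrib)
qed

lemma sum_cell_mass_le:
  fixes G :: "('n::finite \<Rightarrow> nat) set"
  assumes "finite G" "0 < R" "0 < \<eta>"
    and sub: "\<And>q u. q \<in> G \<Longrightarrow> (\<lambda>i. R * u i) \<in> cell \<eta> d q \<Longrightarrow> u \<in> X"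
    and X: "X \<in> sets (leb_on UNIV)" "emeasure (exp_measure R) X \<le> ennreal V" and "0 \<le> V"
  shows "(\<Sum>q\<in>G. cell_mass \<eta> d q) \<le> R ^ CARD('n) * V"
proof -
  have "ennreal ((\<Sum>q\<in>G. cell_mass \<eta> d q) / R ^ CARD('n)) \<le> emeasure (exp_measure R) X"
    unfolding emeasure_exp_measure_cells[OF assms(1-3), symmetric]
    by (rule emeasure_mono) (use sub X in \<open>auto simp: exp_measure_def\<close>)
  also note X(2)
  finally have "(\<Sum>q\<in>G. cell_mass \<eta> d q) / R ^ CARD('n) \<le> V"
    using \<open>0 \<le> V\<close> by (simp add: ennreal_le_iff)
  then show ?thesis using \<open>0 < R\<close> by (simp add: field_simps)
qed

section \<open>The region of summation\<close>

locale hyperbola_region =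
  fixes K :: "'k set" and \<alpha> :: "'n::finite \<Rightarrow> 'k \<Rightarrow> real" and \<omega> :: "'n \<Rightarrow> real"
    and P :: "(real ^ 'n) set"
  assumes finite_K: "finite K"
    and \<alpha>_nonneg: "\<And>i j. j \<in> K \<Longrightarrow> 0 \<le> \<alpha> i j"
    and \<omega>_pos: "\<And>i. 0 < \<omega> i"
    and P_def: "P = polyhedron_P K \<alpha> \<omega>"
    and bounded_region: "bounded P"
    and face_not_coordinate: "\<And>i. \<not> max_face P \<subseteq> {t. t $ i = 0}"

sublocale hyperbola_region \<subseteq> bounded_polyhedron
  "Inl ` K \<union> range Inr" "case_sum (\<lambda>_. 1) (\<lambda>_. 0)"
  "case_sum (\<lambda>j. - (\<chi> i. \<alpha> i j * inverse (\<omega> i))) (\<lambda>i. axis i 1)" P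
proof
  show "finite (Inl ` K \<union> range (Inr :: 'n \<Rightarrow> 'k + 'n))" using finite_K by simp
  show "P = {t. \<forall>m\<in>Inl ` K \<union> range Inr. 0 \<le> case_sum (\<lambda>_. 1) (\<lambda>_. 0) m
      + case_sum (\<lambda>j. - (\<chi> i. \<alpha> i j * inverse (\<omega> i))) (\<lambda>i. axis i 1) m \<bullet> t}"
    by (auto simp: P_def polyhedron_P_def inner_axis' ball_Un) (auto simp: inner_vec_def)
  show "bounded P" by (rule bounded_region)
  have "0 \<in> P" by (simp add: P_def polyhedron_P_def)
  then show "P \<noteq> {}" by blast
qed

context hyperbola_region begin

abbreviation k :: nat where "k \<equiv> max_face_dim P"

definition region :: "('n \<Rightarrow> real) set" where
  "region = {u. (\<chi> j. u j) \<in> P}"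

definition load :: "'k \<Rightarrow> ('n \<Rightarrow> real) \<Rightarrow> real" where
  "load j u = (\<Sum>i\<in>UNIV. \<alpha> i j * inverse (\<omega> i) * u i)"

definition points :: "real \<Rightarrow> (nat ^ 'n) set" where
  "points L = {y. (\<forall>i. 1 \<le> y $ i) \<and> (\<lambda>i. log_coord \<omega> y i / L) \<in> region}"

lemma P_iff: "t \<in> P \<longleftrightarrow> (\<forall>j\<in>K. (\<Sum>i\<in>UNIV. \<alpha> i j * inverse (\<omega> i) * t $ i) \<le> 1) \<and> (\<forall>i. 0 \<le> t $ i)"
  unfolding P_def polyhedron_P_def by simp

lemma region_iff: "u \<in> region \<longleftrightarrow> (\<forall>j\<in>K. load j u \<le> 1) \<and> (\<forall>i. 0 \<le> u i)"
  by (simp add: region_def P_iff load_def)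

lemma load_mono: "j \<in> K \<Longrightarrow> (\<And>i. u i \<le> v i) \<Longrightarrow> load j u \<le> load j v"
  unfolding load_def by (intro sum_mono mult_left_mono) (auto simp: \<alpha>_nonneg \<omega>_pos less_imp_le)

lemma load_scale: "load j (\<lambda>i. u i / L) = load j u / L"
  by (simp add: load_def sum_divide_distrib)

lemma load_nonneg: "j \<in> K \<Longrightarrow> (\<And>i. 0 \<le> u i) \<Longrightarrow> 0 \<le> load j u"
  using load_mono[of j "\<lambda>_. 0" u] by (simp add: load_def)

text \<open>The coefficients of the inequalities are nonnegative. This is how grid cells are compared with the
region: a cell is inside as soon as its upper corner is.\<close>

lemma region_down: "u \<in> region \<Longrightarrow> (\<And>i. 0 \<le> v i) \<Longrightarrow> (\<And>i. v i \<le> u i) \<Longrightarrow> v \<in> region"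
  unfolding region_iff using load_mono[of _ v u] order_trans by meson

lemma region_bound: "\<exists>D\<ge>1. \<forall>u\<in>region. \<forall>i. u i \<le> D"
proof -
  obtain D where D: "\<And>t. t \<in> P \<Longrightarrow> norm t \<le> D" using bounded_region by (auto simp: bounded_iff)
  have "u i \<le> max 1 D" if u: "u \<in> region" for u i
    using component_le_norm_cart[of "\<chi> j. u j" i] D[of "\<chi> j. u j"] u by (simp add: region_def)
  then show ?thesis by (intro exI[of _ "max 1 D"]) auto
qed

lemma region_sum: "u \<in> region \<Longrightarrow> (\<Sum>i\<in>UNIV. u i) \<le> a"
  using sum_le_a[of "\<chi> j. u j"] by (simp add: region_def)

lemma region_inflate:
  "\<exists>C\<ge>0. \<forall>L>0. \<forall>x v. (\<lambda>i. x i / L) \<in> region \<longrightarrow> (\<forall>i. 0 \<le> v i \<and> v i \<le> x i + 2) \<longrightarrow>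
     (\<lambda>i. v i / (L + C)) \<in> region"
proof -
  define C where "C = (\<Sum>j\<in>K. load j (\<lambda>_. 2))"
  have C0: "C \<ge> 0" by (auto simp: C_def intro!: sum_nonneg load_nonneg)
  have C: "load j (\<lambda>_. 2) \<le> C" if "j \<in> K" for j
    unfolding C_def using that finite_K by (intro member_le_sum) (auto intro!: load_nonneg)
  have "(\<lambda>i. v i / (L + C)) \<in> region"
    if L: "L > 0" and x: "(\<lambda>i. x i / L) \<in> region" and v: "\<And>i. 0 \<le> v i" "\<And>i. v i \<le> x i + 2" for L x v
    unfolding region_iff
  proof (intro conjI allI ballI)
    fix j assume j: "j \<in> K"
    have "load j v \<le> load j (\<lambda>i. x i + 2)" using j v by (intro load_mono)
    also have "\<dots> = load j x + load j (\<lambda>_. 2)" by (simp add: load_def distrib_left sum.distrib)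
    also have "\<dots> \<le> L + C"
      using x j L C[OF j] by (auto simp: region_iff load_scale field_simps intro: add_mono)
    finally show "load j (\<lambda>i. v i / (L + C)) \<le> 1"
      using L C0 by (simp add: load_scale field_simps)
  next
    fix i show "0 \<le> v i / (L + C)" using v L C0 by simp
  qed
  then show ?thesis using C0 by blast
qed

lemma points_subset_log_box:
  assumes "0 < L" "\<And>u i. u \<in> region \<Longrightarrow> u i \<le> D"
  shows "points L \<subseteq> {y. \<forall>i. 1 \<le> y $ i \<and> log_coord \<omega> y i \<le> D * L}"
proof
  fix y assume y: "y \<in> points L"
  have "log_coord \<omega> y i / L \<le> D" for i using assms(2) y by (auto simp: points_def)
  then show "y \<in> {y. \<forall>i. 1 \<le> y $ i \<and> log_coord \<omega> y i \<le> D * L}"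
    using y assms(1) by (auto simp: points_def field_simps)
qed

lemma finite_points: "0 < L \<Longrightarrow> finite (points L)"
proof -
  assume L: "0 < L"
  obtain D where "\<And>u i. u \<in> region \<Longrightarrow> u i \<le> D" using region_bound by auto
  then have "points L \<subseteq> {y. \<forall>i. 1 \<le> y $ i \<and> log_coord \<omega> y i \<le> D * L}"
    by (intro points_subset_log_box[OF L]) blast
  then show ?thesis
    by (rule finite_subset) (rule finite_log_box[OF \<omega>_pos])
qed

lemma S_sum_eq:
  assumes L: "0 < L"
  shows "S_sum K \<alpha> f (exp L) = (\<Sum>y\<in>points L. f y)"
  unfolding S_sum_def
proof (rule sum.cong)
  have "(\<Prod>i\<in>UNIV. real (y $ i) powr \<alpha> i j) \<le> exp L \<longleftrightarrow> load j (\<lambda>i. log_coord \<omega> y i / L) \<le> 1"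
    if y: "\<forall>i. 1 \<le> y $ i" for y j
  proof -
    have "(\<Prod>i\<in>UNIV. real (y $ i) powr \<alpha> i j) = (\<Prod>i\<in>UNIV. exp (\<alpha> i j * ln (real (y $ i))))"
    proof (intro prod.cong refl)
      fix i have "y $ i \<noteq> 0" using y by (metis not_one_le_zero)
      then show "real (y $ i) powr \<alpha> i j = exp (\<alpha> i j * ln (real (y $ i)))" by (simp add: powr_def)
    qed
    also have "\<dots> = exp (\<Sum>i\<in>UNIV. \<alpha> i j * ln (real (y $ i)))" by (simp add: exp_sum)
    also have "(\<Sum>i\<in>UNIV. \<alpha> i j * ln (real (y $ i))) = load j (log_coord \<omega> y)"
      unfolding load_def log_coord_def
      by (intro sum.cong) (use \<omega>_pos in \<open>auto simp: less_imp_neq[symmetric]\<close>)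
    finally show ?thesis using L by (simp add: load_scale)
  qed
  moreover have "\<forall>i. 0 \<le> log_coord \<omega> y i / L" if "\<forall>i. 1 \<le> y $ i" for y
    using that L \<omega>_pos by (simp add: log_coord_nonneg)
  ultimately show "{y. (\<forall>i. 1 \<le> y $ i) \<and> (\<forall>j\<in>K. (\<Prod>i\<in>UNIV. real (y $ i) powr \<alpha> i j) \<le> exp L)} = points L"
    unfolding points_def region_iff by blast
qed simp

lemma sets_region: "region \<in> sets (leb_on UNIV)"
proof -
  have "(\<lambda>u. \<chi> j. u j) \<in> leb_on UNIV \<rightarrow>\<^sub>M (borel :: (real ^ 'n) measure)"
    by (rule measurable_vec_lambda) simp
  from measurable_sets[OF this borel_P] show ?thesis
    by (simp add: region_def vimage_def space_PiM PiE_def)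
qed

lemma sets_region_near: "{u \<in> region. u l \<le> \<epsilon>} \<in> sets (leb_on UNIV)"
proof -
  have "{u \<in> space (leb_on UNIV). u l \<le> \<epsilon>} \<in> sets (leb_on UNIV)" by measurable
  from sets.Int[OF sets_region this] show ?thesis
    by (rule back_subst[where P="\<lambda>x. x \<in> sets (leb_on UNIV)"]) (auto simp: space_PiM)
qed

lemma region_near_le:
  "\<exists>C\<ge>0. \<forall>R>0. \<forall>\<epsilon>\<ge>0. \<forall>l. emeasure (exp_measure R) {u \<in> region. u l \<le> \<epsilon>}
    \<le> ennreal (C * exp (a * R) * (\<epsilon> / R ^ Suc codim + 1 / R ^ Suc (Suc codim)))"
proof -
  have "\<forall>l. \<exists>C\<ge>0. \<forall>R>0. \<forall>\<epsilon>\<ge>0. emeasure (exp_measure R) {u \<in> region. u l \<le> \<epsilon>}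
    \<le> ennreal (C * exp (a * R) * (\<epsilon> / R ^ Suc codim + 1 / R ^ Suc (Suc codim)))"
  proof
    fix l
    have "{u \<in> region. u l \<le> \<epsilon>} = {u. (\<chi> j. u j) \<in> P \<and> \<bar>u l\<bar> \<le> \<epsilon>}" for \<epsilon>
      by (auto simp: region_def P_iff)
    moreover obtain q where "q \<in> F" "q $ l \<noteq> 0" using face_not_coordinate[of l] by auto
    ultimately show "\<exists>C\<ge>0. \<forall>R>0. \<forall>\<epsilon>\<ge>0. emeasure (exp_measure R) {u \<in> region. u l \<le> \<epsilon>}
        \<le> ennreal (C * exp (a * R) * (\<epsilon> / R ^ Suc codim + 1 / R ^ Suc (Suc codim)))"
      using exp_measure_near_hyperplane_le by simp
  qed
  from choice[OF this] obtain C where C: "\<forall>l. 0 \<le> C l \<and> (\<forall>R>0. \<forall>\<epsilon>\<ge>0.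
      emeasure (exp_measure R) {u \<in> region. u l \<le> \<epsilon>}
      \<le> ennreal (C l * exp (a * R) * (\<epsilon> / R ^ Suc codim + 1 / R ^ Suc (Suc codim))))"
    by blast
  define C' where "C' = (\<Sum>l\<in>UNIV. C l)"
  have C': "C l \<le> C'" for l unfolding C'_def using C by (intro member_le_sum) auto
  have "C' \<ge> 0" using C by (auto simp: C'_def intro!: sum_nonneg)
  moreover have "emeasure (exp_measure R) {u \<in> region. u l \<le> \<epsilon>}
      \<le> ennreal (C' * exp (a * R) * (\<epsilon> / R ^ Suc codim + 1 / R ^ Suc (Suc codim)))"
    if "R > 0" "\<epsilon> \<ge> 0" for R \<epsilon> l
  proof -
    have "emeasure (exp_measure R) {u \<in> region. u l \<le> \<epsilon>}
        \<le> ennreal (C l * exp (a * R) * (\<epsilon> / R ^ Suc codim + 1 / R ^ Suc (Suc codim)))"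
      using C that by blast
    also have "\<dots> \<le> ennreal (C' * exp (a * R) * (\<epsilon> / R ^ Suc codim + 1 / R ^ Suc (Suc codim)))"
      using that C' by (intro ennreal_leI mult_right_mono) auto
    finally show ?thesis .
  qed
  ultimately show ?thesis by blast
qed

lemma power_card: "R ^ CARD('n) = R ^ k * R ^ Suc codim" for R :: real
proof -
  have "CARD('n) = k + Suc codim" using max_face_dim_less by simp
  then have "R ^ CARD('n) = R ^ (k + Suc codim)" by (rule arg_cong)
  then show ?thesis by (simp only: power_add)
qed

lemma sum_group_le:
  fixes f :: "nat ^ 'n \<Rightarrow> real"
  assumes fin: "finite Y" and G: "finite G" "g ` Y \<subseteq> G"
    and le: "\<And>q. q \<in> G \<Longrightarrow> (\<Sum>y | y \<in> Y \<and> g y = q. f y) \<le> h q"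
  shows "(\<Sum>y\<in>Y. f y) \<le> (\<Sum>q\<in>G. h q)"
proof -
  have "(\<Sum>y\<in>Y. f y) = (\<Sum>q\<in>G. \<Sum>y | y \<in> Y \<and> g y = q. f y)"
    by (rule sum.group[symmetric]) (use fin G in auto)
  also have "\<dots> \<le> (\<Sum>q\<in>G. h q)" using le by (rule sum_mono)
  finally show ?thesis .
qed

text \<open>Each point lies in a unit cell, whose total weight is at most a constant times the exponential
mass of the next unit cell up. These next cells lie in the region for the slightly larger parameter
\<open>L + C0\<close>, near the same coordinate hyperplane, and there the integral bound applies.\<close>

lemma sum_points_near_le:
  "\<exists>C\<ge>0. \<forall>f CM CE. property_I A \<Delta> \<omega> CM CE f \<longrightarrow> (\<forall>L\<ge>1. \<forall>T\<ge>0. \<forall>l.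
     (\<Sum>y | y \<in> points L \<and> log_coord \<omega> y l \<le> T. f y) \<le> C * CE * (exp (a * L) * L ^ k / L * (T + 1)))"
proof -
  obtain C0 where C0: "C0 \<ge> 0" "\<And>L x v. L > 0 \<Longrightarrow> (\<lambda>i. x i / L) \<in> region \<Longrightarrow>
      (\<And>i. 0 \<le> v i \<and> v i \<le> x i + 2) \<Longrightarrow> (\<lambda>i. v i / (L + C0)) \<in> region"
    using region_inflate by blast
  obtain C1 where C1: "C1 \<ge> 0" "\<And>R \<epsilon> l. R > 0 \<Longrightarrow> \<epsilon> \<ge> 0 \<Longrightarrow>
      emeasure (exp_measure R) {u \<in> region. u l \<le> \<epsilon>}
      \<le> ennreal (C1 * exp (a * R) * (\<epsilon> / R ^ Suc codim + 1 / R ^ Suc (Suc codim)))"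
    using region_near_le by blast
  define C where "C = (1 + \<bar>A\<bar>) * (C1 * exp (a * C0) * (1 + C0) ^ k * 3)"
  have "C \<ge> 0" using C0 C1 by (simp add: C_def)
  moreover have "(\<Sum>y | y \<in> points L \<and> log_coord \<omega> y l \<le> T. f y) \<le> C * CE * (exp (a * L) * L ^ k / L * (T + 1))"
    if I: "property_I A \<Delta> \<omega> CM CE f" and L: "L \<ge> 1" and T: "T \<ge> 0" for f CM CE L T l
  proof -
    have CM: "0 \<le> CM" "CM \<le> CE" and \<Delta>: "0 < \<Delta>" and f: "\<And>y. (\<forall>i. 1 \<le> y $ i) \<Longrightarrow> 0 \<le> f y"
      using I by (auto simp: property_I_def)
    let ?x = "log_coord \<omega>"
    let ?Y = "{y. y \<in> points L \<and> ?x y l \<le> T}"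
    define q where "q y i = nat \<lceil>?x y i\<rceil>" for y i
    \<comment> \<open>\<open>R\<close> times the region contains every nonnegative point that exceeds
      a point of \<open>L\<close> times the region by at most 2 in each coordinate\<close>
    define R where "R = L + C0"
    have R: "R > 0" "R \<ge> L" "R \<le> (1 + C0) * L"
      using L C0(1) mult_left_mono[OF L C0(1)] by (auto simp: R_def algebra_simps)
    have fin: "finite ?Y" using finite_points[of L] L by simp
    have pos: "1 \<le> y $ i" "0 \<le> ?x y i" if "y \<in> points L" for y i
      using that \<omega>_pos by (auto simp: points_def intro!: log_coord_nonneg)
    have q: "?x y i \<le> real (q y i)" "real (q y i) \<le> ?x y i + 1" if "y \<in> points L" for y i
      using pos(2)[OF that, of i] unfolding q_def by linarith+
    have one: "(\<Sum>y | y \<in> ?Y \<and> q y = p. f y) \<le> (1 + \<bar>A\<bar>) * CE * cell_mass 1 0 p" for p :: "'n \<Rightarrow> nat"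
    proof -
      let ?e = "exp (\<Sum>i\<in>UNIV. real (p i))"
      have "(\<Sum>y | y \<in> ?Y \<and> q y = p. f y) \<le> box_sum f \<omega> (\<lambda>i. real (p i))"
        unfolding box_sum_def
        by (rule sum_mono2) (use finite_log_box[OF \<omega>_pos] q pos(1) f in auto)
      also have "\<dots> \<le> CM * ?e + \<bar>A\<bar> * CE * ?e"
        using box_sum_asymptotic[OF I, of 0 0 "\<lambda>i. real (p i)"] \<Delta> by simp
      also have "\<dots> \<le> (1 + \<bar>A\<bar>) * CE * ?e"
        using mult_right_mono[OF CM(2), of ?e] by (simp add: algebra_simps)
      also have "?e \<le> cell_mass 1 0 p"
      proof -
        have "exp (real (p i)) \<le> exp (real (p i) + 1) - exp (real (p i))" for i
        proof -
          have "2 * exp (real (p i)) \<le> exp 1 * exp (real (p i))"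
            using exp_ge_add_one_self[of 1] by (intro mult_right_mono) auto
          then show ?thesis by (simp add: exp_add mult.commute)
        qed
        then show ?thesis
          unfolding exp_sum[OF finite] cell_mass_def by (intro prod_mono) auto
      qed
      finally show ?thesis using CM by (simp add: mult_left_mono)
    qed
    have "(\<Sum>y\<in>?Y. f y) \<le> (\<Sum>p\<in>q ` ?Y. (1 + \<bar>A\<bar>) * CE * cell_mass 1 0 p)"
      by (rule sum_group_le[where g=q]) (use fin one in auto)
    also have "\<dots> = (1 + \<bar>A\<bar>) * CE * (\<Sum>p\<in>q ` ?Y. cell_mass 1 0 p)"
      by (simp add: sum_distrib_left)
    also have "(\<Sum>p\<in>q ` ?Y. cell_mass 1 0 p) \<le> R ^ CARD('n) *
        (C1 * exp (a * R) * ((T + 2) / R / R ^ Suc codim + 1 / R ^ Suc (Suc codim)))"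
    proof (rule sum_cell_mass_le[OF _ R(1), where X="{u \<in> region. u l \<le> (T + 2) / R}"])
      fix p u assume "p \<in> q ` ?Y" and u: "(\<lambda>i. R * u i) \<in> cell 1 0 p"
      then obtain y where y: "y \<in> points L" "?x y l \<le> T" "p = q y" by auto
      have u': "0 \<le> R * u i" "R * u i \<le> ?x y i + 2" for i
      proof -
        have "real (p i) < R * u i" "R * u i \<le> real (p i) + 1" using u by (auto simp: cell_def)
        then show "0 \<le> R * u i" "R * u i \<le> ?x y i + 2" using q[OF y(1), of i] y(3) by auto
      qed
      have "(\<lambda>i. R * u i / (L + C0)) \<in> region"
        using y(1) L u' by (intro C0(2)[of L "?x y"]) (auto simp: points_def)
      then have "u \<in> region" using R(1) by (simp add: R_def[symmetric])
      moreover have "u l \<le> (T + 2) / R"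
        using u'(2)[of l] y(2) R(1) by (simp add: field_simps)
      ultimately show "u \<in> {u \<in> region. u l \<le> (T + 2) / R}" by simp
    next
      show "emeasure (exp_measure R) {u \<in> region. u l \<le> (T + 2) / R}
          \<le> ennreal (C1 * exp (a * R) * ((T + 2) / R / R ^ Suc codim + 1 / R ^ Suc (Suc codim)))"
        using T R by (intro C1(2)) auto
    qed (use fin sets_region_near C1(1) T R in auto)
    also have "\<dots> = C1 * exp (a * R) * (R ^ k / R) * (T + 3)"
      unfolding power_card using R(1) by (simp add: field_simps)
    also have "\<dots> \<le> C1 * (exp (a * L) * exp (a * C0)) * ((1 + C0) ^ k * L ^ k / L) * (3 * (T + 1))"
    proof -
      have "R ^ k / R \<le> (1 + C0) ^ k * L ^ k / L"
      proof -
        have "R ^ k \<le> ((1 + C0) * L) ^ k" using R by (intro power_mono) auto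
        then show ?thesis using R L C0(1) unfolding power_mult_distrib by (intro frac_le) auto
      qed
      moreover have "exp (a * R) = exp (a * L) * exp (a * C0)"
        by (simp add: R_def distrib_left exp_add)
      ultimately show ?thesis using C1(1) C0(1) L T R(1) by (intro mult_mono) auto
    qed
    finally have "(\<Sum>y\<in>?Y. f y) \<le> (1 + \<bar>A\<bar>) * CE *
        (C1 * (exp (a * L) * exp (a * C0)) * ((1 + C0) ^ k * L ^ k / L) * (3 * (T + 1)))"
      using CM by (simp add: mult_left_mono)
    also have "\<dots> = C * CE * (exp (a * L) * L ^ k / L * (T + 1))"
      unfolding C_def by (simp only: times_divide_eq_left times_divide_eq_right mult_ac)
    finally show ?thesis .
  qed
  ultimately show ?thesis by blast
qed

end

section \<open>Comparison of the sum with the integral\<close>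

lemma cell_sum_eq_cell:
  "cell_sum f \<omega> (\<lambda>i. \<eta> * (real (q i) + d)) (\<lambda>i. \<eta> * (real (q i) + d + 1))
    = (\<Sum>y | (\<forall>i. 1 \<le> y $ i) \<and> log_coord \<omega> y \<in> cell \<eta> d q. f y)"
  unfolding cell_sum_def cell_def by (rule sum.cong) auto

lemma mem_cell_ceiling:
  assumes \<eta>: "0 < \<eta>" and v: "\<And>i. \<eta> * d < v i" "0 \<le> d"
  shows "v \<in> cell \<eta> (-1) (\<lambda>i. nat \<lceil>v i / \<eta>\<rceil>)" and "d < real (nat \<lceil>v i / \<eta>\<rceil>)"
proof -
  have d: "d < v i / \<eta>" for i using v(1)[of i] \<eta> by (simp add: field_simps)
  have c: "real (nat \<lceil>v i / \<eta>\<rceil>) - 1 < v i / \<eta>" "v i / \<eta> \<le> real (nat \<lceil>v i / \<eta>\<rceil>)" for i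
    using d[of i] v(2) by linarith+
  show "d < real (nat \<lceil>v i / \<eta>\<rceil>)" using d[of i] c(2)[of i] by linarith
  show "v \<in> cell \<eta> (-1) (\<lambda>i. nat \<lceil>v i / \<eta>\<rceil>)"
    unfolding cell_def
  proof (intro CollectI allI conjI)
    fix i
    show "\<eta> * (real (nat \<lceil>v i / \<eta>\<rceil>) + -1) < v i" "v i \<le> \<eta> * (real (nat \<lceil>v i / \<eta>\<rceil>) + -1 + 1)"
      using c[of i] \<eta> by (simp_all add: field_simps)
  qed
qed

context hyperbola_region begin

text \<open>The cells of side \<open>\<eta>\<close> all of whose coordinates exceed \<open>q0 * \<eta>\<close>, and whose lower corner (outer
cells) or upper corner (inner cells) lies in \<open>L\<close> times the region. The cell of index \<open>q\<close> is
\<open>cell \<eta> (-1) q\<close>, with upper corner \<open>\<eta> * q\<close>.\<close>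

definition outer_cells :: "real \<Rightarrow> nat \<Rightarrow> real \<Rightarrow> ('n \<Rightarrow> nat) set" where
  "outer_cells \<eta> q0 L = {q. (\<forall>i. q0 < q i) \<and> (\<lambda>i. \<eta> * (real (q i) - 1) / L) \<in> region}"

definition inner_cells :: "real \<Rightarrow> nat \<Rightarrow> real \<Rightarrow> ('n \<Rightarrow> nat) set" where
  "inner_cells \<eta> q0 L = {q. (\<forall>i. q0 < q i) \<and> (\<lambda>i. \<eta> * real (q i) / L) \<in> region}"

abbreviation cell_points :: "(nat ^ 'n \<Rightarrow> real) \<Rightarrow> real \<Rightarrow> ('n \<Rightarrow> nat) \<Rightarrow> real" where
  "cell_points f \<eta> q \<equiv> cell_sum f \<omega> (\<lambda>i. \<eta> * (real (q i) + -1)) (\<lambda>i. \<eta> * (real (q i) + -1 + 1))"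

lemma inner_subset_outer:
  fixes \<eta> L :: real
  assumes "0 < \<eta>" "0 < L"
  shows "inner_cells \<eta> q0 L \<subseteq> outer_cells \<eta> q0 L"
proof
  fix q assume q: "q \<in> inner_cells \<eta> q0 L"
  have "(\<lambda>i. \<eta> * (real (q i) - 1) / L) \<in> region"
  proof (rule region_down)
    show "(\<lambda>i. \<eta> * real (q i) / L) \<in> region" using q by (simp add: inner_cells_def)
    fix i
    have "1 \<le> q i" using q by (auto simp: inner_cells_def Suc_le_eq intro: le_less_trans[OF le0])
    then show "0 \<le> \<eta> * (real (q i) - 1) / L" using assms by simp
    show "\<eta> * (real (q i) - 1) / L \<le> \<eta> * real (q i) / L"
      using assms by (intro divide_right_mono mult_left_mono) auto
  qed
  then show "q \<in> outer_cells \<eta> q0 L" using q by (simp add: inner_cells_def outer_cells_def)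
qed

lemma outer_cells_card:
  fixes \<eta> L :: real
  assumes \<eta>: "0 < \<eta>" "0 < L" and D: "0 \<le> D" "\<And>u i. u \<in> region \<Longrightarrow> u i \<le> D"
  shows "finite (outer_cells \<eta> q0 L)" "real (card (outer_cells \<eta> q0 L)) \<le> (D * L / \<eta> + 2) ^ CARD('n)"
proof -
  define N where "N = nat \<lfloor>D * L / \<eta> + 1\<rfloor>"
  have sub: "outer_cells \<eta> q0 L \<subseteq> {q. \<forall>i. q i \<le> N}"
  proof
    fix q assume q: "q \<in> outer_cells \<eta> q0 L"
    have "q i \<le> N" for i
    proof -
      have "\<eta> * (real (q i) - 1) / L \<le> D" using D(2) q by (auto simp: outer_cells_def)
      then have "real (q i) \<le> D * L / \<eta> + 1" using \<eta> by (simp add: field_simps)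
      then show ?thesis unfolding N_def by (rule le_nat_floor)
    qed
    then show "q \<in> {q. \<forall>i. q i \<le> N}" by simp
  qed
  then show "finite (outer_cells \<eta> q0 L)"
    by (rule finite_subset) (rule finite_bounded_nat_functions)
  have "card (outer_cells \<eta> q0 L) \<le> card {q :: 'n \<Rightarrow> nat. \<forall>i. q i \<le> N}"
    by (rule card_mono[OF finite_bounded_nat_functions sub])
  also have "{q :: 'n \<Rightarrow> nat. \<forall>i. q i \<le> N} = PiE UNIV (\<lambda>_. {..N})" by (auto simp: PiE_def)
  also have "card \<dots> = (N + 1) ^ CARD('n)" by (subst card_PiE) auto
  finally have "real (card (outer_cells \<eta> q0 L)) \<le> (real N + 1) ^ CARD('n)"
    by (metis of_nat_1 of_nat_add of_nat_mono of_nat_power)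
  also have "\<dots> \<le> (D * L / \<eta> + 2) ^ CARD('n)"
  proof (rule power_mono)
    have "0 \<le> D * L / \<eta>" using \<eta> D(1) by simp
    then show "real N + 1 \<le> D * L / \<eta> + 2" unfolding N_def by linarith
  qed simp
  finally show "real (card (outer_cells \<eta> q0 L)) \<le> (D * L / \<eta> + 2) ^ CARD('n)" .
qed

lemma finite_outer_cells: "0 < \<eta> \<Longrightarrow> 0 < L \<Longrightarrow> finite (outer_cells \<eta> q0 L)"
proof -
  assume *: "0 < \<eta>" "0 < L"
  obtain D where D: "D \<ge> 1" "\<forall>u\<in>region. \<forall>i. u i \<le> D" using region_bound by auto
  show ?thesis by (rule outer_cells_card(1)[OF *, of D]) (use D in auto)
qed

lemma sum_points_le_cells:
  fixes \<eta> L :: real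
  assumes \<eta>: "0 < \<eta>" "0 < L" and f: "\<And>y. (\<forall>i. 1 \<le> y $ i) \<Longrightarrow> 0 \<le> f y"
  shows "(\<Sum>y\<in>points L. f y) \<le> (\<Sum>q\<in>outer_cells \<eta> q0 L. cell_points f \<eta> q)
    + (\<Sum>l\<in>UNIV. \<Sum>y | y \<in> points L \<and> log_coord \<omega> y l \<le> \<eta> * real q0. f y)"
proof -
  let ?x = "log_coord \<omega>"
  let ?N = "\<lambda>l. {y. y \<in> points L \<and> ?x y l \<le> \<eta> * real q0}"
  let ?Y = "{y. y \<in> points L \<and> (\<forall>l. \<eta> * real q0 < ?x y l)}"
  have fin: "finite (points L)" using finite_points \<eta> by simp
  have nn: "0 \<le> f y" if "y \<in> points L" for y using that f by (simp add: points_def)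
  have "(\<Sum>y\<in>points L. f y) = (\<Sum>y\<in>?Y \<union> (\<Union>l. ?N l). f y)"
    by (rule sum.cong) (auto simp: not_less)
  also have "\<dots> \<le> (\<Sum>y\<in>?Y. f y) + (\<Sum>y\<in>(\<Union>l. ?N l). f y)"
    using fin nn by (subst sum_Un) (auto intro!: sum_nonneg finite_subset[OF _ fin])
  also have "(\<Sum>y\<in>(\<Union>l. ?N l). f y) \<le> (\<Sum>l\<in>UNIV. \<Sum>y\<in>?N l. f y)"
  proof -
    have "(\<Sum>y\<in>(\<Union>l. ?N l). f y) \<le> (\<Sum>y\<in>(\<Union>l. ?N l). \<Sum>l\<in>UNIV. if y \<in> ?N l then f y else 0)"
    proof (rule sum_mono)
      fix y assume "y \<in> (\<Union>l. ?N l)"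
      then obtain l where l: "y \<in> ?N l" by blast
      have "(if y \<in> ?N l then f y else 0) \<le> (\<Sum>l\<in>UNIV. if y \<in> ?N l then f y else 0)"
        by (rule member_le_sum) (use nn in auto)
      then show "f y \<le> (\<Sum>l\<in>UNIV. if y \<in> ?N l then f y else 0)" using l by simp
    qed
    also have "\<dots> = (\<Sum>l\<in>UNIV. \<Sum>y\<in>(\<Union>l. ?N l). if y \<in> ?N l then f y else 0)"
      by (rule sum.swap)
    also have "\<dots> = (\<Sum>l\<in>UNIV. \<Sum>y\<in>?N l. f y)"
      by (intro sum.cong refl sum.mono_neutral_cong_right) (auto intro: finite_subset[OF _ fin])
    finally show ?thesis .
  qed
  also have "(\<Sum>y\<in>?Y. f y) \<le> (\<Sum>q\<in>outer_cells \<eta> q0 L. cell_points f \<eta> q)"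
  proof (rule sum_group_le[where g = "\<lambda>y i. nat \<lceil>?x y i / \<eta>\<rceil>"])
    show "finite ?Y" using fin by simp
    show "finite (outer_cells \<eta> q0 L)" by (rule finite_outer_cells[OF \<eta>])
    show "(\<lambda>y i. nat \<lceil>?x y i / \<eta>\<rceil>) ` ?Y \<subseteq> outer_cells \<eta> q0 L"
    proof
      fix q assume "q \<in> (\<lambda>y i. nat \<lceil>?x y i / \<eta>\<rceil>) ` ?Y"
      then obtain y where y: "y \<in> points L" "\<And>i. \<eta> * real q0 < ?x y i"
        and q: "q = (\<lambda>i. nat \<lceil>?x y i / \<eta>\<rceil>)" by auto
      have c: "?x y \<in> cell \<eta> (-1) q" and q0: "q0 < q i" for i
        using mem_cell_ceiling[OF \<eta>(1) y(2)] unfolding q by auto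
      have "(\<lambda>i. \<eta> * (real (q i) - 1) / L) \<in> region"
      proof (rule region_down)
        show "(\<lambda>i. ?x y i / L) \<in> region" using y by (simp add: points_def)
        fix i
        show "0 \<le> \<eta> * (real (q i) - 1) / L" using q0[of i] \<eta> by simp
        have "\<eta> * (real (q i) - 1) \<le> ?x y i" using c by (auto simp: cell_def intro: less_imp_le)
        then show "\<eta> * (real (q i) - 1) / L \<le> ?x y i / L" using \<eta> by (simp add: divide_right_mono)
      qed
      then show "q \<in> outer_cells \<eta> q0 L" using q0 by (simp add: outer_cells_def)
    qed
    fix q
    show "(\<Sum>y | y \<in> ?Y \<and> (\<lambda>i. nat \<lceil>?x y i / \<eta>\<rceil>) = q. f y) \<le> cell_points f \<eta> q"
      unfolding cell_sum_eq_cell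
    proof (rule sum_mono2)
      show "finite {y. (\<forall>i. 1 \<le> y $ i) \<and> ?x y \<in> cell \<eta> (- 1) q}"
        by (rule finite_subset[OF _ finite_log_box[OF \<omega>_pos, where b = "\<lambda>i. \<eta> * (real (q i) + -1 + 1)"]])
           (auto simp: cell_def)
      show "{y. y \<in> ?Y \<and> (\<lambda>i. nat \<lceil>?x y i / \<eta>\<rceil>) = q} \<subseteq> {y. (\<forall>i. 1 \<le> y $ i) \<and> ?x y \<in> cell \<eta> (- 1) q}"
        using mem_cell_ceiling(1)[OF \<eta>(1), of "real q0"] by (auto simp: points_def)
    qed (use f in auto)
  qed
  finally show ?thesis by simp
qed

lemma sum_cells_le_points:
  fixes \<eta> L :: real
  assumes \<eta>: "0 < \<eta>" "0 < L" and f: "\<And>y. (\<forall>i. 1 \<le> y $ i) \<Longrightarrow> 0 \<le> f y"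
  shows "(\<Sum>q\<in>inner_cells \<eta> q0 L. cell_points f \<eta> q) \<le> (\<Sum>y\<in>points L. f y)"
proof -
  let ?x = "log_coord \<omega>"
  let ?C = "\<lambda>q. {y. (\<forall>i. 1 \<le> y $ i) \<and> ?x y \<in> cell \<eta> (- 1) q}"
  have fin: "finite (points L)" using finite_points \<eta> by simp
  have finG: "finite (inner_cells \<eta> q0 L)"
    using inner_subset_outer[OF \<eta>] finite_outer_cells[OF \<eta>] by (rule finite_subset)
  have sub: "?C q \<subseteq> points L" if q: "q \<in> inner_cells \<eta> q0 L" for q
  proof
    fix y assume y: "y \<in> ?C q"
    have "(\<lambda>i. ?x y i / L) \<in> region"
    proof (rule region_down)
      show "(\<lambda>i. \<eta> * real (q i) / L) \<in> region" using q by (simp add: inner_cells_def)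
      fix i
      show "0 \<le> ?x y i / L" using y \<omega>_pos \<eta> by (simp add: log_coord_nonneg)
      show "?x y i / L \<le> \<eta> * real (q i) / L" using y \<eta> by (auto simp: cell_def intro!: divide_right_mono)
    qed
    then show "y \<in> points L" using y by (simp add: points_def)
  qed
  have "(\<Sum>q\<in>inner_cells \<eta> q0 L. cell_points f \<eta> q) = (\<Sum>y\<in>(\<Union>q\<in>inner_cells \<eta> q0 L. ?C q). f y)"
    unfolding cell_sum_eq_cell
  proof (rule sum.UNION_disjoint[symmetric])
    show "\<forall>q\<in>inner_cells \<eta> q0 L. finite (?C q)" using sub fin finite_subset by blast
    show "\<forall>q\<in>inner_cells \<eta> q0 L. \<forall>q'\<in>inner_cells \<eta> q0 L. q \<noteq> q' \<longrightarrow> ?C q \<inter> ?C q' = {}"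
      using cell_unique[OF \<eta>(1)] by blast
  qed fact
  also have "\<dots> \<le> (\<Sum>y\<in>points L. f y)"
    by (rule sum_mono2) (use fin sub f in \<open>auto simp: points_def\<close>)
  finally show ?thesis .
qed

abbreviation region_mass :: "real \<Rightarrow> real" where
  "region_mass R \<equiv> measure (exp_measure R) region"

lemma region_mass_asymptotic:
  "\<exists>C\<ge>0. \<forall>R>0. emeasure (exp_measure R) region = ennreal (region_mass R) \<and>
     \<bar>R ^ CARD('n) * region_mass R - fact codim * c_P P * R ^ k * exp (a * R)\<bar> \<le> C * (exp (a * R) * R ^ k / R)"
proof -
  obtain C where C: "C \<ge> 0" "\<And>R. R > 0 \<Longrightarrow> emeasure (exp_measure R) region < \<infinity>"
    "\<And>R. R > 0 \<Longrightarrow> \<bar>region_mass R - exp (a * R) * (fact codim * c_P P / R ^ Suc codim)\<bar>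
       \<le> exp (a * R) * (C / R ^ Suc (Suc codim))"
    using exp_measure_P unfolding region_def by blast
  have "\<bar>R ^ CARD('n) * region_mass R - fact codim * c_P P * R ^ k * exp (a * R)\<bar> \<le> C * (exp (a * R) * R ^ k / R)"
    if R: "R > 0" for R
  proof -
    have "R ^ CARD('n) * region_mass R - fact codim * c_P P * R ^ k * exp (a * R)
        = R ^ CARD('n) * (region_mass R - exp (a * R) * (fact codim * c_P P / R ^ Suc codim))"
      unfolding power_card using R by (simp add: field_simps)
    also have "\<bar>\<dots>\<bar> \<le> R ^ CARD('n) * (exp (a * R) * (C / R ^ Suc (Suc codim)))"
      using mult_left_mono[OF C(3)[OF R], of "R ^ CARD('n)"] R by (simp add: abs_mult)
    also have "\<dots> = C * (exp (a * R) * R ^ k / R)"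
      unfolding power_card using R by (simp add: field_simps)
    finally show ?thesis .
  qed
  moreover have "emeasure (exp_measure R) region = ennreal (region_mass R)" if "R > 0" for R
    using C(2)[OF that] by (intro emeasure_eq_ennreal_measure) auto
  ultimately show ?thesis using C(1) by blast
qed

text \<open>Moved down by one step along the diagonal, an outer cell has its upper corner in the region and
lies inside it; it stays in the positive orthant as \<open>1 \<le> q0\<close>.\<close>

lemma outer_mass_le:
  fixes \<eta> L :: real
  assumes \<eta>: "0 < \<eta>" "0 < L" and q0: "1 \<le> q0"
    and fin: "emeasure (exp_measure L) region = ennreal (region_mass L)"
  shows "(\<Sum>q\<in>outer_cells \<eta> q0 L. cell_mass \<eta> (-1) q)
    \<le> exp (\<eta> * CARD('n)) * (L ^ CARD('n) * region_mass L)"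
proof -
  have "(\<Sum>q\<in>outer_cells \<eta> q0 L. cell_mass \<eta> (-2) q) \<le> L ^ CARD('n) * region_mass L"
  proof (rule sum_cell_mass_le)
    fix q u assume q: "q \<in> outer_cells \<eta> q0 L" and u: "(\<lambda>i. L * u i) \<in> cell \<eta> (-2) q"
    show "u \<in> region"
    proof (rule region_down)
      show "(\<lambda>i. \<eta> * (real (q i) - 1) / L) \<in> region" using q by (simp add: outer_cells_def)
      fix i
      have "\<eta> * (real (q i) + -2) < L * u i" "L * u i \<le> \<eta> * (real (q i) + -2 + 1)"
        using u by (auto simp: cell_def)
      moreover have "0 \<le> \<eta> * (real (q i) + -2)"
      proof -
        have "q0 < q i" using q by (simp add: outer_cells_def)
        then have "2 \<le> q i" using q0 by linarith
        then show ?thesis using \<eta> by simp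
      qed
      ultimately have "0 < L * u i" "L * u i \<le> \<eta> * (real (q i) - 1)" by simp_all
      then show "0 \<le> u i" "u i \<le> \<eta> * (real (q i) - 1) / L"
        using \<eta> by (simp_all add: zero_less_mult_iff field_simps)
    qed
  qed (use \<eta> fin sets_region finite_outer_cells in auto)
  moreover have "cell_mass \<eta> (-1) q = exp (\<eta> * CARD('n)) * cell_mass \<eta> (-2) q" for q :: "'n \<Rightarrow> nat"
    using cell_mass_shift[of \<eta> "-2" 1 q] by simp
  ultimately show ?thesis by (simp add: sum_distrib_left[symmetric])
qed

text \<open>Moved up by one step along the diagonal, the inner cells cover every point of the region with all
coordinates above \<open>\<eta> * (q0 + 1) / L\<close>: the lower corner of the shifted cell that contains such a
point is the upper corner of the original cell.\<close>

lemma inner_mass_ge: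
  fixes \<eta> L N :: real
  assumes \<eta>: "0 < \<eta>" "0 < L"
    and fin: "emeasure (exp_measure L) region = ennreal (region_mass L)"
    and near: "\<And>l. emeasure (exp_measure L) {u \<in> region. u l \<le> \<eta> * (real q0 + 1) / L} \<le> ennreal N" "0 \<le> N"
  shows "exp (- (\<eta> * CARD('n))) * (L ^ CARD('n) * (region_mass L - CARD('n) * N))
    \<le> (\<Sum>q\<in>inner_cells \<eta> q0 L. cell_mass \<eta> (-1) q)"
proof -
  let ?G = "inner_cells \<eta> q0 L"
  let ?Z = "\<lambda>l. {u \<in> region. u l \<le> \<eta> * (real q0 + 1) / L}"
  let ?U = "\<Union>q\<in>?G. {u. (\<lambda>i. L * u i) \<in> cell \<eta> 0 q}"
  have finG: "finite ?G"
    using inner_subset_outer[OF \<eta>] finite_outer_cells[OF \<eta>] by (rule finite_subset)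
  have U_sets: "?U \<in> sets (exp_measure L)"
    using finG emeasure_exp_measure_cell(2)[OF \<eta>(2,1)] by (auto simp: exp_measure_def)
  have Z_sets: "?Z l \<in> sets (exp_measure L)" for l
    using sets_region_near by (simp add: exp_measure_def)
  have cover: "region \<subseteq> ?U \<union> (\<Union>l. ?Z l)"
  proof
    fix u assume u: "u \<in> region"
    show "u \<in> ?U \<union> (\<Union>l. ?Z l)"
    proof (cases "\<exists>l. u l \<le> \<eta> * (real q0 + 1) / L")
      case True
      then show ?thesis using u by auto
    next
      case False
      then have big: "\<eta> * (real q0 + 1) < L * u i" for i
        using \<eta> by (simp add: not_le field_simps)
      define p where "p i = nat \<lceil>L * u i / \<eta>\<rceil>" for i
      define q where "q i = p i - 1" for i
      have p: "(\<lambda>i. L * u i) \<in> cell \<eta> (-1) p" "real q0 + 1 < real (p i)" for i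
        using mem_cell_ceiling[OF \<eta>(1) big] unfolding p_def by auto
      have pq: "real (p i) = real (q i) + 1" for i using p(2)[of i] by (simp add: q_def)
      have c: "(\<lambda>i. L * u i) \<in> cell \<eta> 0 q" using p(1) by (simp add: cell_def pq)
      have q0: "q0 < q i" for i using p(2)[of i] pq[of i] by linarith
      have "(\<lambda>i. \<eta> * real (q i) / L) \<in> region"
      proof (rule region_down[OF u])
        fix i
        show "0 \<le> \<eta> * real (q i) / L" using \<eta> by simp
        have "\<eta> * real (q i) < L * u i" using c by (simp add: cell_def)
        then show "\<eta> * real (q i) / L \<le> u i" using \<eta> by (simp add: field_simps)
      qed
      then have "q \<in> ?G" using q0 by (simp add: inner_cells_def)
      then show ?thesis using c by blast
    qed
  qed
  let ?M = "\<Sum>q\<in>?G. cell_mass \<eta> 0 q"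
  have "ennreal (region_mass L) \<le> emeasure (exp_measure L) (?U \<union> (\<Union>l. ?Z l))"
    unfolding fin[symmetric] by (rule emeasure_mono[OF cover]) (use U_sets Z_sets in auto)
  also have "\<dots> \<le> emeasure (exp_measure L) ?U + emeasure (exp_measure L) (\<Union>l. ?Z l)"
    by (rule emeasure_subadditive) (use U_sets Z_sets in auto)
  also have "emeasure (exp_measure L) (\<Union>l. ?Z l) \<le> (\<Sum>l\<in>UNIV. emeasure (exp_measure L) (?Z l))"
    by (rule emeasure_subadditive_finite) (use Z_sets in auto)
  also have "\<dots> \<le> (\<Sum>l\<in>(UNIV :: 'n set). ennreal N)" using near by (intro sum_mono) auto
  also have "\<dots> = ennreal (CARD('n) * N)" using near(2) by (simp add: ennreal_mult ennreal_of_nat_eq_real_of_nat)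
  also have "emeasure (exp_measure L) ?U = ennreal (?M / L ^ CARD('n))"
    by (rule emeasure_exp_measure_cells[OF finG \<eta>(2,1)])
  finally have "ennreal (region_mass L) \<le> ennreal (?M / L ^ CARD('n)) + ennreal (CARD('n) * N)"
    by (simp add: add_left_mono)
  also have "\<dots> = ennreal (?M / L ^ CARD('n) + CARD('n) * N)"
    using near(2) \<eta> by (intro ennreal_plus[symmetric]) (auto intro!: divide_nonneg_nonneg sum_nonneg cell_mass_nonneg)
  finally have "region_mass L \<le> ?M / L ^ CARD('n) + CARD('n) * N"
    using near(2) \<eta> by (subst (asm) ennreal_le_iff)
      (auto intro!: add_nonneg_nonneg divide_nonneg_nonneg sum_nonneg cell_mass_nonneg)
  then have "L ^ CARD('n) * (region_mass L - CARD('n) * N) \<le> ?M"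
    using \<eta> by (simp add: field_simps)
  then have "exp (- (\<eta> * CARD('n))) * (L ^ CARD('n) * (region_mass L - CARD('n) * N))
      \<le> exp (- (\<eta> * CARD('n))) * ?M" by (intro mult_left_mono) auto
  moreover have "cell_mass \<eta> (-1) q = exp (- (\<eta> * CARD('n))) * cell_mass \<eta> 0 q" for q :: "'n \<Rightarrow> nat"
    using cell_mass_shift[of \<eta> 0 "-1" q] by simp
  ultimately show ?thesis by (simp add: sum_distrib_left[symmetric])
qed

lemma sum_cells_error_le:
  fixes \<eta> L :: real
  assumes I: "property_I A \<Delta> \<omega> CM CE f" and \<kappa>: "0 \<le> \<kappa>" "\<And>i. \<kappa> * \<omega> i \<le> \<Delta>"
    and \<eta>: "0 < \<eta>" "0 < L" and G: "G \<subseteq> outer_cells \<eta> q0 L"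
  shows "\<bar>(\<Sum>q\<in>G. cell_points f \<eta> q) - CM * (\<Sum>q\<in>G. cell_mass \<eta> (-1) q)\<bar>
    \<le> card (outer_cells \<eta> q0 L) * (2 ^ CARD('n) * (\<bar>A\<bar> * CE * exp (a * L + \<eta> * CARD('n)) * exp (- (\<kappa> * (\<eta> * real q0)))))"
proof -
  have CE: "0 \<le> CE" using I by (auto simp: property_I_def)
  let ?e = "2 ^ CARD('n) * (\<bar>A\<bar> * CE * exp (a * L + \<eta> * CARD('n)) * exp (- (\<kappa> * (\<eta> * real q0))))"
  have fin: "finite (outer_cells \<eta> q0 L)" by (rule finite_outer_cells[OF \<eta>])
  have one: "\<bar>cell_points f \<eta> q - CM * cell_mass \<eta> (-1) q\<bar> \<le> ?e" if q: "q \<in> G" for q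
  proof -
    have q': "(\<lambda>i. \<eta> * (real (q i) - 1) / L) \<in> region" "\<And>i. q0 < q i"
      using q G by (auto simp: outer_cells_def)
    have "\<bar>cell_points f \<eta> q - CM * cell_mass \<eta> (-1) q\<bar> \<le> 2 ^ CARD('n) *
        (\<bar>A\<bar> * CE * exp (\<Sum>i\<in>UNIV. \<eta> * (real (q i) + -1 + 1)) * exp (- (\<kappa> * (\<eta> * real q0))))"
      unfolding cell_mass_def
    proof (rule cell_sum_asymptotic[OF I \<kappa>])
      fix i
      have "real q0 \<le> real (q i) + -1" using q'(2)[of i] by linarith
      then show "\<eta> * real q0 \<le> \<eta> * (real (q i) + -1)" using \<eta> by (intro mult_left_mono) auto
      show "\<eta> * (real (q i) + -1) \<le> \<eta> * (real (q i) + -1 + 1)" using \<eta> by (intro mult_left_mono) auto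
    qed (use \<eta> in auto)
    also have "\<dots> \<le> ?e"
    proof -
      have "(\<Sum>i\<in>UNIV. \<eta> * (real (q i) - 1) / L) \<le> a" by (rule region_sum[OF q'(1)])
      then have "(\<Sum>i\<in>UNIV. \<eta> * (real (q i) - 1)) \<le> a * L"
        using \<eta> by (simp add: sum_divide_distrib[symmetric] field_simps)
      then have "(\<Sum>i\<in>UNIV. \<eta> * (real (q i) + -1 + 1)) \<le> a * L + \<eta> * CARD('n)"
        by (simp add: right_diff_distrib sum_subtractf mult.commute)
      then show ?thesis using CE by (intro mult_left_mono mult_right_mono) auto
    qed
    finally show ?thesis .
  qed
  have diff: "(\<Sum>q\<in>G. cell_points f \<eta> q) - CM * (\<Sum>q\<in>G. cell_mass \<eta> (-1) q)
      = (\<Sum>q\<in>G. cell_points f \<eta> q - CM * cell_mass \<eta> (-1) q)"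
    by (simp add: sum_subtractf sum_distrib_left)
  have "\<bar>(\<Sum>q\<in>G. cell_points f \<eta> q) - CM * (\<Sum>q\<in>G. cell_mass \<eta> (-1) q)\<bar> \<le> (\<Sum>q\<in>G. ?e)"
    unfolding diff by (rule order_trans[OF sum_abs sum_mono]) (rule one)
  also have "\<dots> = card G * ?e" by (rule sum_constant)
  also have "\<dots> \<le> card (outer_cells \<eta> q0 L) * ?e"
  proof (rule mult_right_mono)
    show "real (card G) \<le> real (card (outer_cells \<eta> q0 L))" using card_mono[OF fin G] by simp
    show "0 \<le> ?e" using CE by simp
  qed
  finally show ?thesis .
qed

end

section \<open>The asymptotic formula\<close>

lemma exp_le_one_plus: "exp x \<le> 1 + x * exp x" for x :: real
proof -
  have "(1 - x) * exp x \<le> exp (- x) * exp x"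
    using exp_ge_add_one_self[of "- x"] by (intro mult_right_mono) auto
  then show ?thesis by (simp add: exp_minus algebra_simps)
qed

text \<open>The grid has step \<open>\<eta> = 1 / L\<close>, and points with a coordinate at most \<open>T\<close>, about \<open>c * ln L\<close>, are
split off. There are \<open>O(L ^ (2 * s))\<close> cells, and \<open>c\<close> is chosen such that the saving in
Property I is \<open>exp (- \<kappa> * T) \<le> 1 / L ^ (2 * s + 1)\<close> on each. In the proof \<open>X\<close> is the order of the main
term, \<open>w\<close> is smaller than \<open>X\<close> by the factor \<open>L\<close>, and every error is \<open>O(w * ln L)\<close>.\<close>

lemma (in hyperbola_region) sum_points_asymptotic:
  assumes \<Delta>: "0 < \<Delta>"
  shows "\<exists>C. \<forall>f CM CE. property_I A \<Delta> \<omega> CM CE f \<longrightarrow> (\<forall>L\<ge>exp 1.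
    \<bar>(\<Sum>y\<in>points L. f y) - fact codim * CM * c_P P * L ^ k * exp (a * L)\<bar>
      \<le> C * CE * (exp (a * L) * L ^ k / L * ln L))"
proof -
  let ?s = "real CARD('n)"
  \<comment> \<open>chosen such that \<open>\<kappa> * \<omega> i \<le> \<Delta>\<close> for all \<open>i\<close>\<close>
  define \<kappa> where "\<kappa> = \<Delta> / (\<Sum>i\<in>UNIV. \<omega> i)"
  have sum_pos: "(\<Sum>i\<in>UNIV. \<omega> i) > 0" using \<omega>_pos by (intro sum_pos) auto
  then have \<kappa>: "0 < \<kappa>" using \<Delta> by (simp add: \<kappa>_def)
  have \<kappa>\<omega>: "\<kappa> * \<omega> i \<le> \<Delta>" for i
  proof -
    have "\<omega> i \<le> (\<Sum>i\<in>UNIV. \<omega> i)" by (rule member_le_sum) (use \<omega>_pos in \<open>auto intro: less_imp_le\<close>)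
    then have "\<Delta> * \<omega> i \<le> \<Delta> * (\<Sum>i\<in>UNIV. \<omega> i)" using \<Delta> by simp
    then show ?thesis using sum_pos by (simp add: \<kappa>_def field_simps)
  qed
  \<comment> \<open>\<open>2 * s\<close> pays for the number of cells, and 1 for the factor \<open>1 / L\<close> that is to be gained\<close>
  define c where "c = (2 * ?s + 1) / \<kappa>"
  have c: "c > 0" "\<kappa> * c = 2 * ?s + 1" using \<kappa> by (simp_all add: c_def add_pos_nonneg)
  obtain D where D: "D \<ge> 1" "\<And>u i. u \<in> region \<Longrightarrow> u i \<le> D" using region_bound by auto
  obtain Cn where Cn: "Cn \<ge> 0" "\<And>R \<epsilon> l. R > 0 \<Longrightarrow> \<epsilon> \<ge> 0 \<Longrightarrow>
      emeasure (exp_measure R) {u \<in> region. u l \<le> \<epsilon>}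
      \<le> ennreal (Cn * exp (a * R) * (\<epsilon> / R ^ Suc codim + 1 / R ^ Suc (Suc codim)))"
    using region_near_le by blast
  obtain Cb where Cb: "Cb \<ge> 0" "\<And>f CM CE L T l. property_I A \<Delta> \<omega> CM CE f \<Longrightarrow> L \<ge> 1 \<Longrightarrow> T \<ge> 0 \<Longrightarrow>
     (\<Sum>y | y \<in> points L \<and> log_coord \<omega> y l \<le> T. f y) \<le> Cb * CE * (exp (a * L) * L ^ k / L * (T + 1))"
    using sum_points_near_le[of A \<Delta>] by blast
  obtain Cm where Cm: "Cm \<ge> 0"
    "\<And>R. R > 0 \<Longrightarrow> emeasure (exp_measure R) region = ennreal (region_mass R)"
    "\<And>R. R > 0 \<Longrightarrow> \<bar>R ^ CARD('n) * region_mass R - fact codim * c_P P * R ^ k * exp (a * R)\<bar>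
      \<le> Cm * (exp (a * R) * R ^ k / R)"
    using region_mass_asymptotic by blast
  define H where "H = fact codim * c_P P"
  have H: "H \<ge> 0" using c_P_nonneg by (simp add: H_def)
  define C1 where "C1 = (D + 2) ^ CARD('n) * (2 ^ CARD('n) * (\<bar>A\<bar> * exp ?s))"
  have C1: "C1 \<ge> 0" using D by (simp add: C1_def)
  define C where "C = Cm + ?s * exp ?s * (H + Cm) + C1 + ?s * Cb * (c + 2) + ?s * Cn * (c + 3)"
  have "\<bar>(\<Sum>y\<in>points L. f y) - fact codim * CM * c_P P * L ^ k * exp (a * L)\<bar>
      \<le> C * CE * (exp (a * L) * L ^ k / L * ln L)"
    if I: "property_I A \<Delta> \<omega> CM CE f" and L: "L \<ge> exp 1" for f CM CE L
  proof -
    have CM: "0 \<le> CM" "CM \<le> CE" and f: "\<And>y. (\<forall>i. 1 \<le> y $ i) \<Longrightarrow> 0 \<le> f y"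
      using I by (auto simp: property_I_def)
    have L1: "L \<ge> 1" "L > 0" using L exp_ge_add_one_self[of 1] by linarith+
    have lnL: "ln L \<ge> 1" using L L1 by (simp add: ln_ge_iff)
    define \<eta> where "\<eta> = 1 / L"
    have \<eta>: "\<eta> > 0" "\<eta> \<le> 1" using L1 by (auto simp: \<eta>_def)
    define q0 where "q0 = nat \<lceil>c * L * ln L\<rceil>"
    have "ln L > 0" using lnL by linarith
    then have "c * L * ln L > 0" by (intro mult_pos_pos c(1) L1(2))
    then have q0: "1 \<le> q0" "c * L * ln L \<le> real q0" "real q0 \<le> c * L * ln L + 1"
      unfolding q0_def by linarith+
    define T where "T = \<eta> * real q0"
    have T: "c * ln L \<le> T" "T \<le> (c + 1) * ln L" "0 \<le> T"
    proof -
      show "c * ln L \<le> T" using q0(2) L1 by (simp add: T_def \<eta>_def field_simps)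
      have "T \<le> c * ln L + \<eta>" using q0(3) L1 by (simp add: T_def \<eta>_def field_simps)
      then show "T \<le> (c + 1) * ln L" using \<eta>(2) lnL by (simp add: distrib_right)
      show "0 \<le> T" using \<eta> by (simp add: T_def)
    qed
    define X where "X = L ^ k * exp (a * L)"
    define w where "w = X / L"
    define Z where "Z = L ^ CARD('n) * region_mass L"
    have X0: "X > 0" and w0: "w > 0" using L1 by (auto simp: X_def w_def)
    have wW: "w \<le> w * ln L" using w0 lnL by simp
    have w_eq: "exp (a * L) * L ^ k / L = w" by (simp add: w_def X_def mult.commute)
    have Z: "\<bar>Z - H * X\<bar> \<le> Cm * w" "0 \<le> Z"
      using Cm(3)[OF L1(2)] L1 unfolding w_eq by (simp_all add: Z_def H_def X_def mult.assoc)
    have "w \<le> X" using L1 X0 by (simp add: w_def field_simps)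
    then have "Z \<le> (H + Cm) * X" using Z(1) mult_left_mono[of w X Cm] Cm(1) by (simp add: distrib_right)
    then have \<eta>Z: "\<eta> * Z \<le> (H + Cm) * w" using \<eta> L1 by (simp add: \<eta>_def w_def field_simps)
    have le_cells: "(\<Sum>y\<in>points L. f y) \<le> (\<Sum>q\<in>outer_cells \<eta> q0 L. cell_points f \<eta> q)
        + (\<Sum>l\<in>UNIV. \<Sum>y | y \<in> points L \<and> log_coord \<omega> y l \<le> \<eta> * real q0. f y)"
      by (rule sum_points_le_cells[OF \<eta>(1) L1(2)]) (rule f, blast)
    have ge_cells: "(\<Sum>q\<in>inner_cells \<eta> q0 L. cell_points f \<eta> q) \<le> (\<Sum>y\<in>points L. f y)"
      by (rule sum_cells_le_points[OF \<eta>(1) L1(2)]) (rule f, blast)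
    \<comment> \<open>the total error of Property I over any set of outer cells\<close>
    define e1 where "e1 = C1 * CE * w"
    have cells: "\<bar>(\<Sum>q\<in>G. cell_points f \<eta> q) - CM * (\<Sum>q\<in>G. cell_mass \<eta> (-1) q)\<bar> \<le> e1"
      if "G \<subseteq> outer_cells \<eta> q0 L" for G
    proof -
      let ?n = "card (outer_cells \<eta> q0 L)"
      have "\<bar>(\<Sum>q\<in>G. cell_points f \<eta> q) - CM * (\<Sum>q\<in>G. cell_mass \<eta> (-1) q)\<bar>
          \<le> ?n * (2 ^ CARD('n) * (\<bar>A\<bar> * CE * exp (a * L + \<eta> * CARD('n)) * exp (- (\<kappa> * T))))"
        using sum_cells_error_le[OF I _ \<kappa>\<omega> \<eta>(1) L1(2) that] \<kappa> by (simp add: T_def)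
      also have "\<dots> \<le> ((D + 2) ^ CARD('n) * L ^ (2 * CARD('n))) *
          (2 ^ CARD('n) * (\<bar>A\<bar> * CE * (exp (a * L) * exp ?s) * (1 / L ^ (2 * CARD('n) + 1))))"
      proof (intro mult_mono)
        have "real ?n \<le> (D * L / \<eta> + 2) ^ CARD('n)"
          by (rule outer_cells_card(2)[OF \<eta>(1) L1(2)]) (use D in auto)
        also have "\<dots> \<le> ((D + 2) * L ^ 2) ^ CARD('n)"
        proof (rule power_mono)
          have "1 \<le> L ^ 2" using L1 by simp
          then show "D * L / \<eta> + 2 \<le> (D + 2) * L ^ 2"
            by (simp add: \<eta>_def distrib_right power2_eq_square)
        qed (use D L1 \<eta> in auto)
        also have "\<dots> = (D + 2) ^ CARD('n) * L ^ (2 * CARD('n))"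
          by (simp add: power_mult_distrib power_mult)
        finally show "real ?n \<le> (D + 2) ^ CARD('n) * L ^ (2 * CARD('n))" .
        have "\<eta> * ?s \<le> ?s" using \<eta> mult_right_mono[of \<eta> 1 ?s] by simp
        then show "exp (a * L + \<eta> * CARD('n)) \<le> exp (a * L) * exp ?s"
          by (simp add: exp_add[symmetric])
        have "\<kappa> * (c * ln L) \<le> \<kappa> * T" using T \<kappa> by (intro mult_left_mono) auto
        then have "exp (- (\<kappa> * T)) \<le> exp (- ((2 * ?s + 1) * ln L))"
          using c(2) by (simp add: mult.assoc[symmetric])
        also have "\<dots> = 1 / L ^ (2 * CARD('n) + 1)"
        proof -
          have "(2 * ?s + 1) * ln L = of_nat (2 * CARD('n) + 1) * ln L" by simp
          then have "exp ((2 * ?s + 1) * ln L) = exp (ln L) ^ (2 * CARD('n) + 1)"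
            by (simp only: exp_of_nat_mult)
          then show ?thesis using L1 by (simp add: exp_minus inverse_eq_divide)
        qed
        finally show "exp (- (\<kappa> * T)) \<le> 1 / L ^ (2 * CARD('n) + 1)" .
      qed (use CM D L1 in auto)
      also have "\<dots> = C1 * CE * (exp (a * L) / L)"
        using L1 by (simp add: C1_def field_simps)
      also have "\<dots> \<le> e1"
      proof -
        have "exp (a * L) / L \<le> w"
          using L1 one_le_power[OF L1(1), of k] by (simp add: w_def X_def divide_right_mono)
        then show ?thesis unfolding e1_def using C1 CM by (intro mult_left_mono) auto
      qed
      finally show ?thesis .
    qed
    have e1: "e1 \<le> C1 * CE * (w * ln L)" using C1 CM wW by (simp add: e1_def mult_left_mono)
    \<comment> \<open>the outer cells, and all points with a small coordinate\<close>
    have upper: "(\<Sum>y\<in>points L. f y) - CM * H * X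
        \<le> CE * (w * ln L) * (Cm + ?s * exp ?s * (H + Cm) + C1 + ?s * Cb * (c + 2))"
    proof -
      have "(\<Sum>l\<in>UNIV. \<Sum>y | y \<in> points L \<and> log_coord \<omega> y l \<le> \<eta> * real q0. f y)
          \<le> (\<Sum>l\<in>(UNIV :: 'n set). Cb * CE * (w * ((c + 2) * ln L)))"
      proof (rule sum_mono)
        fix l
        have "(\<Sum>y | y \<in> points L \<and> log_coord \<omega> y l \<le> T. f y) \<le> Cb * CE * (w * (T + 1))"
          using Cb(2)[OF I L1(1) T(3)] by (simp add: w_eq)
        also have "\<dots> \<le> Cb * CE * (w * ((c + 2) * ln L))"
          using Cb(1) CM w0 T(2) lnL by (intro mult_left_mono) (auto simp: distrib_right)
        finally show "(\<Sum>y | y \<in> points L \<and> log_coord \<omega> y l \<le> \<eta> * real q0. f y)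
            \<le> Cb * CE * (w * ((c + 2) * ln L))" by (simp add: T_def)
      qed
      also have "\<dots> = CE * (w * ln L) * (?s * Cb * (c + 2))" by simp
      finally have bad: "(\<Sum>l\<in>UNIV. \<Sum>y | y \<in> points L \<and> log_coord \<omega> y l \<le> \<eta> * real q0. f y)
          \<le> CE * (w * ln L) * (?s * Cb * (c + 2))" .
      have "exp (\<eta> * ?s) * Z \<le> (1 + \<eta> * (?s * exp ?s)) * Z"
      proof (rule mult_right_mono)
        have "\<eta> * ?s \<le> ?s" using \<eta> mult_right_mono[of \<eta> 1 ?s] by simp
        then have "\<eta> * ?s * exp (\<eta> * ?s) \<le> \<eta> * ?s * exp ?s" using \<eta> by (intro mult_left_mono) auto
        then show "exp (\<eta> * ?s) \<le> 1 + \<eta> * (?s * exp ?s)"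
          using exp_le_one_plus[of "\<eta> * ?s"] by (simp add: mult.assoc)
      qed (rule Z)
      also have "\<dots> = Z + ?s * exp ?s * (\<eta> * Z)" by (simp add: algebra_simps)
      also have "\<dots> \<le> H * X + Cm * w + ?s * exp ?s * ((H + Cm) * w)"
        using Z(1) \<eta>Z by (intro add_mono mult_left_mono) auto
      finally have mass: "CM * (exp (\<eta> * ?s) * Z) \<le> CM * (H * X + Cm * w + ?s * exp ?s * ((H + Cm) * w))"
        using CM(1) by (rule mult_left_mono)
      have "CM * (\<Sum>q\<in>outer_cells \<eta> q0 L. cell_mass \<eta> (-1) q) \<le> CM * (exp (\<eta> * ?s) * Z)"
        using outer_mass_le[OF \<eta>(1) L1(2) q0(1) Cm(2)[OF L1(2)]] CM(1) by (simp add: Z_def mult_left_mono)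
      then have "(\<Sum>y\<in>points L. f y) \<le> CM * (H * X + Cm * w + ?s * exp ?s * ((H + Cm) * w)) + e1
          + CE * (w * ln L) * (?s * Cb * (c + 2))"
        using le_cells cells[OF order_refl] bad mass by linarith
      moreover have "CM * (H * X + Cm * w + ?s * exp ?s * ((H + Cm) * w))
          \<le> CM * H * X + CE * (w * ln L) * (Cm + ?s * exp ?s * (H + Cm))"
      proof -
        have "CM * w \<le> CE * (w * ln L)" using CM w0 wW by (intro mult_mono) auto
        then have "CM * w * (Cm + ?s * exp ?s * (H + Cm)) \<le> CE * (w * ln L) * (Cm + ?s * exp ?s * (H + Cm))"
          using Cm(1) H by (intro mult_right_mono) auto
        then show ?thesis by (simp add: algebra_simps)
      qed
      ultimately show ?thesis using e1 by (simp add: algebra_simps)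
    qed
    define \<epsilon> where "\<epsilon> = \<eta> * (real q0 + 1) / L"
    define N where "N = Cn * exp (a * L) * (\<epsilon> / L ^ Suc codim + 1 / L ^ Suc (Suc codim))"
    have \<epsilon>: "0 \<le> \<epsilon>" using \<eta> L1 by (simp add: \<epsilon>_def)
    have N: "0 \<le> N" using \<epsilon> Cn(1) L1 by (simp add: N_def)
    have N_le: "L ^ CARD('n) * (?s * N) \<le> w * ln L * (?s * Cn * (c + 3))"
    proof -
      have "L ^ CARD('n) * (?s * N) = ?s * Cn * (w * (\<epsilon> * L + 1))"
        unfolding power_card N_def w_def X_def using L1 by (simp add: field_simps)
      also have "\<epsilon> * L = T + \<eta>" using L1 by (simp add: \<epsilon>_def T_def distrib_left)
      also have "?s * Cn * (w * (T + \<eta> + 1)) \<le> ?s * Cn * (w * ((c + 3) * ln L))"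
        using T(2) \<eta>(2) lnL Cn(1) w0 by (intro mult_left_mono) (auto simp: distrib_right)
      finally show ?thesis by (simp add: mult_ac)
    qed
    \<comment> \<open>the inner cells, whose shifts miss only the part of the region with a small coordinate\<close>
    have lower: "CM * H * X - (\<Sum>y\<in>points L. f y)
        \<le> CE * (w * ln L) * (Cm + ?s * exp ?s * (H + Cm) + C1 + ?s * Cn * (c + 3))"
    proof -
      let ?N = "L ^ CARD('n) * (?s * N)"
      have "exp (- (\<eta> * ?s)) * (L ^ CARD('n) * (region_mass L - ?s * N))
          \<le> (\<Sum>q\<in>inner_cells \<eta> q0 L. cell_mass \<eta> (-1) q)"
        by (rule inner_mass_ge[OF \<eta>(1) L1(2) Cm(2)[OF L1(2)] _ N])
           (use Cn(2)[OF L1(2) \<epsilon>] in \<open>simp add: \<epsilon>_def N_def\<close>)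
      moreover have "L ^ CARD('n) * (region_mass L - ?s * N) = Z - ?N"
        by (simp add: Z_def right_diff_distrib)
      moreover have "Z - ?s * exp ?s * ((H + Cm) * w) - ?N \<le> exp (- (\<eta> * ?s)) * (Z - ?N)"
      proof -
        have "(1 - \<eta> * ?s) * Z \<le> exp (- (\<eta> * ?s)) * Z"
          using exp_ge_add_one_self[of "- (\<eta> * ?s)"] Z(2) by (intro mult_right_mono) auto
        moreover have "exp (- (\<eta> * ?s)) * ?N \<le> 1 * ?N"
          using \<eta> N L1 by (intro mult_right_mono) auto
        moreover have "?s * (\<eta> * Z) \<le> ?s * exp ?s * ((H + Cm) * w)"
          by (rule mult_mono[OF _ \<eta>Z]) (use \<eta> Z(2) mult_left_mono[of 1 "exp ?s" ?s] in auto)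
        ultimately show ?thesis by (simp add: algebra_simps)
      qed
      ultimately have "H * X - Cm * w - ?s * exp ?s * ((H + Cm) * w) - ?N
          \<le> (\<Sum>q\<in>inner_cells \<eta> q0 L. cell_mass \<eta> (-1) q)"
        using Z(1) by simp
      then have "CM * (H * X - Cm * w - ?s * exp ?s * ((H + Cm) * w) - ?N)
          \<le> CM * (\<Sum>q\<in>inner_cells \<eta> q0 L. cell_mass \<eta> (-1) q)"
        using CM(1) by (rule mult_left_mono)
      also have "\<dots> \<le> (\<Sum>y\<in>points L. f y) + e1"
        using ge_cells cells[OF inner_subset_outer[OF \<eta>(1) L1(2)]]
        by linarith
      finally have "CM * H * X - (\<Sum>y\<in>points L. f y)
          \<le> CM * (w * (Cm + ?s * exp ?s * (H + Cm)) + ?N) + e1" by (simp add: algebra_simps)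
      also have "CM * (w * (Cm + ?s * exp ?s * (H + Cm)) + ?N)
          \<le> CE * (w * ln L * (Cm + ?s * exp ?s * (H + Cm)) + w * ln L * (?s * Cn * (c + 3)))"
      proof (rule mult_mono[OF CM(2)])
        show "w * (Cm + ?s * exp ?s * (H + Cm)) + ?N
            \<le> w * ln L * (Cm + ?s * exp ?s * (H + Cm)) + w * ln L * (?s * Cn * (c + 3))"
          by (rule add_mono[OF mult_right_mono[OF wW] N_le]) (use Cm(1) H in auto)
        show "0 \<le> CE" using CM by linarith
        show "0 \<le> w * (Cm + ?s * exp ?s * (H + Cm)) + ?N"
          using Cm(1) H N L1 w0 by (intro add_nonneg_nonneg mult_nonneg_nonneg) auto
      qed
      finally show ?thesis using e1 by (simp add: algebra_simps)
    qed
    have W0: "0 \<le> CE * (w * ln L)" using CM w0 lnL by simp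
    have "CE * (w * ln L) * (Cm + ?s * exp ?s * (H + Cm) + C1 + ?s * Cb * (c + 2)) \<le> CE * (w * ln L) * C"
      unfolding C_def using Cn(1) c(1) by (intro mult_left_mono[OF _ W0]) auto
    moreover have "CE * (w * ln L) * (Cm + ?s * exp ?s * (H + Cm) + C1 + ?s * Cn * (c + 3)) \<le> CE * (w * ln L) * C"
      unfolding C_def using Cb(1) c(1) by (intro mult_left_mono[OF _ W0]) auto
    moreover have "fact codim * CM * c_P P * L ^ k * exp (a * L) = CM * H * X"
      by (simp add: H_def X_def)
    moreover have "C * CE * (w * ln L) = CE * (w * ln L) * C" by (simp only: mult_ac)
    ultimately show ?thesis
      using upper lower unfolding w_eq abs_le_iff by linarith
  qed
  then show ?thesis by blast
qed

theorem theorem1p1: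
  fixes K :: "'k set"
    and \<alpha> :: "'n::finite \<Rightarrow> 'k \<Rightarrow> real"
    and \<omega> :: "'n \<Rightarrow> real"
    and \<Delta> A a :: real
    and P F :: "(real ^ 'n) set"
    and k :: nat
  assumes "finite K"
    and "\<And>i j. j \<in> K \<Longrightarrow> 0 \<le> \<alpha> i j"
    and "\<And>i. 0 < \<omega> i"
    and "0 < \<Delta>"
    and "P = polyhedron_P K \<alpha> \<omega>"
    and "bounded P"
    and "\<not> (\<exists>V :: (real ^ 'n) set. subspace V \<and> dim V = CARD('n) - 1 \<and> P \<subseteq> V)"
    and "a = max_value P"
    and "F = max_face P"
    and "k = max_face_dim P"
    and "\<And>i. \<not> F \<subseteq> {t. t $ i = 0}"
  shows "\<exists>C B\<^sub>0. \<forall>f CM CE. property_I A \<Delta> \<omega> CM CE f \<longrightarrow>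
           (\<forall>B \<ge> B\<^sub>0.
              \<bar>S_sum K \<alpha> f B - fact (CARD('n) - 1 - k) * CM * c_P P * (ln B) ^ k * B powr a\<bar>
              \<le> C * (CE * (ln (ln B)) ^ CARD('n) * (ln B) powi (int k - 1) * B powr a))"
proof -
  interpret hyperbola_region K \<alpha> \<omega> P
    by standard (use assms in auto)
  obtain C where C: "\<And>f CM CE L. property_I A \<Delta> \<omega> CM CE f \<Longrightarrow> L \<ge> exp 1 \<Longrightarrow>
    \<bar>(\<Sum>y\<in>points L. f y) - fact codim * CM * c_P P * L ^ k * exp (a * L)\<bar>
      \<le> C * CE * (exp (a * L) * L ^ k / L * ln L)"
    using sum_points_asymptotic[OF assms(4), of A] unfolding assms(8,10) by blast
  have "\<bar>S_sum K \<alpha> f B - fact (CARD('n) - 1 - k) * CM * c_P P * (ln B) ^ k * B powr a\<bar>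
      \<le> \<bar>C\<bar> * (CE * (ln (ln B)) ^ CARD('n) * (ln B) powi (int k - 1) * B powr a)"
    if I: "property_I A \<Delta> \<omega> CM CE f" and B: "B \<ge> exp (exp 1)" for f CM CE B
  proof -
    define L where "L = ln B"
    have "B > 0" using B by (rule less_le_trans[OF exp_gt_zero])
    then have L: "L \<ge> exp 1" "B = exp L" using B by (auto simp: L_def ln_ge_iff)
    have L0: "L > 0" using L(1) by (rule less_le_trans[OF exp_gt_zero])
    have lnL: "ln L \<ge> 1" using L(1) L0 by (simp add: ln_ge_iff)
    have CE: "0 \<le> CE" using I by (auto simp: property_I_def)
    have powr: "B powr a = exp (a * L)" using L(2) by (simp add: powr_def)
    have powi: "L powi (int k - 1) = L ^ k / L" using L0 by (simp add: power_int_diff)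
    have "\<bar>S_sum K \<alpha> f B - fact (CARD('n) - 1 - k) * CM * c_P P * L ^ k * exp (a * L)\<bar>
        \<le> C * CE * (exp (a * L) * L ^ k / L * ln L)"
      using C[OF I L(1)] unfolding L(2) S_sum_eq[OF L0] assms(10) by simp
    \<comment> \<open>\<open>ln L\<close> is at least 1 because \<open>B \<ge> exp (exp 1)\<close>\<close>
    also have "\<dots> \<le> \<bar>C\<bar> * CE * (exp (a * L) * L ^ k / L * ln L ^ CARD('n))"
    proof (rule mult_mono)
      have "ln L ^ 1 \<le> ln L ^ CARD('n)" using lnL by (intro power_increasing) (auto simp: Suc_le_eq)
      then show "exp (a * L) * L ^ k / L * ln L \<le> exp (a * L) * L ^ k / L * ln L ^ CARD('n)"
        using L0 by (intro mult_left_mono) auto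
      show "C * CE \<le> \<bar>C\<bar> * CE" using CE by (intro mult_right_mono) auto
      show "0 \<le> exp (a * L) * L ^ k / L * ln L"
        by (intro mult_nonneg_nonneg divide_nonneg_pos)
           (use L0 lnL in \<open>simp_all del: ln_ge_zero_iff\<close>)
    qed (use CE in auto)
    also have "\<dots> = \<bar>C\<bar> * (CE * (ln L) ^ CARD('n) * L powi (int k - 1) * B powr a)"
      by (simp add: powi powr)
    finally show ?thesis by (simp add: powr L_def[symmetric])
  qed
  then show ?thesis by blast
qed

end
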